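(* Let $\Gamma$ be a discrete group, let $(A_n,\tau_n)$ be a sequence of unital tracial $C^*$-algebras with $\sup_n\|\tau_n\|<\infty$, and let $\rho_n:\Gamma\to U(A_n)$ be a sequence of unital maps such that $\|\rho_n(a)\rho_n(b)-\rho_n(ab)\|\to0$ for all $a,b\in\Gamma$. Let $[\rho]\in H^2(\Gamma,Q(\mathbb{C}))$ be the associated class. If $c\in Z_2(\Gamma,\mathbb{Z})$, then $\langle[\rho],[c]\rangle\in H$, where $$H=\frac{c_0(\mathbb{N},\tau_{n*}(K_0(A_n)))}{c_{00}(\mathbb{N},\tau_{n*}(K_0(A_n)))}\subset Q(\mathbb{C}).$$
   Context: A trace $\tau_n$ on $A_n$ is a continuous linear functional with $\tau_n(xy)=\tau_n(yx)$; it is extended to matrices over $A_n$ by summing over the diagonal and induces a homomorphism $\tau_{n*}:K_0(A_n)\to\mathbb{C}$. A map $\rho_n$ is unital if $\rho_n(e)=1_n$. For $\|u-1\|<1$, $\log(u)=-\sum_{k\ge1}(1-u)^k/k$. $Q(\mathbb{C})=c_0(\mathbb{N},\mathbb{C})/c_{00}(\mathbb{N},\mathbb{C})$ (null sequences modulo finitely supported sequences), a trivial $\Gamma$-module. $c_0(\mathbb{N},\tau_{n*}(K_0(A_n)))$ is the group of null sequences $(x_n)_n$ with $x_n\in\tau_{n*}(K_0(A_n))$ for all $n$, and $c_{00}(\mathbb{N},\tau_{n*}(K_0(A_n)))$ is its subgroup of finitely supported sequences. The class $[\rho]\in H^2(\Gamma,Q(\mathbb{C}))$ is the class of the 2-cocycle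 $\omega(a,b)=\left(\frac{1}{2\pi i}\tau_n(\log(\rho_n(a)\rho_n(b)\rho_n(ab)^{-1}))\right)_n$ (components defined for all large $n$). $Z_2(\Gamma,\mathbb{Z})$ is the group of 2-cycles of the bar complex: finite sums $c=\sum_j k_j[a_j|b_j]$ with $k_j\in\mathbb{Z}$, $a_j,b_j\in\Gamma$, and $\sum_j k_j([a_j]-[a_jb_j]+[b_j])=0$. The Kronecker pairing is $\langle[\omega],[c]\rangle=\sum_jk_j\omega(a_j,b_j)$. *)

theory Defs
  imports "HOL-Analysis.Analysis" "HOL-Algebra.Module" "HOL-Algebra.Free_Abelian_Groups"
begin

section \<open>Unital C*-algebras and traces\<close>

text \<open>C*-algebras are carrier-based, so that a sequence of pairwise different algebras is a
  function from \<^typ>\<open>nat\<close> to structures. That the carriers lie in a common type is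
  no restriction, since any sequence of sets embeds into its disjoint union.\<close>

record 'a cstar_struct = "(complex, 'a) module" +
  star :: "'a \<Rightarrow> 'a"
  cnorm :: "'a \<Rightarrow> real"

definition complex_ring :: "complex ring" where
  "complex_ring = \<lparr>carrier = UNIV, monoid.mult = (*), one = 1, ring.zero = 0, ring.add = (+)\<rparr>"

text \<open>The value off the carrier only serves to meet the requirements of \<^locale>\<open>Metric_space\<close>,
  where nonnegativity and symmetry are not relativised.\<close>

definition cstar_dist :: "('a, 'b) cstar_struct_scheme \<Rightarrow> 'a \<Rightarrow> 'a \<Rightarrow> real" where
  "cstar_dist A x y =
    (if x \<in> carrier A \<and> y \<in> carrier A then cnorm A (x \<ominus>\<^bsub>A\<^esub> y) else 0)"

definition cstar_topology :: "('a, 'b) cstar_struct_scheme \<Rightarrow> 'a topology" where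
  "cstar_topology A = Metric_space.mtopology (carrier A) (cstar_dist A)"

locale unital_cstar_algebra = ring A + scalars: module complex_ring A
  for A :: "('a, 'b) cstar_struct_scheme" (structure) +
  assumes smult_mult_left:
      "\<lbrakk>x \<in> carrier A; y \<in> carrier A\<rbrakk> \<Longrightarrow> (z \<odot>\<^bsub>A\<^esub> x) \<otimes> y = z \<odot>\<^bsub>A\<^esub> (x \<otimes> y)"
    and smult_mult_right:
      "\<lbrakk>x \<in> carrier A; y \<in> carrier A\<rbrakk> \<Longrightarrow> x \<otimes> (z \<odot>\<^bsub>A\<^esub> y) = z \<odot>\<^bsub>A\<^esub> (x \<otimes> y)"
    and star_closed: "x \<in> carrier A \<Longrightarrow> star A x \<in> carrier A"
    and star_star: "x \<in> carrier A \<Longrightarrow> star A (star A x) = x"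
    and star_add:
      "\<lbrakk>x \<in> carrier A; y \<in> carrier A\<rbrakk> \<Longrightarrow> star A (x \<oplus> y) = star A x \<oplus> star A y"
    and star_smult: "x \<in> carrier A \<Longrightarrow> star A (z \<odot>\<^bsub>A\<^esub> x) = cnj z \<odot>\<^bsub>A\<^esub> star A x"
    and star_mult:
      "\<lbrakk>x \<in> carrier A; y \<in> carrier A\<rbrakk> \<Longrightarrow> star A (x \<otimes> y) = star A y \<otimes> star A x"
    and cnorm_eq_0: "x \<in> carrier A \<Longrightarrow> cnorm A x = 0 \<longleftrightarrow> x = \<zero>"
    and cnorm_triangle:
      "\<lbrakk>x \<in> carrier A; y \<in> carrier A\<rbrakk> \<Longrightarrow> cnorm A (x \<oplus> y) \<le> cnorm A x + cnorm A y"
    and cnorm_smult: "x \<in> carrier A \<Longrightarrow> cnorm A (z \<odot>\<^bsub>A\<^esub> x) = cmod z * cnorm A x"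
    and cnorm_mult:
      "\<lbrakk>x \<in> carrier A; y \<in> carrier A\<rbrakk> \<Longrightarrow> cnorm A (x \<otimes> y) \<le> cnorm A x * cnorm A y"
    and cstar_identity: "x \<in> carrier A \<Longrightarrow> cnorm A (star A x \<otimes> x) = (cnorm A x)\<^sup>2"
    and complete: "Metric_space.mcomplete (carrier A) (cstar_dist A)"

definition unitary_group :: "('a, 'b) cstar_struct_scheme \<Rightarrow> 'a set" where
  "unitary_group A =
    {u \<in> carrier A. star A u \<otimes>\<^bsub>A\<^esub> u = \<one>\<^bsub>A\<^esub> \<and> u \<otimes>\<^bsub>A\<^esub> star A u = \<one>\<^bsub>A\<^esub>}"

definition is_trace :: "('a, 'b) cstar_struct_scheme \<Rightarrow> ('a \<Rightarrow> complex) \<Rightarrow> bool" where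
  "is_trace A \<tau> \<longleftrightarrow>
    (\<forall>x\<in>carrier A. \<forall>y\<in>carrier A. \<tau> (x \<oplus>\<^bsub>A\<^esub> y) = \<tau> x + \<tau> y) \<and>
    (\<forall>z. \<forall>x\<in>carrier A. \<tau> (z \<odot>\<^bsub>A\<^esub> x) = z * \<tau> x) \<and>
    continuous_map (cstar_topology A) euclidean \<tau> \<and>
    (\<forall>x\<in>carrier A. \<forall>y\<in>carrier A. \<tau> (x \<otimes>\<^bsub>A\<^esub> y) = \<tau> (y \<otimes>\<^bsub>A\<^esub> x))"

definition functional_norm :: "('a, 'b) cstar_struct_scheme \<Rightarrow> ('a \<Rightarrow> complex) \<Rightarrow> real" where
  "functional_norm A \<tau> = (SUP x\<in>{x \<in> carrier A. cnorm A x \<le> 1}. cmod (\<tau> x))"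

definition cstar_log :: "('a, 'b) cstar_struct_scheme \<Rightarrow> 'a \<Rightarrow> 'a" where
  "cstar_log A u =
    (THE l. limitin (cstar_topology A)
      (\<lambda>N. \<ominus>\<^bsub>A\<^esub> (\<Oplus>\<^bsub>A\<^esub>k\<in>{1..N}. (1 / of_nat k) \<odot>\<^bsub>A\<^esub> ((\<one>\<^bsub>A\<^esub> \<ominus>\<^bsub>A\<^esub> u) [^]\<^bsub>A\<^esub> (k::nat))))
      l sequentially)"


section \<open>$K_0$ and the homomorphism induced by a trace\<close>

definition mats :: "('a, 'b) ring_scheme \<Rightarrow> nat \<Rightarrow> nat \<Rightarrow> (nat \<times> nat \<Rightarrow> 'a) set" where
  "mats A m n = {..<m} \<times> {..<n} \<rightarrow>\<^sub>E carrier A"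

definition mats_mult ::
  "('a, 'b) ring_scheme \<Rightarrow> nat \<Rightarrow> nat \<Rightarrow> nat \<Rightarrow> (nat \<times> nat \<Rightarrow> 'a) \<Rightarrow> (nat \<times> nat \<Rightarrow> 'a) \<Rightarrow> nat \<times> nat \<Rightarrow> 'a"
where
  "mats_mult A m k n x y =
    (\<lambda>(i, j)\<in>{..<m} \<times> {..<n}. \<Oplus>\<^bsub>A\<^esub>l\<in>{..<k}. x (i, l) \<otimes>\<^bsub>A\<^esub> y (l, j))"

text \<open>Idempotents of all matrix algebras $M_k(A)$, each paired with its size $k$. For a
  C*-algebra, $K_0$ may be built from idempotents or from self-adjoint idempotents.\<close>

type_synonym 'a sized_mat = "nat \<times> (nat \<times> nat \<Rightarrow> 'a)"

definition idempotents :: "('a, 'b) ring_scheme \<Rightarrow> 'a sized_mat set" where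
  "idempotents A = {(k, e). e \<in> mats A k k \<and> mats_mult A k k k e e = e}"

definition idem_equiv :: "('a, 'b) ring_scheme \<Rightarrow> 'a sized_mat \<Rightarrow> 'a sized_mat \<Rightarrow> bool" where
  "idem_equiv A = (\<lambda>(k, e) (l, f). \<exists>x\<in>mats A k l. \<exists>y\<in>mats A l k.
     mats_mult A k l k x y = e \<and> mats_mult A l k l y x = f)"

definition mat_dsum ::
  "('a, 'b) ring_scheme \<Rightarrow> 'a sized_mat \<Rightarrow> 'a sized_mat \<Rightarrow> 'a sized_mat" where
  "mat_dsum A = (\<lambda>(k, e) (l, f). (k + l, \<lambda>(i, j)\<in>{..<k + l} \<times> {..<k + l}.
     if i < k \<and> j < k then e (i, j)
     else if k \<le> i \<and> k \<le> j then f (i - k, j - k)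
     else \<zero>\<^bsub>A\<^esub>))"

text \<open>The Grothendieck group of the monoid of equivalence classes of idempotents:
  the pair \<open>(p, q)\<close> stands for the formal difference $[p] - [q]$.\<close>

definition K0_rel ::
  "('a, 'b) ring_scheme \<Rightarrow> (('a sized_mat \<times> 'a sized_mat) \<times> ('a sized_mat \<times> 'a sized_mat)) set"
where
  "K0_rel A = {((p, q), (p', q')).
     p \<in> idempotents A \<and> q \<in> idempotents A \<and> p' \<in> idempotents A \<and> q' \<in> idempotents A \<and>
     (\<exists>r\<in>idempotents A.
        idem_equiv A (mat_dsum A (mat_dsum A p q') r) (mat_dsum A (mat_dsum A p' q) r))}"

definition K0 :: "('a, 'b) ring_scheme \<Rightarrow> ('a sized_mat \<times> 'a sized_mat) set monoid" where
  "K0 A = \<lparr>carrier = (idempotents A \<times> idempotents A) // K0_rel A,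
     monoid.mult = (\<lambda>X Y. \<Union>x\<in>X. \<Union>y\<in>Y.
       K0_rel A `` {(mat_dsum A (fst x) (fst y), mat_dsum A (snd x) (snd y))}),
     one = K0_rel A `` {((0, \<lambda>_. undefined), (0, \<lambda>_. undefined))}\<rparr>"

definition mat_trace :: "('a \<Rightarrow> complex) \<Rightarrow> 'a sized_mat \<Rightarrow> complex" where
  "mat_trace \<tau> = (\<lambda>(k, e). \<Sum>i<k. \<tau> (e (i, i)))"

definition K0_trace :: "('a \<Rightarrow> complex) \<Rightarrow> ('a sized_mat \<times> 'a sized_mat) set \<Rightarrow> complex" where
  "K0_trace \<tau> X = the_elem ((\<lambda>(p, q). mat_trace \<tau> p - mat_trace \<tau> q) ` X)"


section \<open>Null sequences modulo finitely supported sequences\<close>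

definition c0_group :: "(nat \<Rightarrow> complex set) \<Rightarrow> (nat \<Rightarrow> complex) monoid" where
  "c0_group G = \<lparr>carrier = {x. (\<forall>n. x n \<in> G n) \<and> x \<longlonglongrightarrow> 0},
     monoid.mult = (\<lambda>x y n. x n + y n), one = (\<lambda>n. 0)\<rparr>"

definition c00 :: "(nat \<Rightarrow> complex set) \<Rightarrow> (nat \<Rightarrow> complex) set" where
  "c00 G = {x. (\<forall>n. x n \<in> G n) \<and> finite {n. x n \<noteq> 0}}"

definition Q_C :: "(nat \<Rightarrow> complex) set monoid" where
  "Q_C = c0_group (\<lambda>_. UNIV) Mod c00 (\<lambda>_. UNIV)"

text \<open>The quotient $c_0(G)/c_{00}(G)$ regarded as a subset of $Q(\mathbb{C})$, i.e. its image under
  $x + c_{00}(G) \mapsto x + c_{00}(\mathbb{C})$.\<close>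

definition Q_sub :: "(nat \<Rightarrow> complex set) \<Rightarrow> (nat \<Rightarrow> complex) set set" where
  "Q_sub G = (\<lambda>X. c00 (\<lambda>_. UNIV) <#>\<^bsub>c0_group (\<lambda>_. UNIV)\<^esub> X) ` carrier (c0_group G Mod c00 G)"


section \<open>Second homology and cohomology of a group via the bar complex\<close>

definition bar2 :: "('g, 'm) monoid_scheme \<Rightarrow> ('g \<times> 'g \<Rightarrow>\<^sub>0 int) monoid" where
  "bar2 \<Gamma> = free_Abelian_group (carrier \<Gamma> \<times> carrier \<Gamma>)"

definition bar_boundary2 ::
  "('g, 'm) monoid_scheme \<Rightarrow> ('g \<times> 'g \<Rightarrow>\<^sub>0 int) \<Rightarrow> ('g \<Rightarrow>\<^sub>0 int)" where
  "bar_boundary2 \<Gamma> = frag_extend (\<lambda>(a, b). frag_of a - frag_of (a \<otimes>\<^bsub>\<Gamma>\<^esub> b) + frag_of b)"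

definition bar_boundary3 ::
  "('g, 'm) monoid_scheme \<Rightarrow> ('g \<times> 'g \<times> 'g \<Rightarrow>\<^sub>0 int) \<Rightarrow> ('g \<times> 'g \<Rightarrow>\<^sub>0 int)" where
  "bar_boundary3 \<Gamma> = frag_extend (\<lambda>(a, b, c).
     frag_of (b, c) - frag_of (a \<otimes>\<^bsub>\<Gamma>\<^esub> b, c) + frag_of (a, b \<otimes>\<^bsub>\<Gamma>\<^esub> c) - frag_of (a, b))"

definition cycles2 :: "('g, 'm) monoid_scheme \<Rightarrow> ('g \<times> 'g \<Rightarrow>\<^sub>0 int) set" where
  "cycles2 \<Gamma> = {c \<in> carrier (bar2 \<Gamma>). bar_boundary2 \<Gamma> c = 0}"

definition boundaries2 :: "('g, 'm) monoid_scheme \<Rightarrow> ('g \<times> 'g \<Rightarrow>\<^sub>0 int) set" where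
  "boundaries2 \<Gamma> = bar_boundary3 \<Gamma> `
     carrier (free_Abelian_group (carrier \<Gamma> \<times> carrier \<Gamma> \<times> carrier \<Gamma>))"

definition homology2 :: "('g, 'm) monoid_scheme \<Rightarrow> ('g \<times> 'g \<Rightarrow>\<^sub>0 int) set monoid" where
  "homology2 \<Gamma> = (bar2 \<Gamma>)\<lparr>carrier := cycles2 \<Gamma>\<rparr> Mod boundaries2 \<Gamma>"

definition homology2_class ::
  "('g, 'm) monoid_scheme \<Rightarrow> ('g \<times> 'g \<Rightarrow>\<^sub>0 int) \<Rightarrow> ('g \<times> 'g \<Rightarrow>\<^sub>0 int) set" where
  "homology2_class \<Gamma> c = boundaries2 \<Gamma> #>\<^bsub>bar2 \<Gamma>\<^esub> c"

text \<open>Coefficients: an abelian group \<open>M\<close>, written multiplicatively, with trivial action.\<close>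

definition cochains2 ::
  "('g, 'm) monoid_scheme \<Rightarrow> ('c, 'n) monoid_scheme \<Rightarrow> ('g \<times> 'g \<Rightarrow> 'c) monoid" where
  "cochains2 \<Gamma> M = product_group (carrier \<Gamma> \<times> carrier \<Gamma>) (\<lambda>_. M)"

definition cocycles2 ::
  "('g, 'm) monoid_scheme \<Rightarrow> ('c, 'n) monoid_scheme \<Rightarrow> ('g \<times> 'g \<Rightarrow> 'c) set" where
  "cocycles2 \<Gamma> M = {\<omega> \<in> carrier (cochains2 \<Gamma> M).
     \<forall>a\<in>carrier \<Gamma>. \<forall>b\<in>carrier \<Gamma>. \<forall>c\<in>carrier \<Gamma>.
       \<omega> (b, c) \<otimes>\<^bsub>M\<^esub> \<omega> (a, b \<otimes>\<^bsub>\<Gamma>\<^esub> c) = \<omega> (a \<otimes>\<^bsub>\<Gamma>\<^esub> b, c) \<otimes>\<^bsub>M\<^esub> \<omega> (a, b)}"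

definition coboundaries2 ::
  "('g, 'm) monoid_scheme \<Rightarrow> ('c, 'n) monoid_scheme \<Rightarrow> ('g \<times> 'g \<Rightarrow> 'c) set" where
  "coboundaries2 \<Gamma> M =
     (\<lambda>\<phi>. \<lambda>(a, b)\<in>carrier \<Gamma> \<times> carrier \<Gamma>. \<phi> a \<otimes>\<^bsub>M\<^esub> inv\<^bsub>M\<^esub> \<phi> (a \<otimes>\<^bsub>\<Gamma>\<^esub> b) \<otimes>\<^bsub>M\<^esub> \<phi> b) `
     (carrier \<Gamma> \<rightarrow> carrier M)"

definition cohomology2 ::
  "('g, 'm) monoid_scheme \<Rightarrow> ('c, 'n) monoid_scheme \<Rightarrow> ('g \<times> 'g \<Rightarrow> 'c) set monoid" where
  "cohomology2 \<Gamma> M = (cochains2 \<Gamma> M)\<lparr>carrier := cocycles2 \<Gamma> M\<rparr> Mod coboundaries2 \<Gamma> M"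

definition cohomology2_class ::
  "('g, 'm) monoid_scheme \<Rightarrow> ('c, 'n) monoid_scheme \<Rightarrow> ('g \<times> 'g \<Rightarrow> 'c) \<Rightarrow> ('g \<times> 'g \<Rightarrow> 'c) set"
where
  "cohomology2_class \<Gamma> M \<omega> = coboundaries2 \<Gamma> M #>\<^bsub>cochains2 \<Gamma> M\<^esub> \<omega>"

definition cochain_eval ::
  "('c, 'n) monoid_scheme \<Rightarrow> ('g \<times> 'g \<Rightarrow> 'c) \<Rightarrow> ('g \<times> 'g \<Rightarrow>\<^sub>0 int) \<Rightarrow> 'c" where
  "cochain_eval M \<omega> c =
     (\<Otimes>\<^bsub>M\<^esub>s\<in>Poly_Mapping.keys c. \<omega> s [^]\<^bsub>M\<^esub> Poly_Mapping.lookup c s)"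

text \<open>The Kronecker pairing of $H^2(\Gamma, M)$ with $H_2(\Gamma, \mathbb{Z})$, computed on representatives.\<close>

definition kronecker ::
  "('c, 'n) monoid_scheme \<Rightarrow> ('g \<times> 'g \<Rightarrow> 'c) set \<Rightarrow> ('g \<times> 'g \<Rightarrow>\<^sub>0 int) set \<Rightarrow> 'c" where
  "kronecker M X Y = the_elem ((\<lambda>(\<omega>, c). cochain_eval M \<omega> c) ` (X \<times> Y))"


section \<open>The class of an asymptotic homomorphism\<close>

text \<open>Where the logarithm series is not known to converge the component is set to \<open>0\<close>; this
  concerns finitely many \<open>n\<close> only and is invisible in $Q(\mathbb{C})$.\<close>

definition defect_seq ::
  "('g, 'm) monoid_scheme \<Rightarrow> (nat \<Rightarrow> ('a, 'b) cstar_struct_scheme) \<Rightarrow> (nat \<Rightarrow> 'a \<Rightarrow> complex) \<Rightarrow>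
   (nat \<Rightarrow> 'g \<Rightarrow> 'a) \<Rightarrow> 'g \<Rightarrow> 'g \<Rightarrow> nat \<Rightarrow> complex"
where
  "defect_seq \<Gamma> A \<tau> \<rho> a b n =
    (let u = \<rho> n a \<otimes>\<^bsub>A n\<^esub> \<rho> n b \<otimes>\<^bsub>A n\<^esub> inv\<^bsub>A n\<^esub> (\<rho> n (a \<otimes>\<^bsub>\<Gamma>\<^esub> b))
     in if cnorm (A n) (u \<ominus>\<^bsub>A n\<^esub> \<one>\<^bsub>A n\<^esub>) < 1
        then 1 / (2 * of_real pi * \<i>) * \<tau> n (cstar_log (A n) u) else 0)"

definition defect_cocycle ::
  "('g, 'm) monoid_scheme \<Rightarrow> (nat \<Rightarrow> ('a, 'b) cstar_struct_scheme) \<Rightarrow> (nat \<Rightarrow> 'a \<Rightarrow> complex) \<Rightarrow>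
   (nat \<Rightarrow> 'g \<Rightarrow> 'a) \<Rightarrow> 'g \<times> 'g \<Rightarrow> (nat \<Rightarrow> complex) set"
where
  "defect_cocycle \<Gamma> A \<tau> \<rho> =
    (\<lambda>(a, b)\<in>carrier \<Gamma> \<times> carrier \<Gamma>.
       c00 (\<lambda>_. UNIV) #>\<^bsub>c0_group (\<lambda>_. UNIV)\<^esub> defect_seq \<Gamma> A \<tau> \<rho> a b)"

definition rho_class ::
  "('g, 'm) monoid_scheme \<Rightarrow> (nat \<Rightarrow> ('a, 'b) cstar_struct_scheme) \<Rightarrow> (nat \<Rightarrow> 'a \<Rightarrow> complex) \<Rightarrow>
   (nat \<Rightarrow> 'g \<Rightarrow> 'a) \<Rightarrow> ('g \<times> 'g \<Rightarrow> (nat \<Rightarrow> complex) set) set"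
where
  "rho_class \<Gamma> A \<tau> \<rho> = cohomology2_class \<Gamma> Q_C (defect_cocycle \<Gamma> A \<tau> \<rho>)"

end

theory Submission
  imports Defs
begin

text \<open>Let \<open>\<Delta>\<close> be the logarithm of the de la Harpe--Skandalis determinant: a path \<open>F\<close> from \<open>1\<close> to \<open>g\<close> in
  $GL_m(A)$ gives the value \<open>\<integral> \<tau> (F' F\<^sup>-\<^sup>1)\<close>. It turns products into sums, it is \<open>\<tau> (log u)\<close> for \<open>u\<close> near
  \<open>1\<close>, and \<open>0\<close> is one of its values at a commutator by Whitehead's lemma. Bott periodicity says that its values
  at \<open>1\<close> lie in $2 \pi i\, \tau_*(K_0(A))$: a loop is approximated by a trigonometric polynomial, made a
  polynomial \<open>a\<close> in \<open>z\<close> by a power of \<open>z\<close>, and the Wiener--Hopf compression of \<open>a\<close> yields an explicit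
  idempotent matrix whose trace is the total logarithmic derivative. For a 2-cycle $\sum_j k_j [a_j|b_j]$ the
  elements $\rho(a_j) \rho(b_j) \rho(a_j b_j)^{-1}$, raised to the powers $k_j$, multiply to \<open>1\<close> modulo
  commutators, hence $\sum_j k_j \tau(\log(\rho(a_j) \rho(b_j) \rho(a_j b_j)^{-1}))$ is a value at \<open>1\<close>.\<close>

section \<open>Traces and logarithmic derivatives in complex Banach algebras\<close>

text \<open>The logarithm of the determinant has many values, so it is kept as a relation between
  units and complex numbers. The laws for products, inverses, conjugates and commutators make its
  graph a normal subgroup with abelian quotient in the product of the unit group and the complex
  numbers, and the cycle condition is used in that quotient. Each \<open>n\<close> is treated
  separately and exactly; the asymptotic hypothesis brings the finitely many defects of a cycle into
  the domain of the logarithm and makes the cocycle a null sequence. Paths are polynomial because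
  this class is closed under the operations behind those laws and because, for a loop based at 1,
  approximation reduces to the scalar functions \<open>t ^ k - t\<close>, to which Stone-Weierstrass
  on the circle applies. The compression gives an idempotent that need not be self-adjoint, and the
  power of \<open>z\<close> that clears negative frequencies costs a multiple of the class of the
  unit; hence a difference of two idempotents. The compression is a matrix over 3 by 3 matrices and
  is flattened at the end.\<close>

text \<open>\<^class>\<open>monoid_mult\<close> instead of \<^class>\<open>real_normed_algebra_1\<close>, because the norm put on matrices
  below violates \<open>norm 1 = 1\<close> and the zero algebra violates \<open>0 \<noteq> 1\<close>.\<close>

class complex_banach_algebra = real_normed_algebra + banach + monoid_mult +
  fixes scaleC :: "complex \<Rightarrow> 'a \<Rightarrow> 'a"
  assumes scaleC_add_right: "scaleC z (x + y) = scaleC z x + scaleC z y"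
    and scaleC_add_left: "scaleC (z + w) x = scaleC z x + scaleC w x"
    and scaleC_scaleC: "scaleC z (scaleC w x) = scaleC (z * w) x"
    and scaleC_of_real: "scaleC (of_real r) x = r *\<^sub>R x"
    and scaleC_mult_left: "scaleC z x * y = scaleC z (x * y)"
    and scaleC_mult_right: "x * scaleC z y = scaleC z (x * y)"
    and norm_scaleC: "norm (scaleC z x) = cmod z * norm x"
begin

lemma scaleC_one: "scaleC 1 x = x"
  using scaleC_of_real[of 1 x] by (simp add: scaleR_one)

end

lemma bounded_bilinear_scaleC:
  "bounded_bilinear (scaleC :: complex \<Rightarrow> 'a::complex_banach_algebra \<Rightarrow> 'a)"
proof
  show "scaleC (r *\<^sub>R z) x = r *\<^sub>R scaleC z x" for r z and x :: 'a
    by (metis scaleC_of_real scaleC_scaleC scaleR_conv_of_real)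
  show "scaleC z (r *\<^sub>R x) = r *\<^sub>R scaleC z x" for r z and x :: 'a
    by (metis scaleC_of_real scaleC_scaleC mult.commute)
  show "\<exists>K. \<forall>z (x::'a). norm (scaleC z x) \<le> cmod z * norm x * K"
    by (intro exI[of _ 1]) (simp add: norm_scaleC)
qed (simp_all add: scaleC_add_left scaleC_add_right)

lemmas scaleC_sum_right = bounded_bilinear.sum_right[OF bounded_bilinear_scaleC]
lemmas scaleC_zero_left = bounded_bilinear.zero_left[OF bounded_bilinear_scaleC]
lemmas continuous_on_scaleC = bounded_bilinear.continuous_on[OF bounded_bilinear_scaleC]
lemmas bounded_linear_scaleC_right = bounded_bilinear.bounded_linear_right[OF bounded_bilinear_scaleC]

section \<open>Units, Neumann series and paths of inverses\<close>

text \<open>A relation with an explicit second element, since the class has no inverse operation;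
  for a path of units the inverses form a second path whose regularity is then derived.\<close>

definition is_inverse :: "'a::monoid_mult \<Rightarrow> 'a \<Rightarrow> bool" where
  "is_inverse x y \<longleftrightarrow> x * y = 1 \<and> y * x = 1"

lemma is_inverse_sym: "is_inverse x y \<Longrightarrow> is_inverse y x"
  by (simp add: is_inverse_def)

lemma is_inverse_mult: "is_inverse x y \<Longrightarrow> is_inverse x' y' \<Longrightarrow> is_inverse (x * x') (y' * y)"
  unfolding is_inverse_def by (metis mult.assoc mult.left_neutral)

lemma is_inverse_unique: "is_inverse x y \<Longrightarrow> is_inverse x y' \<Longrightarrow> y = y'"
  unfolding is_inverse_def by (metis mult.assoc mult.left_neutral mult.right_neutral)

lemma is_inverse_cancel:
  assumes "is_inverse x y"
  shows "x * (y * a) = a" "y * (x * a) = a" "x * y = 1" "y * x = 1"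
  using assms unfolding is_inverse_def by (metis mult.assoc mult.left_neutral)+

text \<open>Restricted to positive exponents because \<open>norm 1\<close> may exceed 1: in the norm
  put on matrices below, every diagonal entry of the identity contributes.\<close>

lemma norm_power_Suc_le:
  fixes x :: "'a::{real_normed_algebra, monoid_mult}"
  shows "norm (x ^ Suc n) \<le> norm x ^ Suc n"
proof (induction n)
  case (Suc n)
  have "norm (x ^ Suc (Suc n)) \<le> norm x * norm (x ^ Suc n)"
    using norm_mult_ineq by (metis power_Suc)
  also have "\<dots> \<le> norm x * norm x ^ Suc n"
    by (rule mult_left_mono[OF Suc]) simp
  finally show ?case by simp
qed simp

lemma is_inverse_one_minus:
  fixes x :: "'a::{real_normed_algebra, monoid_mult, banach}"
  assumes "norm x < 1"
  shows "\<exists>y. is_inverse (1 - x) y"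
proof -
  have "summable (\<lambda>n. x ^ Suc n)"
  proof (rule summable_comparison_test)
    show "\<exists>N. \<forall>n\<ge>N. norm (x ^ Suc n) \<le> norm x ^ Suc n"
      using norm_power_Suc_le by blast
    show "summable (\<lambda>n. norm x ^ Suc n)"
      using assms by (subst summable_Suc_iff) (simp add: summable_geometric)
  qed
  then have s: "summable (\<lambda>n. x ^ n)"
    by (rule summable_Suc_iff[THEN iffD1])
  define y where "y = suminf (\<lambda>n. x ^ n)"
  have "x * y = suminf (\<lambda>n. x ^ Suc n)"
    unfolding y_def power_Suc by (rule suminf_mult[OF s, symmetric])
  moreover have "y * x = suminf (\<lambda>n. x ^ Suc n)"
    unfolding y_def power_Suc2 by (rule suminf_mult2[OF s])
  moreover have "suminf (\<lambda>n. x ^ Suc n) = y - 1"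
    unfolding y_def using suminf_split_head[OF s] by (simp only: power_0)
  ultimately have "x * y = y - 1" "y * x = y - 1"
    by (simp_all only:)
  then have "is_inverse (1 - x) y"
    by (simp add: is_inverse_def left_diff_distrib right_diff_distrib)
  then show ?thesis ..
qed

text \<open>The identity \<open>G s - G t = - (G s * (F s - F t) * G t)\<close> controls the
  difference once \<open>G s\<close> is bounded near \<open>t\<close>, and the same identity
  supplies this bound.\<close>

lemma inverse_path_continuous:
  fixes F G :: "real \<Rightarrow> 'a::{real_normed_algebra, monoid_mult}"
  assumes F: "continuous_on S F" and inv: "\<And>t. t \<in> S \<Longrightarrow> is_inverse (F t) (G t)"
  shows "continuous_on S G"
  unfolding continuous_on_def
proof
  fix t assume t: "t \<in> S"
  have eq: "G s - G t = - (G s * (F s - F t) * G t)" if "s \<in> S" for s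
    using is_inverse_cancel[OF inv[OF t]] is_inverse_cancel[OF inv[OF that]] by (simp add: algebra_simps)
  have Ft: "((\<lambda>s. norm (F s - F t)) \<longlongrightarrow> 0) (at t within S)"
    using F t by (simp add: continuous_on_def LIM_zero tendsto_norm_zero)
  define K where "K = norm (G t)"
  have "((\<lambda>s. norm (F s - F t) * K) \<longlongrightarrow> 0 * K) (at t within S)"
    by (intro tendsto_intros Ft)
  \<comment> \<open>Below the threshold 1/2 the identity yields
    \<open>norm (G s) \<le> K + norm (G s) / 2\<close>, hence
    \<open>norm (G s) \<le> 2 * K\<close>.\<close>
  then have "eventually (\<lambda>s. norm (F s - F t) * K < 1 / 2) (at t within S)"
    by (rule order_tendstoD) simp
  moreover have "eventually (\<lambda>s. s \<in> S) (at t within S)"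
    by (simp add: eventually_at_filter)
  ultimately have ev: "eventually (\<lambda>s. norm (G s - G t) \<le> 2 * K * norm (F s - F t) * K) (at t within S)"
  proof eventually_elim
    case (elim s)
    have b: "norm (G s - G t) \<le> norm (G s) * norm (F s - F t) * K"
      unfolding eq[OF elim(2)] norm_minus_cancel K_def
      by (meson norm_mult_ineq mult_right_mono norm_ge_zero order_trans)
    also have "\<dots> = norm (G s) * (norm (F s - F t) * K)"
      by simp
    also have "\<dots> \<le> norm (G s) * (1 / 2)"
      by (intro mult_left_mono) (use elim in auto)
    finally have "norm (G s) \<le> 2 * K"
      using norm_triangle_sub[of "G s" "G t"] by (simp add: K_def)
    then have "norm (G s) * (norm (F s - F t) * K) \<le> 2 * K * (norm (F s - F t) * K)"
      by (intro mult_right_mono) (auto simp: K_def)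
    with b show ?case by (simp add: mult.assoc)
  qed
  have "((\<lambda>s. 2 * K * norm (F s - F t) * K) \<longlongrightarrow> 2 * K * 0 * K) (at t within S)"
    by (intro tendsto_intros Ft)
  then have "((\<lambda>s. G s - G t) \<longlongrightarrow> 0) (at t within S)"
    by (intro Lim_null_comparison[OF ev]) simp
  then show "(G \<longlongrightarrow> G t) (at t within S)"
    by (rule LIM_zero_cancel)
qed

lemma has_vector_derivative_within_iff_tendsto:
  "(f has_vector_derivative D) (at x within S) \<longleftrightarrow>
     ((\<lambda>y. (f y - f x) /\<^sub>R (y - x)) \<longlongrightarrow> D) (at x within S)"
proof -
  have eq: "eventually (\<lambda>y. norm ((f y - f x) - (y - x) *\<^sub>R D) / norm (y - x)
          = norm ((f y - f x) /\<^sub>R (y - x) - D)) (at x within S)"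
    unfolding eventually_at_filter
  proof (intro always_eventually allI impI)
    fix y assume "y \<noteq> x"
    then have "(f y - f x) /\<^sub>R (y - x) - D = ((f y - f x) - (y - x) *\<^sub>R D) /\<^sub>R (y - x)"
      by (simp add: scaleR_diff_right)
    then show "norm ((f y - f x) - (y - x) *\<^sub>R D) / norm (y - x) = norm ((f y - f x) /\<^sub>R (y - x) - D)"
      by (simp add: divide_inverse mult.commute)
  qed
  show ?thesis
    unfolding has_vector_derivative_def has_derivative_iff_norm tendsto_cong[OF eq]
    by (simp add: bounded_linear_scaleR_left tendsto_norm_zero_iff LIM_zero_iff)
qed

text \<open>Divide the identity for \<open>G s - G t\<close> by \<open>s - t\<close> and let
  \<open>s\<close> tend to \<open>t\<close>; the factor \<open>G s\<close> converges by continuity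
  of the inverse path.\<close>

lemma inverse_path_derivative:
  fixes F G :: "real \<Rightarrow> 'a::{real_normed_algebra, monoid_mult}"
  assumes F: "\<And>t. t \<in> S \<Longrightarrow> (F has_vector_derivative F' t) (at t within S)"
    and inv: "\<And>t. t \<in> S \<Longrightarrow> is_inverse (F t) (G t)" and t: "t \<in> S"
  shows "(G has_vector_derivative - (G t * F' t * G t)) (at t within S)"
proof -
  have "continuous_on S F"
    by (meson F has_vector_derivative_continuous continuous_on_eq_continuous_within)
  then have "continuous_on S G"
    using inv by (rule inverse_path_continuous)
  then have G: "(G \<longlongrightarrow> G t) (at t within S)"
    using t by (simp add: continuous_on_def)
  have "((\<lambda>s. (F s - F t) /\<^sub>R (s - t)) \<longlongrightarrow> F' t) (at t within S)"
    using F[OF t] by (simp add: has_vector_derivative_within_iff_tendsto)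
  then have lim: "((\<lambda>s. - (G s * ((F s - F t) /\<^sub>R (s - t)) * G t)) \<longlongrightarrow> - (G t * F' t * G t)) (at t within S)"
    by (intro tendsto_intros G)
  have "eventually (\<lambda>s. s \<in> S) (at t within S)"
    by (simp add: eventually_at_filter)
  then have "eventually (\<lambda>s. - (G s * ((F s - F t) /\<^sub>R (s - t)) * G t) = (G s - G t) /\<^sub>R (s - t)) (at t within S)"
  proof eventually_elim
    case (elim s)
    have "G s - G t = - (G s * (F s - F t) * G t)"
      using is_inverse_cancel[OF inv[OF t]] is_inverse_cancel[OF inv[OF elim]] by (simp add: algebra_simps)
    then show ?case by simp
  qed
  then have "((\<lambda>s. (G s - G t) /\<^sub>R (s - t)) \<longlongrightarrow> - (G t * F' t * G t)) (at t within S)"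
    by (rule Lim_transform_eventually[OF lim])
  then show ?thesis
    by (simp add: has_vector_derivative_within_iff_tendsto)
qed


section \<open>Bounded traces and the trace of the logarithm\<close>

locale bounded_trace =
  fixes \<tau> :: "'r::complex_banach_algebra \<Rightarrow> complex"
  assumes blin: "bounded_linear \<tau>"
    and scale: "\<tau> (scaleC z x) = z * \<tau> x"
    and commute: "\<tau> (x * y) = \<tau> (y * x)"
begin

lemmas linear_simps = linear_add[OF bounded_linear.linear[OF blin]]
  linear_diff[OF bounded_linear.linear[OF blin]] linear_neg[OF bounded_linear.linear[OF blin]]
  linear_0[OF bounded_linear.linear[OF blin]] linear_sum[OF bounded_linear.linear[OF blin]]

lemma continuous_on [continuous_intros]:
  "continuous_on S f \<Longrightarrow> continuous_on S (\<lambda>x. \<tau> (f x))"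
  by (rule bounded_linear.continuous_on[OF blin])

lemma bound: "\<exists>K>0. \<forall>x. norm (\<tau> x) \<le> K * norm x"
  using bounded_linear.pos_bounded[OF blin] by (metis mult.commute)

lemma conjugate: "is_inverse g h \<Longrightarrow> \<tau> (g * x * h) = \<tau> x"
  by (metis commute is_inverse_cancel(2) mult.assoc)

text \<open>This is minus the trace of the logarithm of \<open>1 - x\<close>, with the trace taken
  termwise, so that no logarithm in the algebra is involved.\<close>

definition log_series :: "'r \<Rightarrow> complex" where
  "log_series x = suminf (\<lambda>k. \<tau> (x ^ Suc k) / of_nat (Suc k))"

lemma summable_log_series:
  assumes "norm x < 1"
  shows "summable (\<lambda>k. \<tau> (x ^ Suc k) / of_nat (Suc k))"
proof -
  obtain K where K: "K > 0" "\<And>x. norm (\<tau> x) \<le> K * norm x"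
    using bound by blast
  show ?thesis
  proof (rule summable_comparison_test)
    have "norm (\<tau> (x ^ Suc k) / of_nat (Suc k)) \<le> K * norm x ^ Suc k" for k
    proof -
      have "norm (\<tau> (x ^ Suc k) / of_nat (Suc k)) \<le> norm (\<tau> (x ^ Suc k))"
        using mult_right_mono[of 1 "real (Suc k)" "norm (\<tau> (x ^ Suc k))"]
        by (simp add: norm_divide divide_le_eq mult.commute del: power_Suc of_nat_Suc)
      also have "\<dots> \<le> K * norm (x ^ Suc k)"
        by (rule K)
      also have "\<dots> \<le> K * norm x ^ Suc k"
        by (intro mult_left_mono norm_power_Suc_le) (use K in auto)
      finally show ?thesis .
    qed
    then show "\<exists>N. \<forall>k\<ge>N. norm (\<tau> (x ^ Suc k) / of_nat (Suc k)) \<le> K * norm x ^ Suc k"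
      by blast
    show "summable (\<lambda>k. K * norm x ^ Suc k)"
      using assms by (intro summable_mult) (subst summable_Suc_iff, simp add: summable_geometric)
  qed
qed

lemma log_series_zero [simp]: "log_series 0 = 0"
  by (simp add: log_series_def linear_simps)

text \<open>The derivative of a power is the sum of the products
  \<open>r ^ i * r' * r ^ (n - 1 - i)\<close>, and only the trace makes these terms equal. The extra
  factor \<open>r t ^ m\<close> carries the induction, in which one factor \<open>r t\<close> is
  absorbed into it. For \<open>n = 0\<close> the exponent may be truncated, but then its coefficient
  is 0.\<close>

lemma power_has_vector_derivative:
  assumes "(r has_vector_derivative r') (at t within S)"
  shows "\<exists>D. ((\<lambda>s. r s ^ n) has_vector_derivative D) (at t within S) \<and>
    (\<forall>m. \<tau> (D * r t ^ m) = of_nat n * \<tau> (r' * r t ^ (n + m - 1)))"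
proof (induction n)
  case 0
  show ?case by (intro exI[of _ 0]) (simp add: linear_simps)
next
  case (Suc n)
  then obtain D where D: "((\<lambda>s. r s ^ n) has_vector_derivative D) (at t within S)"
    and Dm: "\<And>m. \<tau> (D * r t ^ m) = of_nat n * \<tau> (r' * r t ^ (n + m - 1))"
    by blast
  have "((\<lambda>s. r s ^ n * r s) has_vector_derivative (r t ^ n * r' + D * r t)) (at t within S)"
    by (rule has_vector_derivative_mult[OF D assms])
  moreover have "\<tau> ((r t ^ n * r' + D * r t) * r t ^ m) = of_nat (Suc n) * \<tau> (r' * r t ^ (Suc n + m - 1))" for m
  proof -
    have "\<tau> (r t ^ n * r' * r t ^ m) = \<tau> (r' * r t ^ m * r t ^ n)"
      by (metis commute mult.assoc)
    also have "r' * r t ^ m * r t ^ n = r' * r t ^ (n + m)"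
      by (simp add: mult.assoc power_add[symmetric] add.commute)
    finally have 1: "\<tau> (r t ^ n * r' * r t ^ m) = \<tau> (r' * r t ^ (n + m))" .
    have 2: "\<tau> (D * r t * r t ^ m) = of_nat n * \<tau> (r' * r t ^ (n + m))"
      using Dm[of "Suc m"] by (simp add: mult.assoc)
    show ?thesis
      by (simp only: distrib_right linear_simps(1) 1 2) (simp add: algebra_simps)
  qed
  ultimately show ?case
    by (intro exI[of _ "r t ^ n * r' + D * r t"]) (simp add: power_commutes del: add_Suc)
qed

text \<open>Expand \<open>(1 - r)\<^sup>-\<^sup>1\<close> in a geometric series and integrate termwise.\<close>

lemma log_series_has_integral:
  assumes r: "\<And>t. t \<in> {0..1} \<Longrightarrow> (r has_vector_derivative r' t) (at t within {0..1})"
    and r': "continuous_on {0..1} r'"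
    and q: "\<And>t. t \<in> {0..1} \<Longrightarrow> norm (r t) \<le> q" "q < 1"
    and H: "\<And>t. t \<in> {0..1} \<Longrightarrow> is_inverse (1 - r t) (H t)"
  shows "((\<lambda>t. \<tau> (r' t * H t)) has_integral (log_series (r 1) - log_series (r 0))) {0..1::real}"
proof -
  obtain K where K: "K > 0" "\<And>x. norm (\<tau> x) \<le> K * norm x"
    using bound by blast
  have cr: "continuous_on {0..1} r"
    by (meson r has_vector_derivative_continuous continuous_on_eq_continuous_within)
  have cH: "continuous_on {0..1} H"
    by (rule inverse_path_continuous[OF _ H]) (auto intro!: continuous_intros cr)
  define I where "I = integral {0..1} (\<lambda>t. \<tau> (r' t * H t))"
  have cI: "continuous_on {0..1} (\<lambda>t. \<tau> (r' t * H t))"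
    by (intro continuous_intros r' cH)
  then have int: "(\<lambda>t. \<tau> (r' t * H t)) integrable_on {0..1}"
    by (rule integrable_continuous_interval)
  have "compact ((\<lambda>t. norm (r' t) * norm (H t)) ` {0..1::real})"
    by (intro compact_continuous_image continuous_intros r' cH) auto
  then obtain C where "\<forall>x\<in>(\<lambda>t. norm (r' t) * norm (H t)) ` {0..1::real}. norm x \<le> C"
    using compact_imp_bounded bounded_iff by metis
  then have C: "norm (r' t) * norm (H t) \<le> C" if "t \<in> {0..1}" for t
    using that by fastforce
  have q0: "0 \<le> q"
    using order_trans[OF norm_ge_zero q(1)[of 0]] by simp
  define T where "T n t = (\<Sum>k<n. \<tau> (r t ^ Suc k) / of_nat (Suc k))" for n and t :: real
  have T: "(T n has_vector_derivative (\<Sum>k<n. \<tau> (r' t * r t ^ k))) (at t within {0..1})" if t: "t \<in> {0..1}" for n t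
    unfolding T_def
  proof (intro has_vector_derivative_sum)
    fix k
    obtain D where D: "((\<lambda>s. r s ^ Suc k) has_vector_derivative D) (at t within {0..1})"
      and Dm: "\<And>m. \<tau> (D * r t ^ m) = of_nat (Suc k) * \<tau> (r' t * r t ^ (Suc k + m - 1))"
      using power_has_vector_derivative[OF r[OF t], of "Suc k"] by blast
    have "\<tau> D = of_nat (Suc k) * \<tau> (r' t * r t ^ k)"
      using Dm[of 0] by simp
    moreover have "((\<lambda>s. \<tau> (r s ^ Suc k)) has_vector_derivative \<tau> D) (at t within {0..1})"
      by (rule bounded_linear.has_vector_derivative[OF blin D])
    ultimately show "((\<lambda>s. \<tau> (r s ^ Suc k) / of_nat (Suc k)) has_vector_derivative \<tau> (r' t * r t ^ k)) (at t within {0..1})"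
      using has_vector_derivative_divide[of "\<lambda>s. \<tau> (r s ^ Suc k)" "\<tau> D" "at t within {0..1}" "of_nat (Suc k)"]
      by (simp del: power_Suc of_nat_Suc)
  qed
  have ftc: "((\<lambda>t. \<Sum>k<n. \<tau> (r' t * r t ^ k)) has_integral (T n 1 - T n 0)) {0..1}" for n
    by (rule fundamental_theorem_of_calculus) (use T in auto)
  \<comment> \<open>\<open>n > 0\<close> because \<open>norm (r t ^ n) \<le> q ^ n\<close> may fail
    at exponent 0.\<close>
  have bd: "norm (I - (T n 1 - T n 0)) \<le> K * C * q ^ n" if n: "n > 0" for n
  proof -
    have cd: "continuous_on {0..1} (\<lambda>t. \<tau> (r' t * H t) - (\<Sum>k<n. \<tau> (r' t * r t ^ k)))"
      by (intro continuous_intros cI r' cr)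
    have "norm (integral {0..1} (\<lambda>t. \<tau> (r' t * H t) - (\<Sum>k<n. \<tau> (r' t * r t ^ k)))) \<le> (K * C * q ^ n) * (1 - 0)"
    proof (rule integral_bound[OF _ cd])
      fix t :: real assume t: "t \<in> {0..1}"
      have "(1 - r t) * (\<Sum>k<n. r t ^ k) = 1 - r t ^ n"
      proof (induction n)
        case (Suc n)
        have "(1 - r t) * (\<Sum>k<Suc n. r t ^ k) = (1 - r t ^ n) + (1 - r t) * r t ^ n"
          using Suc by (simp only: sum.lessThan_Suc distrib_left)
        also have "\<dots> = 1 - r t ^ Suc n"
          by (simp add: left_diff_distrib)
        finally show ?case .
      qed simp
      then have "H t * ((1 - r t) * (\<Sum>k<n. r t ^ k)) = H t - H t * r t ^ n"
        by (simp only: right_diff_distrib mult_1_right)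
      \<comment> \<open>The remainder of the geometric series is exactly
        \<open>H t * r t ^ n\<close>, which gives an error of order \<open>q ^ n\<close> uniformly
        on the interval.\<close>
      then have HS: "H t - (\<Sum>k<n. r t ^ k) = H t * r t ^ n"
        by (simp only: is_inverse_cancel(2)[OF H[OF t]]) simp
      have "\<tau> (r' t * H t) - (\<Sum>k<n. \<tau> (r' t * r t ^ k)) = \<tau> (r' t * (H t - (\<Sum>k<n. r t ^ k)))"
        by (simp add: linear_simps right_diff_distrib sum_distrib_left)
      also have "norm \<dots> \<le> K * norm (r' t * (H t * r t ^ n))"
        unfolding HS by (rule K)
      also have "\<dots> \<le> K * (norm (r' t) * (norm (H t) * norm (r t ^ n)))"
        by (intro mult_left_mono order_trans[OF norm_mult_ineq] norm_ge_zero order_refl) (use K in auto)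
      also have "\<dots> \<le> K * (norm (r' t) * (norm (H t) * q ^ n))"
      proof (intro mult_left_mono norm_ge_zero)
        show "norm (r t ^ n) \<le> q ^ n"
          using norm_power_Suc_le[of "r t" "n - 1"] power_mono[OF q(1)[OF t], of n] n by simp
      qed (use K in auto)
      also have "\<dots> = K * ((norm (r' t) * norm (H t)) * q ^ n)"
        by simp
      also have "\<dots> \<le> K * (C * q ^ n)"
        by (intro mult_left_mono mult_right_mono C t) (use K q0 in auto)
      finally show "norm (\<tau> (r' t * H t) - (\<Sum>k<n. \<tau> (r' t * r t ^ k))) \<le> K * C * q ^ n"
        by (simp add: mult.assoc)
    qed simp
    moreover have "integral {0..1} (\<lambda>t. \<tau> (r' t * H t) - (\<Sum>k<n. \<tau> (r' t * r t ^ k))) = I - (T n 1 - T n 0)"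
      unfolding I_def using ftc[of n] int by (simp add: integral_diff has_integral_iff)
    ultimately show ?thesis by simp
  qed
  have "(\<lambda>n. K * C * q ^ n) \<longlonglongrightarrow> K * C * 0"
    by (intro tendsto_intros LIMSEQ_realpow_zero q0 q)
  then have lim0: "(\<lambda>n. K * C * q ^ n) \<longlonglongrightarrow> 0"
    by simp
  have lim1: "(\<lambda>n. I - (T n 1 - T n 0)) \<longlonglongrightarrow> 0"
    by (rule Lim_null_comparison[OF eventually_sequentiallyI[of 1] lim0]) (rule bd, simp)
  have lim2: "(\<lambda>n. I - (T n 1 - T n 0)) \<longlonglongrightarrow> I - (log_series (r 1) - log_series (r 0))"
  proof (intro tendsto_intros)
    have "(\<lambda>n. T n t) \<longlonglongrightarrow> log_series (r t)" if "t \<in> {0..1}" for t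
      unfolding T_def log_series_def
      by (rule summable_LIMSEQ[OF summable_log_series[OF le_less_trans[OF q(1)[OF that] q(2)]]])
    then show "(\<lambda>n. T n 1) \<longlonglongrightarrow> log_series (r 1)" "(\<lambda>n. T n 0) \<longlonglongrightarrow> log_series (r 0)"
      by auto
  qed
  have "I = log_series (r 1) - log_series (r 0)"
    using LIMSEQ_unique[OF lim2 lim1] by simp
  then show ?thesis
    using int unfolding I_def by (simp add: has_integral_iff)
qed

end

section \<open>Polynomial paths\<close>

text \<open>Horner form: addition and multiplication by the parameter generate all polynomials in
  \<open>t\<close> with vector coefficients, and inductions can do without a degree.\<close>

inductive poly_path :: "(real \<Rightarrow> 'a::real_vector) \<Rightarrow> bool" where
  const: "poly_path (\<lambda>t. a)"
| scale: "poly_path f \<Longrightarrow> poly_path (\<lambda>t. t *\<^sub>R f t)"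
| add: "poly_path f \<Longrightarrow> poly_path g \<Longrightarrow> poly_path (\<lambda>t. f t + g t)"

lemma poly_path_mult_const_left: "poly_path f \<Longrightarrow> poly_path (\<lambda>t. (a::'a::real_algebra) * f t)"
  by (induction rule: poly_path.induct) (simp_all add: distrib_left poly_path.intros)

lemma poly_path_mult:
  assumes f: "poly_path f" and g: "poly_path g"
  shows "poly_path (\<lambda>t. f t * g t :: 'a::real_algebra)"
  using f
proof induction
  case (const a)
  show ?case using g by (rule poly_path_mult_const_left)
qed (simp_all add: distrib_right poly_path.intros)

lemma poly_path_uminus: "poly_path f \<Longrightarrow> poly_path (\<lambda>t. - f t)"
proof (induction rule: poly_path.induct)
  case (scale f)
  from poly_path.scale[OF scale.IH] show ?case by simp
next
  case (add f g)
  from poly_path.add[OF add.IH] show ?case by simp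
qed (rule poly_path.const)

lemma poly_path_reflect: "poly_path f \<Longrightarrow> poly_path (\<lambda>t. f (1 - t))"
proof (induction rule: poly_path.induct)
  case (scale f)
  have "poly_path (\<lambda>t. f (1 - t) + - (t *\<^sub>R f (1 - t)))"
    by (intro poly_path.add poly_path_uminus poly_path.scale scale.IH)
  then show ?case by (simp add: algebra_simps)
qed (intro poly_path.intros; assumption?)+

lemma poly_path_derivative:
  fixes f :: "real \<Rightarrow> 'a::real_normed_vector"
  assumes "poly_path f"
  shows "\<exists>f'. poly_path f' \<and> (\<forall>t. (f has_vector_derivative f' t) (at t))"
  using assms
proof induction
  case (const a)
  show ?case by (intro exI[of _ "\<lambda>t. 0"]) (simp add: poly_path.const)
next
  case (scale f)
  then obtain f' where f': "poly_path f'" "\<And>t. (f has_vector_derivative f' t) (at t)"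
    by blast
  have "((\<lambda>t. t *\<^sub>R f t) has_vector_derivative (t *\<^sub>R f' t + f t)) (at t)" for t
    using has_vector_derivative_scaleR[OF DERIV_ident f'(2)[of t]] by simp
  moreover have "poly_path (\<lambda>t. t *\<^sub>R f' t + f t)"
    by (intro poly_path.intros f' scale.hyps)
  ultimately show ?case by blast
next
  case (add f g)
  then obtain f' g' where "poly_path f'" "\<And>t. (f has_vector_derivative f' t) (at t)"
    "poly_path g'" "\<And>t. (g has_vector_derivative g' t) (at t)"
    by blast
  then show ?case
    by (intro exI[of _ "\<lambda>t. f' t + g' t"]) (auto intro: poly_path.intros has_vector_derivative_add)
qed

lemma poly_path_continuous:
  fixes f :: "real \<Rightarrow> 'a::real_normed_vector"
  assumes "poly_path f"
  shows "continuous_on S f"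
  using poly_path_derivative[OF assms]
  by (meson continuous_at_imp_continuous_on has_vector_derivative_continuous)

lemma poly_path_coefficients:
  assumes "poly_path f"
  shows "\<exists>N a. \<forall>t. f t = (\<Sum>k\<le>N. t ^ k *\<^sub>R a k)"
  using assms
proof induction
  case (const a)
  show ?case by (intro exI[of _ 0] exI[of _ "\<lambda>_. a"]) simp
next
  case (scale f)
  then obtain N a where "\<And>t. f t = (\<Sum>k\<le>N. t ^ k *\<^sub>R a k)" by blast
  then have "t *\<^sub>R f t = (\<Sum>k\<le>Suc N. t ^ k *\<^sub>R (case k of 0 \<Rightarrow> 0 | Suc k \<Rightarrow> a k))" for t
    by (simp only: sum.atMost_Suc_shift) (simp add: scaleR_sum_right)
  then show ?case
    by (intro exI[of _ "Suc N"] exI[of _ "\<lambda>k. case k of 0 \<Rightarrow> 0 | Suc k \<Rightarrow> a k"] allI)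
next
  case (add f g)
  then obtain N a M b where f: "\<And>t. f t = (\<Sum>k\<le>N. t ^ k *\<^sub>R a k)" and g: "\<And>t. g t = (\<Sum>k\<le>M. t ^ k *\<^sub>R b k)"
    by blast
  have "f t + g t = (\<Sum>k\<le>max N M. t ^ k *\<^sub>R ((if k \<le> N then a k else 0) + (if k \<le> M then b k else 0)))" for t
  proof -
    have "f t = (\<Sum>k\<le>max N M. t ^ k *\<^sub>R (if k \<le> N then a k else 0))"
      unfolding f by (rule sum.mono_neutral_cong_left) auto
    moreover have "g t = (\<Sum>k\<le>max N M. t ^ k *\<^sub>R (if k \<le> M then b k else 0))"
      unfolding g by (rule sum.mono_neutral_cong_left) auto
    ultimately show ?thesis
      by (simp add: scaleR_add_right sum.distrib)
  qed
  then show ?case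
    by (intro exI[of _ "max N M"] exI[of _ "\<lambda>k. (if k \<le> N then a k else 0) + (if k \<le> M then b k else 0)"] allI)
qed

section \<open>Values of the determinant along paths\<close>

context bounded_trace
begin

text \<open>\<open>connects g w\<close>: some polynomial path of units leads from \<open>1\<close> to \<open>g\<close> and has total logarithmic
  derivative \<open>w\<close>, i.e.\ \<open>w\<close> is a value of the (multivalued) logarithm of the de la Harpe--Skandalis
  determinant at \<open>g\<close>.\<close>

definition connects :: "'r \<Rightarrow> complex \<Rightarrow> bool" where
  "connects g w \<longleftrightarrow> (\<exists>F F' G. poly_path F \<and> (\<forall>t. (F has_vector_derivative F' t) (at t)) \<and>
     (\<forall>t\<in>{0..1}. is_inverse (F t) (G t)) \<and> F 0 = 1 \<and> F 1 = g \<and>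
     ((\<lambda>t. \<tau> (F' t * G t)) has_integral w) {0..1})"

lemma connectsI:
  assumes "poly_path F" "\<And>t. (F has_vector_derivative F' t) (at t)"
    "\<And>t. t \<in> {0..1} \<Longrightarrow> is_inverse (F t) (G t)" "F 0 = 1" "F 1 = g"
    "((\<lambda>t. \<tau> (F' t * G t)) has_integral w) {0..1}"
  shows "connects g w"
  using assms unfolding connects_def by blast

text \<open>Pointwise product of the paths. The logarithmic derivative of \<open>F * E\<close> is
  \<open>F' * G\<close> plus the conjugate of \<open>E' * H\<close> by \<open>F\<close>, and the
  trace does not see the conjugation; hence the values add although the algebra is not
  commutative.\<close>

lemma connects_mult:
  assumes "connects g w" "connects h v"
  shows "connects (g * h) (w + v)"
proof -
  obtain F F' G where F: "poly_path F" "\<And>t. (F has_vector_derivative F' t) (at t)"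
    "\<And>t. t \<in> {0..1} \<Longrightarrow> is_inverse (F t) (G t)" "F 0 = 1" "F 1 = g"
    "((\<lambda>t. \<tau> (F' t * G t)) has_integral w) {0..1}"
    using assms(1) unfolding connects_def by blast
  obtain E E' H where E: "poly_path E" "\<And>t. (E has_vector_derivative E' t) (at t)"
    "\<And>t. t \<in> {0..1} \<Longrightarrow> is_inverse (E t) (H t)" "E 0 = 1" "E 1 = h"
    "((\<lambda>t. \<tau> (E' t * H t)) has_integral v) {0..1}"
    using assms(2) unfolding connects_def by blast
  show ?thesis
  proof (rule connectsI)
    show "poly_path (\<lambda>t. F t * E t)"
      by (intro poly_path_mult F E)
    show "((\<lambda>t. F t * E t) has_vector_derivative (F t * E' t + F' t * E t)) (at t)" for t
      by (intro has_vector_derivative_mult F E)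
    show "is_inverse (F t * E t) (H t * G t)" if "t \<in> {0..1}" for t
      by (intro is_inverse_mult F E that)
    have eq: "\<tau> ((F t * E' t + F' t * E t) * (H t * G t)) = \<tau> (F' t * G t) + \<tau> (E' t * H t)" if t: "t \<in> {0..1}" for t
    proof -
      have 1: "(F t * E' t + F' t * E t) * (H t * G t) = F t * (E' t * H t) * G t + F' t * (E t * (H t * G t))"
        by (simp only: distrib_right mult.assoc)
      show ?thesis
        unfolding 1 linear_simps conjugate[OF F(3)[OF t]] is_inverse_cancel[OF E(3)[OF t]] by simp
    qed
    show "((\<lambda>t. \<tau> ((F t * E' t + F' t * E t) * (H t * G t))) has_integral (w + v)) {0..1}"
      by (rule has_integral_eq[OF _ has_integral_add[OF F(6) E(6)]]) (simp add: eq)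
  qed (simp_all add: F E)
qed

lemma connects_conjugate:
  assumes "connects g w" and h: "is_inverse h h'"
  shows "connects (h * g * h') w"
proof -
  obtain F F' G where F: "poly_path F" "\<And>t. (F has_vector_derivative F' t) (at t)"
    "\<And>t. t \<in> {0..1} \<Longrightarrow> is_inverse (F t) (G t)" "F 0 = 1" "F 1 = g"
    "((\<lambda>t. \<tau> (F' t * G t)) has_integral w) {0..1}"
    using assms(1) unfolding connects_def by blast
  show ?thesis
  proof (rule connectsI)
    show "poly_path (\<lambda>t. h * F t * h')"
      by (intro poly_path_mult poly_path.const F)
    show "((\<lambda>t. h * F t * h') has_vector_derivative (h * F' t * h')) (at t)" for t
      using F(2)[of t]
      by (intro has_vector_derivative_mult_left has_vector_derivative_mult_right)
    show "is_inverse (h * F t * h') (h * (G t * h'))" if "t \<in> {0..1}" for t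
      by (intro is_inverse_mult F h is_inverse_sym[OF h] that)
    have eq: "\<tau> (h * F' t * h' * (h * (G t * h'))) = \<tau> (F' t * G t)" for t
    proof -
      have "h * F' t * h' * (h * (G t * h')) = h * (F' t * G t) * h'"
        by (simp add: mult.assoc is_inverse_cancel[OF h])
      then show ?thesis by (simp add: conjugate[OF h])
    qed
    show "((\<lambda>t. \<tau> (h * F' t * h' * (h * (G t * h')))) has_integral w) {0..1}"
      unfolding eq by (rule F)
  qed (simp_all add: F is_inverse_cancel[OF h])
qed

text \<open>The pointwise inverse of a polynomial path is in general not polynomial. Instead the
  path is run backwards, which changes the sign of the total, and multiplied by the constant
  \<open>h\<close>, which moves its start from \<open>g\<close> to 1.\<close>

lemma connects_inverse:
  assumes "connects g w" and h: "is_inverse g h"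
  shows "connects h (- w)"
proof -
  obtain F F' G where F: "poly_path F" "\<And>t. (F has_vector_derivative F' t) (at t)"
    "\<And>t. t \<in> {0..1} \<Longrightarrow> is_inverse (F t) (G t)" "F 0 = 1" "F 1 = g"
    "((\<lambda>t. \<tau> (F' t * G t)) has_integral w) {0..1}"
    using assms(1) unfolding connects_def by blast
  show ?thesis
  proof (rule connectsI)
    show "poly_path (\<lambda>t. F (1 - t) * h)"
      by (intro poly_path_mult poly_path.const poly_path_reflect F)
    show "((\<lambda>t. F (1 - t) * h) has_vector_derivative (- F' (1 - t) * h)) (at t)" for t
    proof (rule has_vector_derivative_mult_left)
      have "((\<lambda>t. 1 - t) has_real_derivative -1) (at t)"
        by (auto intro!: derivative_eq_intros)
      then have "((F \<circ> (\<lambda>t. 1 - t)) has_vector_derivative (-1) *\<^sub>R F' (1 - t)) (at t)"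
        by (intro vector_diff_chain_at) (auto intro: F simp: has_real_derivative_iff_has_vector_derivative)
      then show "((\<lambda>t. F (1 - t)) has_vector_derivative - F' (1 - t)) (at t)"
        by (simp add: o_def)
    qed
    show "is_inverse (F (1 - t) * h) (g * G (1 - t))" if "t \<in> {0..1}" for t
      using that by (intro is_inverse_mult F is_inverse_sym[OF h]) auto
    have eq: "\<tau> (- F' (1 - t) * h * (g * G (1 - t))) = - \<tau> (F' (1 - t) * G (1 - t))" for t
      by (simp add: mult.assoc is_inverse_cancel[OF h] linear_simps)
    have "((\<lambda>t. \<tau> (F' (1 - t) * G (1 - t))) has_integral w) {0..1}"
      using has_integral_affinity[OF F(6)[folded cbox_interval], of "-1" 1] by simp
    then show "((\<lambda>t. \<tau> (- F' (1 - t) * h * (g * G (1 - t)))) has_integral - w) {0..1}"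
      unfolding eq by (rule has_integral_neg)
  qed (simp_all add: F is_inverse_cancel[OF h])
qed

text \<open>Along the segment from 1 to \<open>1 + n\<close> the inverse is
  \<open>1 - t *\<^sub>R n\<close> and the logarithmic derivative is constantly \<open>n\<close>.
  The intended case is an elementary matrix.\<close>

lemma connects_nilpotent:
  assumes "n * n = 0" "\<tau> n = 0"
  shows "connects (1 + n) 0"
proof (rule connectsI)
  show "poly_path (\<lambda>t. 1 + t *\<^sub>R n)"
    by (intro poly_path.intros)
  show "((\<lambda>t. 1 + t *\<^sub>R n) has_vector_derivative n) (at t)" for t
    by (auto intro!: derivative_eq_intros)
  show "is_inverse (1 + t *\<^sub>R n) (1 - t *\<^sub>R n)" for t
    using assms by (simp add: is_inverse_def algebra_simps)
  have "\<tau> (n * (1 - t *\<^sub>R n)) = 0" for t :: real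
    using assms by (simp add: algebra_simps)
  then show "((\<lambda>t. \<tau> (n * (1 - t *\<^sub>R n))) has_integral 0) {0..1}"
    by simp
qed auto

lemma connects_one: "connects 1 0"
  using connects_nilpotent[of 0] by (simp add: linear_simps)

lemma norm_scaleR_le_one: "t \<in> {0..1} \<Longrightarrow> norm (t *\<^sub>R x) \<le> norm (x::'r)"
  by (simp add: mult_left_le_one_le)

lemma segment_has_integral:
  assumes "norm x < 1" "\<And>t. t \<in> {0..1} \<Longrightarrow> is_inverse (1 - t *\<^sub>R x) (G t)"
  shows "((\<lambda>t. \<tau> (x * G t)) has_integral log_series x) {0..1::real}"
proof -
  have "((\<lambda>t. \<tau> (x * G t)) has_integral (log_series (1 *\<^sub>R x) - log_series (0 *\<^sub>R x))) {0..1::real}"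
  proof (rule log_series_has_integral)
    show "((\<lambda>t. t *\<^sub>R x) has_vector_derivative x) (at t within {0..1})" for t
      by (auto intro!: derivative_eq_intros)
  qed (use assms norm_scaleR_le_one in auto)
  then show ?thesis by simp
qed

text \<open>The straight segment stays inside the domain of the Neumann series, so the logarithm
  given by the power series is one of the values of the determinant.\<close>

lemma connects_one_minus:
  assumes "norm x < 1"
  shows "connects (1 - x) (- log_series x)"
proof -
  have "\<exists>y. is_inverse (1 - t *\<^sub>R x) y" if "t \<in> {0..1}" for t
    using norm_scaleR_le_one[OF that, of x] assms by (intro is_inverse_one_minus) simp
  then obtain G where G: "\<And>t. t \<in> {0..1} \<Longrightarrow> is_inverse (1 - t *\<^sub>R x) (G t)"
    by metis
  show ?thesis
  proof (rule connectsI)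
    show "poly_path (\<lambda>t. 1 - t *\<^sub>R x)"
      using poly_path.add[OF poly_path.const[of 1] poly_path_uminus[OF poly_path.scale[OF poly_path.const[of x]]]] by simp
    show "((\<lambda>t. 1 - t *\<^sub>R x) has_vector_derivative - x) (at t)" for t
      by (auto intro!: derivative_eq_intros)
    show "((\<lambda>t. \<tau> (- x * G t)) has_integral - log_series x) {0..1}"
      using has_integral_neg[OF segment_has_integral[OF assms G]] by (simp add: linear_simps)
  qed (simp_all add: G)
qed

text \<open>Up to sign, both sides are the total logarithmic derivative of the path
  \<open>(1 - t *\<^sub>R x) * (1 - t *\<^sub>R y)\<close>: once read off its expansion
  \<open>1 - r t\<close>, once off its two factors. The hypothesis keeps \<open>norm (r t)\<close>
  below 1 along the whole path.\<close>

lemma log_series_add: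
  assumes small: "norm x + norm y + norm x * norm y < 1"
  shows "log_series (x + y - x * y) = log_series x + log_series y"
proof -
  have "norm x * norm y \<ge> 0" by simp
  then have x: "norm x < 1" and y: "norm y < 1"
    using small norm_ge_zero[of x] norm_ge_zero[of y] by linarith+
  have "\<exists>z. is_inverse (1 - t *\<^sub>R x) z" "\<exists>z. is_inverse (1 - t *\<^sub>R y) z" if "t \<in> {0..1}" for t
    using norm_scaleR_le_one[OF that, of x] norm_scaleR_le_one[OF that, of y] x y
    by (metis is_inverse_one_minus order_le_less_trans)+
  then obtain G H where G: "\<And>t. t \<in> {0..1} \<Longrightarrow> is_inverse (1 - t *\<^sub>R x) (G t)"
    and H: "\<And>t. t \<in> {0..1} \<Longrightarrow> is_inverse (1 - t *\<^sub>R y) (H t)"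
    by metis
  define r where "r t = t *\<^sub>R (x + y) - t *\<^sub>R t *\<^sub>R (x * y)" for t :: real
  define r' where "r' t = x + y - (2 * t) *\<^sub>R (x * y)" for t :: real
  have eq: "1 - r t = (1 - t *\<^sub>R x) * (1 - t *\<^sub>R y)" for t
    unfolding r_def by (simp add: algebra_simps)
  have "((\<lambda>t. \<tau> (r' t * (H t * G t))) has_integral (log_series (r 1) - log_series (r 0))) {0..1::real}"
  proof (rule log_series_has_integral[OF _ _ _ small])
    show "(r has_vector_derivative r' t) (at t within {0..1})" for t
      unfolding r_def r'_def by (auto intro!: derivative_eq_intros simp: algebra_simps simp flip: scaleR_left.add)
    show "continuous_on {0..1} r'"
      unfolding r'_def by (intro continuous_intros)
    show "is_inverse (1 - r t) (H t * G t)" if "t \<in> {0..1}" for t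
      unfolding eq by (intro is_inverse_mult G H that)
    show "norm (r t) \<le> norm x + norm y + norm x * norm y" if t: "t \<in> {0..1}" for t
    proof -
      have "norm (r t) \<le> norm (t *\<^sub>R x + t *\<^sub>R y) + norm (t *\<^sub>R t *\<^sub>R (x * y))"
        unfolding r_def scaleR_add_right by (rule norm_triangle_ineq4)
      moreover have "norm (t *\<^sub>R x + t *\<^sub>R y) \<le> norm x + norm y"
        by (rule order_trans[OF norm_triangle_ineq]) (intro add_mono norm_scaleR_le_one t)
      moreover have "norm (t *\<^sub>R t *\<^sub>R (x * y)) \<le> norm x * norm y"
        using norm_scaleR_le_one[OF t, of "t *\<^sub>R (x * y)"] norm_scaleR_le_one[OF t, of "x * y"] norm_mult_ineq[of x y]
        by linarith
      ultimately show ?thesis by linarith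
    qed
  qed
  moreover have "\<tau> (r' t * (H t * G t)) = \<tau> (x * G t) + \<tau> (y * H t)" if t: "t \<in> {0..1}" for t
  proof -
    have "r' t = (1 - t *\<^sub>R x) * y + x * (1 - t *\<^sub>R y)"
      unfolding r'_def by (simp add: algebra_simps flip: scaleR_left.add)
    then have "r' t * (H t * G t) = (1 - t *\<^sub>R x) * (y * H t) * G t + x * ((1 - t *\<^sub>R y) * (H t * G t))"
      by (simp only: distrib_right mult.assoc)
    then show ?thesis
      unfolding is_inverse_cancel[OF H[OF t]] by (simp add: linear_simps conjugate[OF G[OF t]])
  qed
  ultimately have "((\<lambda>t. \<tau> (x * G t) + \<tau> (y * H t)) has_integral (log_series (r 1) - log_series (r 0))) {0..1::real}"
    by (rule has_integral_eq[rotated])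
  moreover have "((\<lambda>t. \<tau> (x * G t) + \<tau> (y * H t)) has_integral (log_series x + log_series y)) {0..1::real}"
    by (intro has_integral_add segment_has_integral x y G H)
  ultimately have "log_series (r 1) - log_series (r 0) = log_series x + log_series y"
    by (rule has_integral_unique)
  then show ?thesis by (simp add: r_def)
qed

end

section \<open>The idempotent of an invertible trigonometric polynomial\<close>

text \<open>Let \<open>a\<close> be the symbol of a polynomial loop and \<open>c\<close> the Laurent coefficients of its inverse.
  With \<open>\<Pi>\<close> the projection onto nonnegative powers, \<open>a (1 - \<Pi>) a\<^sup>-\<^sup>1 \<Pi>\<close> is idempotent, and only its
  first \<open>N\<close> rows are nonzero; \<open>e\<close> is its corner.\<close>

lemma laurent_idempotent:
  fixes a :: "nat \<Rightarrow> 'r::{real_normed_algebra, monoid_mult}" and c :: "int \<Rightarrow> 'r"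
  assumes aN: "\<And>k. k > N \<Longrightarrow> a k = 0"
    and conv1: "\<And>n. (\<Sum>p\<le>N. a p * c (n - int p)) = (if n = 0 then 1 else 0)"
    and conv2: "\<And>n. (\<Sum>p\<le>N. c (n - int p) * a p) = (if n = 0 then 1 else 0)"
    and bdd: "\<And>n. norm (c n) \<le> C"
    and lim: "(\<lambda>q::nat. c (int q)) \<longlonglongrightarrow> 0"
  defines "e \<equiv> \<lambda>i j. \<Sum>k=1..N. a (i + k) * c (- int k - int j)"
  shows "(\<Sum>l<N. e i l * e l j) = e i j"
proof -
  \<comment> \<open>\<open>T k m\<close> is the inner sum over \<open>l\<close> in the square of
    \<open>e\<close>. The convolution identity completes it to a Kronecker delta minus the terms
    with \<open>p < m\<close>; these missing terms are collected in \<open>R\<close>.\<close>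
  define T where "T k m = (\<Sum>l<N. c (- int k - int l) * a (l + m))" for k m
  define R where "R k M = (\<Sum>m=1..M. \<Sum>p<m. c (int m - int k - int p) * a p * c (- int m - int j))" for k M
  have C0: "0 \<le> C"
    using bdd[of 0] norm_ge_zero order_trans by blast
  have e_ext: "e l j = (\<Sum>m=1..M. a (l + m) * c (- int m - int j))" if "M \<ge> N" for l M
    unfolding e_def using that by (intro sum.mono_neutral_left) (auto simp: aN)
  \<comment> \<open>\<open>m \<ge> 1\<close> makes the range \<open>p < N + m\<close> contain every
    \<open>p \<le> N\<close>.\<close>
  have T: "T k m = (if m = k then 1 else 0) - (\<Sum>p<m. c (int m - int k - int p) * a p)" if m: "m \<ge> 1" for k m
  proof -
    have "(\<Sum>p<N + m. c (int m - int k - int p) * a p) = (\<Sum>p\<le>N. c (int m - int k - int p) * a p)"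
      using m by (intro sum.mono_neutral_right) (auto simp: aN)
    also have "\<dots> = (if m = k then 1 else 0)"
      by (subst conv2) auto
    finally have 1: "(\<Sum>p<N + m. c (int m - int k - int p) * a p) = (if m = k then 1 else 0)" .
    have "(\<Sum>p<N + m. c (int m - int k - int p) * a p)
        = (\<Sum>p<m. c (int m - int k - int p) * a p) + (\<Sum>p=m..<N + m. c (int m - int k - int p) * a p)"
      by (subst sum.union_disjoint[symmetric]) (auto intro!: sum.cong)
    also have "(\<Sum>p=m..<N + m. c (int m - int k - int p) * a p) = T k m"
      unfolding T_def using sum.shift_bounds_nat_ivl[of "\<lambda>p. c (int m - int k - int p) * a p" 0 m N]
      by (simp add: lessThan_atLeast0 algebra_simps minus_diff_commute)
    finally show ?thesis unfolding 1 by (simp add: algebra_simps)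
  qed
  \<comment> \<open>The cutoff \<open>M\<close> is arbitrary because \<open>a\<close> vanishes
    beyond \<open>N\<close>. The left side does not depend on it, so the correction can be removed
    by letting \<open>M\<close> grow.\<close>
  have main: "(\<Sum>l<N. e i l * e l j) = e i j - (\<Sum>k=1..N. a (i + k) * R k M)" if M: "M \<ge> N" for M
  proof -
    have "(\<Sum>l<N. e i l * e l j)
        = (\<Sum>l<N. (\<Sum>k=1..N. a (i + k) * c (- int k - int l)) * (\<Sum>m=1..M. a (l + m) * c (- int m - int j)))"
      unfolding e_ext[OF M] by (simp add: e_def)
    also have "\<dots> = (\<Sum>l<N. \<Sum>k=1..N. \<Sum>m=1..M. a (i + k) * (c (- int k - int l) * a (l + m) * c (- int m - int j)))"
      by (simp add: sum_product mult.assoc)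
    also have "\<dots> = (\<Sum>k=1..N. \<Sum>m=1..M. \<Sum>l<N. a (i + k) * (c (- int k - int l) * a (l + m) * c (- int m - int j)))"
      by (subst sum.swap) (intro sum.cong refl sum.swap)
    also have "\<dots> = (\<Sum>k=1..N. a (i + k) * (\<Sum>m=1..M. T k m * c (- int m - int j)))"
      unfolding T_def by (simp add: sum_distrib_left sum_distrib_right)
    also have "\<dots> = (\<Sum>k=1..N. a (i + k) * (c (- int k - int j) - R k M))"
    proof (intro sum.cong refl arg_cong2[where f = "(*)"])
      fix k assume k: "k \<in> {1..N}"
      have "(\<Sum>m=1..M. T k m * c (- int m - int j))
          = (\<Sum>m=1..M. (if m = k then c (- int m - int j) else 0) - (\<Sum>p<m. c (int m - int k - int p) * a p * c (- int m - int j)))"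
        by (intro sum.cong refl) (simp add: T left_diff_distrib sum_distrib_right)
      also have "\<dots> = c (- int k - int j) - R k M"
        unfolding R_def using k M by (simp add: sum_subtractf sum.delta)
      finally show "(\<Sum>m=1..M. T k m * c (- int m - int j)) = c (- int k - int j) - R k M" .
    qed
    finally show ?thesis
      by (simp add: e_def right_diff_distrib sum_subtractf)
  qed
  \<comment> \<open>Summed along \<open>q = m - p\<close>, the inner sum over \<open>p\<close> is
    complete for \<open>q \<le> s\<close> and vanishes by \<open>conv1\<close>, as
    \<open>- q - j\<close> is negative. Only the \<open>N\<close> values with
    \<open>s < q \<le> s + N\<close> survive, each with a factor \<open>c (q - k)\<close> that tends
    to 0 with growing \<open>s\<close>.\<close>
  have R: "R k (N + s) = (\<Sum>u=1..N. c (int s + (int u - int k)) * (\<Sum>p\<le>N - u. a p * c (- int (s + u) - int j - int p)))" for k s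
  proof -
    define g where "g q p = c (int q - int k) * (a p * c (- int q - int j - int p))" for q p
    have "R k (N + s) = (\<Sum>(m, p)\<in>(SIGMA m:{1..N+s}. {..<m}). g (m - p) p)"
      unfolding R_def g_def by (subst sum.Sigma[symmetric]) (auto intro!: sum.cong simp: of_nat_diff mult.assoc algebra_simps)
    also have "\<dots> = (\<Sum>(q, p)\<in>(SIGMA q:{1..N+s}. {..N + s - q}). g q p)"
      by (rule sum.reindex_bij_witness[where i = "\<lambda>(q, p). (q + p, p)" and j = "\<lambda>(m, p). (m - p, p)"]) auto
    also have "\<dots> = (\<Sum>q=1..N+s. \<Sum>p\<le>N + s - q. g q p)"
      by (subst sum.Sigma) auto
    also have "\<dots> = (\<Sum>q=s+1..s+N. \<Sum>p\<le>N + s - q. g q p)"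
    proof (rule sum.mono_neutral_right)
      show "\<forall>q\<in>{1..N + s} - {s + 1..s + N}. (\<Sum>p\<le>N + s - q. g q p) = 0"
      proof
        fix q assume "q \<in> {1..N + s} - {s + 1..s + N}"
        then have q: "q \<ge> 1" "q \<le> s" by auto
        have "(\<Sum>p\<le>N + s - q. g q p) = (\<Sum>p\<le>N. g q p)"
          using q by (intro sum.mono_neutral_right) (auto simp: aN g_def)
        also have "\<dots> = c (int q - int k) * (\<Sum>p\<le>N. a p * c ((- int q - int j) - int p))"
          unfolding g_def by (simp add: sum_distrib_left)
        also have "\<dots> = 0"
          using q by (subst conv1) auto
        finally show "(\<Sum>p\<le>N + s - q. g q p) = 0" .
      qed
    qed auto
    also have "\<dots> = (\<Sum>u=1..N. \<Sum>p\<le>N - u. g (u + s) p)"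
      using sum.shift_bounds_cl_nat_ivl[of "\<lambda>q. \<Sum>p\<le>N + s - q. g q p" 1 s N] by (simp add: add.commute)
    also have "\<dots> = (\<Sum>u=1..N. c (int s + (int u - int k)) * (\<Sum>p\<le>N - u. a p * c (- int (s + u) - int j - int p)))"
      unfolding g_def by (intro sum.cong refl) (simp add: sum_distrib_left algebra_simps)
    finally show ?thesis .
  qed
  have c_lim: "(\<lambda>s. c (int s + z)) \<longlonglongrightarrow> 0" for z
  proof (cases "z \<ge> 0")
    case True
    then show ?thesis
      using LIMSEQ_ignore_initial_segment[OF lim, of "nat z"] by simp
  next
    case False
    then show ?thesis
      using lim by - (rule LIMSEQ_offset[where k = "nat (- z)"], simp)
  qed
  define D where "D = (\<Sum>p\<le>N. norm (a p) * C)"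
  have R_lim: "(\<lambda>s. R k (N + s)) \<longlonglongrightarrow> 0" for k
    unfolding R
  proof (rule tendsto_null_sum)
    fix u
    have bd: "norm (\<Sum>p\<le>N - u. a p * c (- int (s + u) - int j - int p)) \<le> D" for s
    proof -
      have "norm (\<Sum>p\<le>N - u. a p * c (- int (s + u) - int j - int p)) \<le> (\<Sum>p\<le>N - u. norm (a p) * C)"
        by (intro sum_norm_le order_trans[OF norm_mult_ineq] mult_left_mono bdd norm_ge_zero)
      also have "\<dots> \<le> D"
        unfolding D_def by (rule sum_mono2) (auto simp: C0)
      finally show ?thesis .
    qed
    have "(\<lambda>s. norm (c (int s + (int u - int k))) * D) \<longlonglongrightarrow> 0 * D"
      by (intro tendsto_intros tendsto_norm_zero c_lim)
    then show "(\<lambda>s. c (int s + (int u - int k)) * (\<Sum>p\<le>N - u. a p * c (- int (s + u) - int j - int p))) \<longlonglongrightarrow> 0"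
      by - (rule Lim_null_comparison[where g = "\<lambda>s. norm (c (int s + (int u - int k))) * D"],
            intro always_eventually allI order_trans[OF norm_mult_ineq] mult_left_mono bd norm_ge_zero, simp)
  qed
  have "(\<lambda>s. e i j - (\<Sum>k=1..N. a (i + k) * R k (N + s))) \<longlonglongrightarrow> e i j - (\<Sum>k=1..N. a (i + k) * 0)"
    by (intro tendsto_intros R_lim)
  then have "(\<lambda>s::nat. \<Sum>l<N. e i l * e l j) \<longlonglongrightarrow> e i j"
    by (simp only: main[OF le_add1, symmetric] mult_zero_right sum.neutral_const diff_zero)
  then show ?thesis
    by (simp add: LIMSEQ_const_iff)
qed

text \<open>Exactly \<open>m\<close> pairs \<open>(i, k)\<close> with \<open>k \<ge> 1\<close> have
  \<open>i + k = m\<close>. The weight \<open>m\<close> is what differentiation of the loop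
  produces: up to \<open>2 * pi * \<i>\<close> the right side is the mean of the derivative times
  the inverse.\<close>

lemma laurent_idempotent_trace:
  fixes a :: "nat \<Rightarrow> 'r::{real_normed_algebra, monoid_mult}" and c :: "int \<Rightarrow> 'r"
  assumes aN: "\<And>k. k > N \<Longrightarrow> a k = 0"
  shows "(\<Sum>i<N. \<Sum>k=1..N. a (i + k) * c (- int k - int i)) = (\<Sum>m\<le>N. of_nat m *\<^sub>R (a m * c (- int m)))"
proof -
  define g where "g m = a m * c (- int m)" for m
  have "(\<Sum>i<N. \<Sum>k=1..N. a (i + k) * c (- int k - int i)) = (\<Sum>(i, k)\<in>{..<N} \<times> {1..N}. g (i + k))"
    unfolding g_def by (simp add: sum.cartesian_product algebra_simps minus_diff_commute)
  also have "\<dots> = (\<Sum>(i, k)\<in>{(i, k). k \<ge> 1 \<and> i + k \<le> N}. g (i + k))"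
  proof (rule sum.mono_neutral_right)
    show "\<forall>x\<in>{..<N} \<times> {1..N} - {(i, k). k \<ge> 1 \<and> i + k \<le> N}. (case x of (i, k) \<Rightarrow> g (i + k)) = 0"
      by (clarsimp simp: g_def) (metis aN linorder_not_le mult_zero_left)
  qed auto
  also have "\<dots> = (\<Sum>(m, i)\<in>(SIGMA m:{..N}. {..<m}). g m)"
    by (rule sum.reindex_bij_witness[where j = "\<lambda>(i, k). (i + k, i)" and i = "\<lambda>(m, i). (i, m - i)"]) auto
  also have "\<dots> = (\<Sum>m\<le>N. \<Sum>i<m. g m)"
    by (subst sum.Sigma) auto
  finally show ?thesis
    unfolding g_def by (simp add: sum_constant_scaleR)
qed

section \<open>Trigonometric polynomials\<close>

instantiation complex :: complex_banach_algebra
begin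
definition scaleC_complex :: "complex \<Rightarrow> complex \<Rightarrow> complex" where
  "scaleC_complex = (*)"
instance
  by standard (simp_all add: scaleC_complex_def algebra_simps norm_mult scaleR_conv_of_real)
end

inductive trig_path :: "(real \<Rightarrow> 'a::complex_banach_algebra) \<Rightarrow> bool" where
  monom: "trig_path (\<lambda>t. scaleC (cis (2 * pi * (of_int j * t))) a)"
| add: "trig_path f \<Longrightarrow> trig_path g \<Longrightarrow> trig_path (\<lambda>t. f t + g t)"

lemma trig_path_const: "trig_path (\<lambda>t. a)"
  using trig_path.monom[of 0 a] by (simp add: scaleC_one)

lemma trig_path_scaleC_const:
  assumes "trig_path p"
  shows "trig_path (\<lambda>t. scaleC (p t) a)"
  using assms
proof induction
  case (monom j z)
  have "scaleC (scaleC (cis (2 * pi * (of_int j * t))) z) a = scaleC (cis (2 * pi * (of_int j * t))) (scaleC z a)" for t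
    by (simp add: scaleC_scaleC scaleC_complex_def)
  then show ?case by (simp add: trig_path.monom)
qed (simp add: scaleC_add_left trig_path.add)

lemma trig_path_monom_mult:
  assumes "trig_path p"
  shows "trig_path (\<lambda>t. cis (2 * pi * (of_int j * t)) * z * p t)"
  using assms
proof induction
  case (monom k w)
  have eq: "cis (2 * pi * (of_int j * t)) * z * scaleC (cis (2 * pi * (of_int k * t))) w
      = scaleC (cis (2 * pi * (of_int (j + k) * t))) (z * w)" for t
  proof -
    have "cis (2 * pi * (of_int (j + k) * t)) = cis (2 * pi * (of_int j * t)) * cis (2 * pi * (of_int k * t))"
      by (simp add: cis_mult algebra_simps)
    then show ?thesis by (simp add: scaleC_complex_def)
  qed
  show ?case unfolding eq by (rule trig_path.monom)
qed (simp add: distrib_left trig_path.add)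

lemma trig_path_mult:
  assumes "trig_path p" and q: "trig_path q"
  shows "trig_path (\<lambda>t. p t * q t :: complex)"
  using assms(1)
proof induction
  case (monom j z)
  then show ?case
    using trig_path_monom_mult[OF q, of j z] by (simp add: scaleC_complex_def)
qed (simp add: distrib_right trig_path.add)

lemma trig_path_cos: "trig_path (\<lambda>t. complex_of_real (cos (2 * pi * t)) * z)"
  and trig_path_sin: "trig_path (\<lambda>t. complex_of_real (sin (2 * pi * t)) * z)"
proof -
  have c: "complex_of_real (cos (2 * pi * t)) = (cis (2 * pi * t) + cis (- (2 * pi * t))) / 2"
    and s: "complex_of_real (sin (2 * pi * t)) = (cis (2 * pi * t) - cis (- (2 * pi * t))) / (2 * \<i>)" for t
    by (simp_all add: complex_eq_iff)
  have eqs: "complex_of_real (cos (2 * pi * t)) * z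
      = scaleC (cis (2 * pi * (of_int 1 * t))) (z / 2) + scaleC (cis (2 * pi * (of_int (- 1) * t))) (z / 2)"
    "complex_of_real (sin (2 * pi * t)) * z
      = scaleC (cis (2 * pi * (of_int 1 * t))) (z / (2 * \<i>)) + scaleC (cis (2 * pi * (of_int (- 1) * t))) (- z / (2 * \<i>))" for t
    unfolding c s by (simp_all add: scaleC_complex_def field_simps)
  show "trig_path (\<lambda>t. complex_of_real (cos (2 * pi * t)) * z)"
    unfolding eqs by (intro trig_path.intros)
  show "trig_path (\<lambda>t. complex_of_real (sin (2 * pi * t)) * z)"
    unfolding eqs by (intro trig_path.intros)
qed

text \<open>On the circle a real-linear functional is a combination of cosine and sine, hence of the
  frequencies 1 and -1; sums and products stay trigonometric. This links the polynomials of
  Stone-Weierstrass to finite Fourier sums.\<close>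

lemma trig_path_real_polynomial_function:
  fixes g :: "complex \<Rightarrow> real"
  assumes "real_polynomial_function g"
  shows "trig_path (\<lambda>t. complex_of_real (g (cis (2 * pi * t))))"
  using assms
proof induction
  case (linear f)
  have "f (cis x) = cos x * f 1 + sin x * f \<i>" for x
  proof -
    have "cis x = cos x *\<^sub>R 1 + sin x *\<^sub>R \<i>"
      by (simp add: complex_eq_iff)
    then show ?thesis
      using linear by (simp add: linear_add linear_scale bounded_linear.linear)
  qed
  then show ?case
    by (simp add: trig_path.add trig_path_cos trig_path_sin)
qed (simp_all add: trig_path_const trig_path.add trig_path_mult)

lemma trig_approximation:
  fixes h :: "real \<Rightarrow> real"
  assumes h: "continuous_on {0..1} h" "h 0 = h 1" and "0 < \<epsilon>"
  obtains p :: "real \<Rightarrow> complex" where "trig_path p" "\<And>t. t \<in> {0..1} \<Longrightarrow> norm (p t - of_real (h t)) < \<epsilon>"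
proof -
  define H where "H = h \<circ> (\<lambda>z. Arg2pi z / (2 * pi))"
  \<comment> \<open>The homotopy of the loop \<open>h\<close> with itself is used for its
    by-product, the continuity of the induced map \<open>H\<close> on the circle.\<close>
  have "homotopic_loops UNIV h h"
    using h by (simp add: homotopic_loops_refl path_def pathstart_def pathfinish_def)
  from homotopic_loops_imp_homotopic_circlemaps[OF this]
  have "continuous_on (sphere 0 1) H"
    unfolding H_def using homotopic_with_imp_continuous by blast
  then obtain g where g: "real_polynomial_function g" "\<And>z. z \<in> sphere 0 1 \<Longrightarrow> \<bar>H z - g z\<bar> < \<epsilon>"
    using Stone_Weierstrass_real_polynomial_function[of "sphere 0 1" H \<epsilon>] \<open>0 < \<epsilon>\<close> by auto
  \<comment> \<open>The argument lies between 0 inclusive and \<open>2 * pi\<close> exclusive, so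
    the end \<open>t = 1\<close> is sent to 0; there \<open>h 0 = h 1\<close> enters.\<close>
  have Hh: "H (cis (2 * pi * t)) = h t" if t: "t \<in> {0..1}" for t
  proof (cases "t = 1")
    case True
    have "Arg2pi 1 = 0"
      by (rule Arg2pi_unique[of 1]) auto
    with True show ?thesis using h by (simp add: H_def)
  next
    case False
    then have "Arg2pi (cis (2 * pi * t)) = 2 * pi * t"
      using t by (intro Arg2pi_unique[of 1]) (auto simp: cis_conv_exp mult.commute)
    then show ?thesis by (simp add: H_def)
  qed
  show thesis
  proof
    show "trig_path (\<lambda>t. complex_of_real (g (cis (2 * pi * t))))"
      by (rule trig_path_real_polynomial_function[OF g(1)])
    show "norm (complex_of_real (g (cis (2 * pi * t))) - of_real (h t)) < \<epsilon>" if "t \<in> {0..1}" for t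
      using g(2)[of "cis (2 * pi * t)"] Hh[OF that] by (simp add: abs_minus_commute flip: of_real_diff)
  qed
qed

text \<open>A power of \<open>z = cis (2 * pi * t)\<close> clears the negative frequencies: exponent
  \<open>nat (- j)\<close> for a monomial of frequency \<open>j\<close>, and the sum of both
  exponents for a sum of two paths.\<close>

lemma trig_path_coefficients:
  assumes "trig_path f"
  shows "\<exists>(d::nat) (N::nat) a. \<forall>t. scaleC (cis (2 * pi * (of_nat d * t))) (f t) = (\<Sum>k\<le>N. scaleC (cis (2 * pi * (of_nat k * t))) (a k))"
  using assms
proof induction
  case (monom j b)
  show ?case
  proof (intro exI allI)
    fix t
    define k where "k = nat (int (nat (- j)) + j)"
    have "scaleC (cis (2 * pi * (of_nat (nat (- j)) * t))) (scaleC (cis (2 * pi * (of_int j * t))) b)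
        = scaleC (cis (2 * pi * (of_nat k * t))) b"
      unfolding k_def by (cases "j \<ge> 0") (simp_all add: scaleC_scaleC cis_mult algebra_simps of_nat_nat)
    also have "\<dots> = (\<Sum>i\<le>k. scaleC (cis (2 * pi * (of_nat i * t))) (if i = k then b else 0))"
      by (subst sum.mono_neutral_right[of _ "{k}"])
         (auto simp: bounded_bilinear.zero_right[OF bounded_bilinear_scaleC])
    finally show "scaleC (cis (2 * pi * (of_nat (nat (- j)) * t))) (scaleC (cis (2 * pi * (of_int j * t))) b)
        = (\<Sum>i\<le>nat (int (nat (- j)) + j). scaleC (cis (2 * pi * (of_nat i * t))) (if i = nat (int (nat (- j)) + j) then b else 0))"
      unfolding k_def .
  qed
next
  case (add f g)
  obtain d N a where f: "\<And>t. scaleC (cis (2 * pi * (of_nat d * t))) (f t) = (\<Sum>k\<le>N. scaleC (cis (2 * pi * (of_nat k * t))) (a k))"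
    using add.IH(1) by blast
  obtain e M b where g: "\<And>t. scaleC (cis (2 * pi * (of_nat e * t))) (g t) = (\<Sum>k\<le>M. scaleC (cis (2 * pi * (of_nat k * t))) (b k))"
    using add.IH(2) by blast
  define S where "S = N + M + d + e"
  \<comment> \<open>Raising the power from \<open>d\<close> to \<open>d + e\<close> moves all
    frequencies up by \<open>e\<close>; padding with zero coefficients gives both summands the
    common range up to \<open>S\<close>.\<close>
  have shift: "\<exists>a'. \<forall>t. scaleC (cis (2 * pi * (of_nat (d + e) * t))) (f t) = (\<Sum>k\<le>S. scaleC (cis (2 * pi * (of_nat k * t))) (a' k))"
    if f: "\<And>t. scaleC (cis (2 * pi * (of_nat d * t))) (f t) = (\<Sum>k\<le>N. scaleC (cis (2 * pi * (of_nat k * t))) (a k))"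
      and S: "S \<ge> N + e" for f and d e N S and a :: "nat \<Rightarrow> 'a"
  proof (intro exI allI)
    fix t
    have "scaleC (cis (2 * pi * (of_nat (d + e) * t))) (f t)
        = scaleC (cis (2 * pi * (of_nat e * t))) (scaleC (cis (2 * pi * (of_nat d * t))) (f t))"
      by (simp add: scaleC_scaleC cis_mult algebra_simps)
    also have "\<dots> = (\<Sum>k\<le>N. scaleC (cis (2 * pi * (of_nat (k + e) * t))) (a k))"
      unfolding f by (simp add: scaleC_sum_right scaleC_scaleC cis_mult algebra_simps)
    also have "\<dots> = (\<Sum>k\<in>{e..N + e}. scaleC (cis (2 * pi * (of_nat k * t))) (a (k - e)))"
      by (rule sum.reindex_bij_witness[where i = "\<lambda>k. k - e" and j = "\<lambda>k. k + e"]) auto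
    also have "\<dots> = (\<Sum>k\<le>S. scaleC (cis (2 * pi * (of_nat k * t))) (if k \<in> {e..N + e} then a (k - e) else 0))"
      using S by (intro sum.mono_neutral_cong_left) (auto simp: bounded_bilinear.zero_right[OF bounded_bilinear_scaleC])
    finally show "scaleC (cis (2 * pi * (of_nat (d + e) * t))) (f t)
      = (\<Sum>k\<le>S. scaleC (cis (2 * pi * (of_nat k * t))) (if k \<in> {e..N + e} then a (k - e) else 0))" .
  qed
  obtain a' where a': "\<And>t. scaleC (cis (2 * pi * (of_nat (d + e) * t))) (f t) = (\<Sum>k\<le>S. scaleC (cis (2 * pi * (of_nat k * t))) (a' k))"
    using shift[OF f, of e S] by (auto simp: S_def)
  obtain b' where b': "\<And>t. scaleC (cis (2 * pi * (of_nat (e + d) * t))) (g t) = (\<Sum>k\<le>S. scaleC (cis (2 * pi * (of_nat k * t))) (b' k))"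
    using shift[OF g, of d S] by (auto simp: S_def)
  have "scaleC (cis (2 * pi * (of_nat (d + e) * t))) (f t + g t) = (\<Sum>k\<le>S. scaleC (cis (2 * pi * (of_nat k * t))) (a' k + b' k))" for t
    using b'[of t] by (simp only: scaleC_add_right a' sum.distrib add.commute[of e d])
  then show ?case
    by (intro exI[of _ "d + e"] exI[of _ S] exI[of _ "\<lambda>k. a' k + b' k"] allI)
qed

lemma trig_path_periodic: "trig_path f \<Longrightarrow> f 0 = f 1"
proof (induction rule: trig_path.induct)
  case (monom j a)
  have "cis (2 * pi * (of_int j * 1)) = 1"
    using cis_multiple_2pi[of "of_int j"] by simp
  then show ?case by simp
qed simp

lemma cis_has_vector_derivative:
  "((\<lambda>t. cis (2 * pi * (x * t))) has_vector_derivative 2 * pi * \<i> * x * cis (2 * pi * (x * t))) (at t within S)"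
  unfolding cis_conv_exp
  by (rule has_vector_derivative_real_field derivative_eq_intros refl | simp add: scaleR_conv_of_real)+

lemma scaleC_cis_has_vector_derivative:
  "((\<lambda>t. scaleC (cis (2 * pi * (x * t))) a) has_vector_derivative
     scaleC (cis (2 * pi * (x * t))) (scaleC (2 * pi * \<i> * x) a)) (at t within S)"
  using bounded_linear.has_vector_derivative[OF bounded_bilinear.bounded_linear_left[OF bounded_bilinear_scaleC, of a]
      cis_has_vector_derivative[of x t S]]
  by (simp add: scaleC_scaleC mult_ac)

lemma trig_path_derivative:
  assumes "trig_path f"
  shows "\<exists>f'. trig_path f' \<and> (\<forall>t. (f has_vector_derivative f' t) (at t))"
  using assms
proof induction
  case (monom j a)
  show ?case
    using trig_path.monom[of j "scaleC (2 * pi * \<i> * of_int j) a"] scaleC_cis_has_vector_derivative[of "of_int j" a]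
    by (intro exI conjI allI) simp_all
next
  case (add f g)
  then obtain f' g' where "trig_path f'" "\<And>t. (f has_vector_derivative f' t) (at t)"
    "trig_path g'" "\<And>t. (g has_vector_derivative g' t) (at t)"
    by blast
  then show ?case
    by (intro exI[of _ "\<lambda>t. f' t + g' t"]) (auto intro: trig_path.intros has_vector_derivative_add)
qed

lemma trig_path_continuous:
  assumes "trig_path f"
  shows "continuous_on S f"
  using trig_path_derivative[OF assms]
  by (meson continuous_at_imp_continuous_on has_vector_derivative_continuous)

lemma has_integral_cis:
  "((\<lambda>t. cis (2 * pi * (of_int n * t))) has_integral (if n = 0 then 1 else 0)) {0..1}"
proof (cases "n = 0")
  case True
  then show ?thesis
    using has_integral_const_real[of "1::complex" 0 1] by simp
next
  case False
  define w where "w = 2 * pi * \<i> * of_int n"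
  have w: "w \<noteq> 0" using False by (simp add: w_def)
  have "cis (2 * pi * (of_int n * 1)) = 1"
    using cis_multiple_2pi[of "of_int n"] by simp
  moreover have "((\<lambda>t. w * cis (2 * pi * (of_int n * t))) has_integral
      (cis (2 * pi * (of_int n * 1)) - cis (2 * pi * (of_int n * 0)))) {0..1}"
    using cis_has_vector_derivative[of "of_int n"]
    by (intro fundamental_theorem_of_calculus) (simp_all add: w_def)
  ultimately have "((\<lambda>t. w * cis (2 * pi * (of_int n * t))) has_integral 0) {0..1}"
    by simp
  from has_integral_mult_right[OF this, of "inverse w"] show ?thesis
    using False w by (simp add: mult.assoc[symmetric])
qed

lemma tendsto_zero_of_nat_mult_bounded:
  fixes c :: "nat \<Rightarrow> 'a::real_normed_vector"
  assumes "\<And>q. real q * norm (c q) \<le> B"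
  shows "c \<longlonglongrightarrow> 0"
proof (rule Lim_null_comparison)
  show "\<forall>\<^sub>F q in sequentially. norm (c q) \<le> B / real q"
  proof (rule eventually_sequentiallyI[of 1])
    fix q :: nat assume "1 \<le> q"
    then show "norm (c q) \<le> B / real q"
      using assms[of q] by (simp add: field_simps)
  qed
  show "(\<lambda>q. B / real q) \<longlonglongrightarrow> 0"
    by (rule lim_const_over_n)
qed

section \<open>Fourier coefficients of the inverse loop\<close>

context bounded_trace
begin

text \<open>The coefficients \<open>c\<close> of \<open>laurent_idempotent\<close> are the Fourier
  coefficients of the inverse loop \<open>g\<close>. Comparing Fourier coefficients in
  \<open>P * g = 1\<close> and \<open>g * P = 1\<close> gives the two convolution identities, and
  the weighted sum of \<open>laurent_idempotent_trace\<close> is the mean of \<open>P' * g\<close>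
  up to the factor \<open>2 * pi * \<i>\<close>.\<close>

lemma polynomial_loop_idempotent:
  assumes inv: "\<And>t. t \<in> {0..1} \<Longrightarrow> is_inverse (\<Sum>k\<le>N. scaleC (cis (2 * pi * (of_nat k * t))) (a k)) (g t)"
  shows "\<exists>e. (\<forall>i<N. \<forall>j<N. (\<Sum>l<N. e i l * e l j) = e i j) \<and>
    ((\<lambda>t. \<tau> ((\<Sum>k\<le>N. scaleC (cis (2 * pi * (of_nat k * t))) (scaleC (2 * pi * \<i> * of_nat k) (a k))) * g t))
      has_integral 2 * pi * \<i> * (\<Sum>i<N. \<tau> (e i i))) {0..1}"
proof -
  define P where "P t = (\<Sum>k\<le>N. scaleC (cis (2 * pi * (of_nat k * t))) (a k))" for t
  define P' where "P' t = (\<Sum>k\<le>N. scaleC (cis (2 * pi * (of_nat k * t))) (scaleC (2 * pi * \<i> * of_nat k) (a k)))" for t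
  define g' where "g' t = - (g t * P' t * g t)" for t
  have P: "(P has_vector_derivative P' t) (at t within {0..1})" for t
    unfolding P_def P'_def
  proof (intro has_vector_derivative_sum)
    show "((\<lambda>t. scaleC (cis (2 * pi * (of_nat k * t))) (a k)) has_vector_derivative
       scaleC (cis (2 * pi * (of_nat k * t))) (scaleC (2 * pi * \<i> * of_nat k) (a k))) (at t within {0..1})" for k
      using scaleC_cis_has_vector_derivative[of "of_nat k" "a k" t "{0..1}"] by simp
  qed
  have inv: "is_inverse (P t) (g t)" if "t \<in> {0..1}" for t
    using inv[OF that] by (simp add: P_def)
  have cP: "continuous_on {0..1} P"
    by (meson P has_vector_derivative_continuous continuous_on_eq_continuous_within)
  have c_cis: "continuous_on {0..1} (\<lambda>t. cis (2 * pi * (x * t)))" for x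
    unfolding cis_conv_exp by (intro continuous_intros)
  have cP': "continuous_on {0..1} P'"
    unfolding P'_def by (intro continuous_on_sum continuous_on_scaleC c_cis continuous_on_const)
  have cg: "continuous_on {0..1} g"
    by (rule inverse_path_continuous[OF cP inv])
  have cg': "continuous_on {0..1} g'"
    unfolding g'_def by (intro continuous_intros cg cP')
  have g': "(g has_vector_derivative g' t) (at t within {0..1})" if "t \<in> {0..1}" for t
    unfolding g'_def by (rule inverse_path_derivative[OF P inv that])
  have "P 0 = P 1"
  proof -
    have "cis (2 * pi * (real k * 1)) = 1" for k
      using cis_multiple_2pi[of "of_nat k"] by simp
    then show ?thesis by (simp add: P_def)
  qed
  then have g01: "g 0 = g 1"
    using inv[of 0] inv[of 1] by (auto intro: is_inverse_unique)
  define c where "c n = integral {0..1} (\<lambda>t. scaleC (cis (2 * pi * (of_int (- n) * t))) (g t))" for n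
  have c: "((\<lambda>t. scaleC (cis (2 * pi * (of_int (- n) * t))) (g t)) has_integral c n) {0..1}" for n
    unfolding c_def
    by (intro integrable_integral integrable_continuous_interval continuous_on_scaleC c_cis cg)
  have delta: "((\<lambda>t. scaleC (cis (2 * pi * (of_int (- n) * t))) 1) has_integral (if n = 0 then 1 else 0 :: 'r)) {0..1}" for n
    using has_integral_linear[OF has_integral_cis[of "- n"] bounded_bilinear.bounded_linear_left[OF bounded_bilinear_scaleC, of 1]]
    by (auto simp: o_def scaleC_one scaleC_zero_left split: if_splits)
  have cis_split: "cis (2 * pi * (of_int (- (n - int p)) * t)) = cis (2 * pi * (of_int (- n) * t)) * cis (2 * pi * (of_nat p * t))" for n p t
    by (simp add: cis_mult algebra_simps)
  have conv1: "(\<Sum>p\<le>N. a p * c (n - int p)) = (if n = 0 then 1 else 0)" for n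
  proof -
    have "((\<lambda>t. \<Sum>p\<le>N. a p * scaleC (cis (2 * pi * (of_int (- (n - int p)) * t))) (g t)) has_integral (\<Sum>p\<le>N. a p * c (n - int p))) {0..1}"
      by (intro has_integral_sum finite_atMost has_integral_linear[OF c bounded_linear_mult_right, unfolded o_def])
    moreover have "(\<Sum>p\<le>N. a p * scaleC (cis (2 * pi * (of_int (- (n - int p)) * t))) (g t)) = scaleC (cis (2 * pi * (of_int (- n) * t))) 1"
      if t: "t \<in> {0..1}" for t
    proof -
      have "(\<Sum>p\<le>N. a p * scaleC (cis (2 * pi * (of_int (- (n - int p)) * t))) (g t))
        = scaleC (cis (2 * pi * (of_int (- n) * t))) (P t * g t)"
        unfolding P_def cis_split
        by (simp only: scaleC_sum_right sum_distrib_right scaleC_mult_left scaleC_mult_right scaleC_scaleC)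
      then show ?thesis by (simp add: is_inverse_cancel[OF inv[OF t]])
    qed
    ultimately have "((\<lambda>t. scaleC (cis (2 * pi * (of_int (- n) * t))) 1) has_integral (\<Sum>p\<le>N. a p * c (n - int p))) {0..1}"
      by (rule has_integral_eq[rotated])
    from has_integral_unique[OF this delta] show ?thesis .
  qed
  have conv2: "(\<Sum>p\<le>N. c (n - int p) * a p) = (if n = 0 then 1 else 0)" for n
  proof -
    have "((\<lambda>t. \<Sum>p\<le>N. scaleC (cis (2 * pi * (of_int (- (n - int p)) * t))) (g t) * a p) has_integral (\<Sum>p\<le>N. c (n - int p) * a p)) {0..1}"
      by (intro has_integral_sum finite_atMost has_integral_linear[OF c bounded_linear_mult_left, unfolded o_def])
    moreover have "(\<Sum>p\<le>N. scaleC (cis (2 * pi * (of_int (- (n - int p)) * t))) (g t) * a p) = scaleC (cis (2 * pi * (of_int (- n) * t))) 1"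
      if t: "t \<in> {0..1}" for t
    proof -
      have "(\<Sum>p\<le>N. scaleC (cis (2 * pi * (of_int (- (n - int p)) * t))) (g t) * a p)
        = scaleC (cis (2 * pi * (of_int (- n) * t))) (g t * P t)"
        unfolding P_def cis_split
        by (simp only: scaleC_sum_right sum_distrib_left scaleC_mult_left scaleC_mult_right scaleC_scaleC)
      then show ?thesis by (simp add: is_inverse_cancel[OF inv[OF t]])
    qed
    ultimately have "((\<lambda>t. scaleC (cis (2 * pi * (of_int (- n) * t))) 1) has_integral (\<Sum>p\<le>N. c (n - int p) * a p)) {0..1}"
      by (rule has_integral_eq[rotated])
    from has_integral_unique[OF this delta] show ?thesis .
  qed
  have bounded: "\<exists>B. \<forall>t\<in>{0..1::real}. norm (h t) \<le> B" if "continuous_on {0..1} h" for h :: "real \<Rightarrow> 'r"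
    using compact_imp_bounded[OF compact_continuous_image[OF that]] by (auto simp: bounded_iff)
  obtain C where C: "\<And>t. t \<in> {0..1} \<Longrightarrow> norm (g t) \<le> C"
    using bounded[OF cg] by blast
  have c_le: "norm (c n) \<le> C" for n
  proof -
    have "norm (c n) \<le> C * (1 - 0)"
      unfolding c_def
      by (rule integral_bound[OF _ continuous_on_scaleC[OF c_cis cg]]) (simp_all add: norm_scaleC C)
    then show ?thesis by simp
  qed
  obtain B where B: "\<And>t. t \<in> {0..1} \<Longrightarrow> norm (g' t) \<le> B"
    using bounded[OF cg'] by blast
  \<comment> \<open>Integration by parts: the boundary terms cancel because
    \<open>g 0 = g 1\<close>, and a bound on the derivative of the inverse path bounds
    \<open>q\<close> times the coefficient.\<close>
  have "real q * norm (c (int q)) \<le> B / (2 * pi)" for q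
  proof -
    define z where "z t = cis (2 * pi * (of_int (- int q) * t))" for t
    have dz: "(z has_vector_derivative 2 * pi * \<i> * of_int (- int q) * z t) (at t within {0..1})" for t
      unfolding z_def using cis_has_vector_derivative[of "of_int (- int q)" t] by simp
    have "((\<lambda>t. scaleC (z t) (g' t) + scaleC (2 * pi * \<i> * of_int (- int q) * z t) (g t)) has_integral
        (scaleC (z 1) (g 1) - scaleC (z 0) (g 0))) {0..1}"
      by (rule fundamental_theorem_of_calculus, simp)
         (rule bounded_bilinear.has_vector_derivative[OF bounded_bilinear_scaleC dz g'])
    moreover have "z 1 = 1" "z 0 = 1"
      using cis_multiple_2pi[of "of_int (- int q)"] by (simp_all add: z_def)
    ultimately have 1: "((\<lambda>t. scaleC (z t) (g' t) + scaleC (2 * pi * \<i> * of_int (- int q) * z t) (g t)) has_integral 0) {0..1}"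
      by (simp add: g01)
    have 2: "((\<lambda>t. scaleC (2 * pi * \<i> * of_int (- int q) * z t) (g t)) has_integral scaleC (2 * pi * \<i> * of_int (- int q)) (c (int q))) {0..1}"
      using has_integral_linear[OF c[of "int q"] bounded_linear_scaleC_right[of "2 * pi * \<i> * of_int (- int q)"]]
      by (simp add: o_def scaleC_scaleC z_def)
    have "((\<lambda>t. scaleC (z t) (g' t)) has_integral 0 - scaleC (2 * pi * \<i> * of_int (- int q)) (c (int q))) {0..1}"
      using has_integral_diff[OF 1 2] by simp
    then have "integral {0..1} (\<lambda>t. scaleC (z t) (g' t)) = - scaleC (2 * pi * \<i> * of_int (- int q)) (c (int q))"
      by (simp add: has_integral_iff)
    moreover have "norm (integral {0..1} (\<lambda>t. scaleC (z t) (g' t))) \<le> B * (1 - 0)"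
      unfolding z_def by (rule integral_bound[OF _ continuous_on_scaleC[OF c_cis cg']]) (simp_all add: norm_scaleC B)
    ultimately have "2 * pi * real q * norm (c (int q)) \<le> B"
      by (simp add: norm_scaleC norm_mult)
    then show ?thesis by (simp add: field_simps)
  qed
  then have lim: "(\<lambda>q::nat. c (int q)) \<longlonglongrightarrow> 0"
    by (rule tendsto_zero_of_nat_mult_bounded)
  \<comment> \<open>\<open>laurent_idempotent\<close> wants coefficients that vanish beyond
    \<open>N\<close>, whereas \<open>a\<close> is arbitrary there.\<close>
  define b where "b k = (if k \<le> N then a k else 0)" for k
  define e where "e i j = (\<Sum>k=1..N. b (i + k) * c (- int k - int j))" for i j
  have "(\<Sum>l<N. e i l * e l j) = e i j" for i j
    unfolding e_def
    by (rule laurent_idempotent[OF _ _ _ c_le lim]) (simp_all add: b_def conv1 conv2)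
  moreover have "((\<lambda>t. \<tau> (P' t * g t)) has_integral 2 * pi * \<i> * (\<Sum>i<N. \<tau> (e i i))) {0..1}"
  proof -
    have "((\<lambda>t. \<Sum>m\<le>N. 2 * pi * \<i> * of_nat m * \<tau> (a m * scaleC (cis (2 * pi * (of_int (- (- int m)) * t))) (g t)))
       has_integral (\<Sum>m\<le>N. 2 * pi * \<i> * of_nat m * \<tau> (a m * c (- int m)))) {0..1}"
      by (intro has_integral_sum finite_atMost has_integral_mult_right
          has_integral_linear[OF has_integral_linear[OF c bounded_linear_mult_right] blin, unfolded o_def])
    moreover have "(\<Sum>m\<le>N. 2 * pi * \<i> * of_nat m * \<tau> (a m * scaleC (cis (2 * pi * (of_int (- (- int m)) * t))) (g t))) = \<tau> (P' t * g t)" for t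
      unfolding P'_def
      by (simp add: sum_distrib_right linear_simps scaleC_mult_left scaleC_mult_right scale mult_ac)
    moreover have "(\<Sum>m\<le>N. 2 * pi * \<i> * of_nat m * \<tau> (a m * c (- int m))) = 2 * pi * \<i> * (\<Sum>i<N. \<tau> (e i i))"
    proof -
      have "(\<Sum>i<N. e i i) = (\<Sum>m\<le>N. of_nat m *\<^sub>R (b m * c (- int m)))"
        unfolding e_def by (rule laurent_idempotent_trace) (simp add: b_def)
      also have "\<dots> = (\<Sum>m\<le>N. scaleC (of_nat m) (a m * c (- int m)))"
        by (intro sum.cong refl) (simp add: b_def scaleC_of_real[symmetric])
      finally have "\<tau> (\<Sum>i<N. e i i) = (\<Sum>m\<le>N. of_nat m * \<tau> (a m * c (- int m)))"
        by (simp add: linear_simps scale)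
      then show ?thesis
        by (simp add: linear_simps sum_distrib_left mult_ac)
    qed
    ultimately show ?thesis by simp
  qed
  ultimately show ?thesis
    unfolding P'_def by blast
qed

end

context bounded_trace
begin

text \<open>The scalar loop of winding number \<open>d\<close> that clears the negative frequencies
  adds \<open>2 * pi * \<i> * d * \<tau> 1\<close> to the total logarithmic derivative; the
  subtracted multiple of \<open>\<tau> 1\<close> compensates for it.\<close>

lemma trig_loop_idempotent:
  assumes f: "trig_path f" "\<And>t. (f has_vector_derivative f' t) (at t)"
    and inv: "\<And>t. t \<in> {0..1} \<Longrightarrow> is_inverse (f t) (g t)"
  shows "\<exists>(N::nat) (d::nat) e. (\<forall>i<N. \<forall>j<N. (\<Sum>l<N. e i l * e l j) = e i j) \<and>
    ((\<lambda>t. \<tau> (f' t * g t)) has_integral 2 * pi * \<i> * ((\<Sum>i<N. \<tau> (e i i)) - of_nat d * \<tau> 1)) {0..1}"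
proof -
  obtain d N a where fa: "\<And>t. scaleC (cis (2 * pi * (of_nat d * t))) (f t) = (\<Sum>k\<le>N. scaleC (cis (2 * pi * (of_nat k * t))) (a k))"
    using trig_path_coefficients[OF f(1)] by blast
  define P' where "P' t = (\<Sum>k\<le>N. scaleC (cis (2 * pi * (of_nat k * t))) (scaleC (2 * pi * \<i> * of_nat k) (a k)))" for t
  define z where "z t = cis (2 * pi * (of_nat d * t))" for t
  define y where "y t = cis (- (2 * pi * (of_nat d * t)))" for t
  have yz: "z t * y t = 1" "y t * z t = 1" for t
    unfolding z_def y_def cis_mult by simp_all
  have "is_inverse (\<Sum>k\<le>N. scaleC (cis (2 * pi * (of_nat k * t))) (a k)) (scaleC (y t) (g t))" if t: "t \<in> {0..1}" for t
    unfolding fa[symmetric] z_def[symmetric]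
    by (simp add: is_inverse_def scaleC_mult_left scaleC_mult_right scaleC_scaleC yz is_inverse_cancel[OF inv[OF t]] scaleC_one)
  from polynomial_loop_idempotent[OF this] obtain e where e: "\<forall>i<N. \<forall>j<N. (\<Sum>l<N. e i l * e l j) = e i j"
    and int: "((\<lambda>t. \<tau> (P' t * scaleC (y t) (g t))) has_integral 2 * pi * \<i> * (\<Sum>i<N. \<tau> (e i i))) {0..1}"
    unfolding P'_def by blast
  have P': "P' t = scaleC (z t) (f' t) + scaleC (2 * pi * \<i> * of_nat d * z t) (f t)" for t
  proof (rule vector_derivative_unique_at)
    show "((\<lambda>t. scaleC (z t) (f t)) has_vector_derivative P' t) (at t)"
      unfolding z_def fa P'_def
    proof (intro has_vector_derivative_sum)
      show "((\<lambda>t. scaleC (cis (2 * pi * (of_nat k * t))) (a k)) has_vector_derivative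
         scaleC (cis (2 * pi * (of_nat k * t))) (scaleC (2 * pi * \<i> * of_nat k) (a k))) (at t)" for k
        using scaleC_cis_has_vector_derivative[of "of_nat k" "a k" t UNIV] by simp
    qed
    have "(z has_vector_derivative 2 * pi * \<i> * of_nat d * z t) (at t)"
      unfolding z_def using cis_has_vector_derivative[of "of_nat d" t UNIV] by simp
    then show "((\<lambda>t. scaleC (z t) (f t)) has_vector_derivative
        (scaleC (z t) (f' t) + scaleC (2 * pi * \<i> * of_nat d * z t) (f t))) (at t)"
      by (rule bounded_bilinear.has_vector_derivative[OF bounded_bilinear_scaleC _ f(2)])
  qed
  have const: "((\<lambda>t. 2 * pi * \<i> * of_nat d * \<tau> 1) has_integral 2 * pi * \<i> * of_nat d * \<tau> 1) {0..1::real}"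
    using has_integral_const_real[of "2 * pi * \<i> * of_nat d * \<tau> 1" 0 1] by simp
  have "((\<lambda>t. \<tau> (f' t * g t)) has_integral
      2 * pi * \<i> * (\<Sum>i<N. \<tau> (e i i)) - 2 * pi * \<i> * of_nat d * \<tau> 1) {0..1}"
  proof (rule has_integral_eq[OF _ has_integral_diff[OF int const]])
    fix t :: real assume t: "t \<in> {0..1}"
    have "P' t * scaleC (y t) (g t) = f' t * g t + scaleC (2 * pi * \<i> * of_nat d) 1"
      using yz(1)[of t] unfolding P' distrib_right
      by (simp only: scaleC_mult_left scaleC_mult_right scaleC_scaleC mult.assoc mult.commute[of "y t"] scaleC_one
          mult_1_right is_inverse_cancel[OF inv[OF t]])
    then show "\<tau> (P' t * scaleC (y t) (g t)) - 2 * pi * \<i> * of_nat d * \<tau> 1 = \<tau> (f' t * g t)"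
      by (simp add: linear_simps scale)
  qed
  then have "((\<lambda>t. \<tau> (f' t * g t)) has_integral 2 * pi * \<i> * ((\<Sum>i<N. \<tau> (e i i)) - of_nat d * \<tau> 1)) {0..1}"
    by (simp add: algebra_simps)
  with e show ?thesis by blast
qed

text \<open>The surjectivity half of Bott periodicity, on the level of traces: a polynomial path that is a
  loop is approximated by a trigonometric polynomial with the same total logarithmic derivative.\<close>

theorem connects_one_imp_idempotent:
  assumes "connects 1 w"
  shows "\<exists>(N::nat) (d::nat) e. (\<forall>i<N. \<forall>j<N. (\<Sum>l<N. e i l * e l j) = e i j) \<and>
    w = 2 * pi * \<i> * ((\<Sum>i<N. \<tau> (e i i)) - of_nat d * \<tau> 1)"
proof -
  obtain F F' G where F: "poly_path F" "\<And>t. (F has_vector_derivative F' t) (at t)"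
    "\<And>t. t \<in> {0..1} \<Longrightarrow> is_inverse (F t) (G t)" "F 0 = 1" "F 1 = 1"
    "((\<lambda>t. \<tau> (F' t * G t)) has_integral w) {0..1}"
    using assms unfolding connects_def by blast
  obtain N a where Fa: "\<And>t. F t = (\<Sum>k\<le>N. t ^ k *\<^sub>R a k)"
    using poly_path_coefficients[OF F(1)] by blast
  \<comment> \<open>The value 1 at both ends forces \<open>a 0 = 1\<close> and makes the other
    coefficients sum to 0, so each \<open>t ^ k\<close> may be replaced by \<open>t ^ k - t\<close>.
    These scalar functions agree at 0 and 1, as \<open>trig_approximation\<close> requires.\<close>
  have F_eq: "F t = 1 + (\<Sum>k=1..N. (t ^ k - t) *\<^sub>R a k)" for t
  proof -
    have split: "(\<Sum>k\<le>N. t ^ k *\<^sub>R a k) = a 0 + (\<Sum>k=1..N. t ^ k *\<^sub>R a k)" for t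
      by (simp add: sum.atLeast1_atMost_eq sum.atMost_shift)
    have "a 0 + (\<Sum>k=1..N. 0 ^ k *\<^sub>R a k) = 1"
      using F(4) Fa[of 0] unfolding split by simp
    moreover have "(\<Sum>k=1..N. 0 ^ k *\<^sub>R a k) = 0"
      by (rule sum.neutral) (auto simp: power_0_left)
    ultimately have a0: "a 0 = 1" by simp
    have "(\<Sum>k=1..N. a k) = 0"
      using F(5) Fa[of 1] unfolding split a0 by simp
    then have "(\<Sum>k=1..N. t *\<^sub>R a k) = 0"
      by (simp add: scaleR_sum_right[symmetric])
    then show ?thesis
      unfolding Fa split a0 by (simp add: scaleR_diff_left sum_subtractf)
  qed
  have cF: "continuous_on S F" for S
    by (rule poly_path_continuous[OF F(1)])
  have cG: "continuous_on {0..1} G"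
    by (rule inverse_path_continuous[OF cF F(3)])
  have cF': "continuous_on {0..1} F'"
  proof -
    obtain E where E: "poly_path E" "\<And>t. (F has_vector_derivative E t) (at t)"
      using poly_path_derivative[OF F(1)] by blast
    have "F' = E"
      using F(2) E(2) by (intro ext) (rule vector_derivative_unique_at)
    then show ?thesis
      using poly_path_continuous[OF E(1)] by simp
  qed
  obtain M where "\<forall>x\<in>G ` {0..1}. norm x \<le> M"
    using compact_imp_bounded[OF compact_continuous_image[OF cG]] by (auto simp: bounded_iff)
  then have M: "norm (G t) \<le> M" if "t \<in> {0..1}" for t
    using that by blast
  have M0: "0 \<le> M"
    using order_trans[OF norm_ge_zero M[of 0]] by simp
  define A where "A = (\<Sum>k=1..N. norm (a k))"
  have A0: "0 \<le> A" unfolding A_def by (rule sum_nonneg) simp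
  \<comment> \<open>Chosen so that \<open>\<epsilon> * A * M \<le> 1 / 2\<close>, which puts
    \<open>f t * G t\<close> into the domain of the Neumann series; the summand 1 guards against
    \<open>A * M = 0\<close>.\<close>
  define \<epsilon> where "\<epsilon> = 1 / (2 * (A * M + 1))"
  have AM: "0 \<le> A * M" using A0 M0 by simp
  then have \<epsilon>: "\<epsilon> > 0" by (simp add: \<epsilon>_def)
  have "\<exists>p::real \<Rightarrow> complex. trig_path p \<and> (\<forall>t\<in>{0..1}. norm (p t - of_real (t ^ k - t)) < \<epsilon>)" if "k \<ge> 1" for k :: nat
  proof -
    have c: "continuous_on {0..1} (\<lambda>t::real. t ^ k - t)"
      by (intro continuous_intros)
    have eq: "(0::real) ^ k - 0 = 1 ^ k - 1"
      using that by simp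
    show ?thesis
      by (rule trig_approximation[OF c eq \<epsilon>]) blast
  qed
  then have "\<forall>k. \<exists>p::real \<Rightarrow> complex. k \<ge> 1 \<longrightarrow> trig_path p \<and> (\<forall>t\<in>{0..1}. norm (p t - of_real (t ^ k - t)) < \<epsilon>)"
    by blast
  from choice[OF this] obtain p :: "nat \<Rightarrow> real \<Rightarrow> complex" where p: "\<And>k. k \<ge> 1 \<Longrightarrow> trig_path (p k)"
    "\<And>k t. k \<ge> 1 \<Longrightarrow> t \<in> {0..1} \<Longrightarrow> norm (p k t - of_real (t ^ k - t)) < \<epsilon>"
    by blast
  define f where "f t = 1 + (\<Sum>k=1..N. scaleC (p k t) (a k))" for t
  have "trig_path (\<lambda>t. \<Sum>k=1..n. scaleC (p k t) (a k))" for n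
  proof (induction n)
    case (Suc n)
    then show ?case
      using trig_path.add[OF Suc trig_path_scaleC_const[OF p(1)[of "Suc n"], of "a (Suc n)"]] by simp
  qed (simp add: trig_path_const)
  then have f: "trig_path f"
    unfolding f_def by (intro trig_path.add trig_path_const)
  obtain f' where f': "trig_path f'" "\<And>t. (f has_vector_derivative f' t) (at t)"
    using trig_path_derivative[OF f] by blast
  have Ff: "norm (F t - f t) \<le> \<epsilon> * A" if t: "t \<in> {0..1}" for t
  proof -
    have "F t - f t = (\<Sum>k=1..N. scaleC (of_real (t ^ k - t) - p k t) (a k))"
      unfolding F_eq f_def
      by (simp add: sum_subtractf[symmetric] bounded_bilinear.diff_left[OF bounded_bilinear_scaleC] scaleC_of_real del: of_real_diff of_real_power)
    also have "norm \<dots> \<le> (\<Sum>k=1..N. \<epsilon> * norm (a k))"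
    proof (rule sum_norm_le)
      fix k assume "k \<in> {1..N}"
      then have "norm (of_real (t ^ k - t) - p k t) \<le> \<epsilon>"
        using p(2)[of k t] t by (simp add: norm_minus_commute less_imp_le)
      then show "norm (scaleC (of_real (t ^ k - t) - p k t) (a k)) \<le> \<epsilon> * norm (a k)"
        unfolding norm_scaleC by (rule mult_right_mono) simp
    qed
    finally show ?thesis by (simp add: A_def sum_distrib_left)
  qed
  \<comment> \<open>Since \<open>f = (1 - r) * F\<close>, the totals of \<open>f\<close> and
    \<open>F\<close> differ by the change of \<open>log_series\<close> along \<open>r\<close>, and
    this change is 0 because \<open>r\<close> has equal ends.\<close>
  define r where "r t = 1 - f t * G t" for t
  have r_le: "norm (r t) \<le> 1 / 2" if t: "t \<in> {0..1}" for t
  proof -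
    have "r t = (F t - f t) * G t"
      by (simp add: r_def left_diff_distrib is_inverse_cancel[OF F(3)[OF t]])
    then have "norm (r t) \<le> norm (F t - f t) * norm (G t)"
      by (simp add: norm_mult_ineq)
    also have "\<dots> \<le> \<epsilon> * A * M"
      by (intro mult_mono Ff M t norm_ge_zero) (use \<epsilon> A0 in simp)
    also have "\<dots> \<le> 1 / 2"
      using AM by (simp add: \<epsilon>_def field_simps)
    finally show ?thesis .
  qed
  have "\<exists>H. is_inverse (1 - r t) H" if "t \<in> {0..1}" for t
    using r_le[OF that] by (intro is_inverse_one_minus) simp
  then obtain H where H: "\<And>t. t \<in> {0..1} \<Longrightarrow> is_inverse (1 - r t) (H t)"
    by metis
  have inv_f: "is_inverse (f t) (G t * H t)" if t: "t \<in> {0..1}" for t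
  proof -
    have "(1 - r t) * F t = f t"
      by (simp add: r_def mult.assoc is_inverse_cancel[OF F(3)[OF t]])
    then show ?thesis
      using is_inverse_mult[OF H[OF t] F(3)[OF t]] by simp
  qed
  define G' where "G' t = - (G t * F' t * G t)" for t
  have G': "(G has_vector_derivative G' t) (at t within {0..1})" if "t \<in> {0..1}" for t
    unfolding G'_def
    by (rule inverse_path_derivative[OF _ F(3) that]) (rule has_vector_derivative_at_within[OF F(2)])
  define r' where "r' t = - (f t * G' t + f' t * G t)" for t
  have int: "((\<lambda>t. \<tau> (r' t * H t)) has_integral (log_series (r 1) - log_series (r 0))) {0..1}"
  proof (rule log_series_has_integral[OF _ _ r_le _ H])
    show "(r has_vector_derivative r' t) (at t within {0..1})" if t: "t \<in> {0..1}" for t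
      unfolding r_def r'_def
      using has_vector_derivative_diff[OF has_vector_derivative_const
          has_vector_derivative_mult[OF has_vector_derivative_at_within[OF f'(2)] G'[OF t]]] by simp
    show "continuous_on {0..1} r'"
      unfolding r'_def G'_def
      by (intro continuous_intros cG cF' trig_path_continuous f f')
  qed auto
  have "G 0 = 1" "G 1 = 1"
    using F(3)[of 0] F(3)[of 1] F(4,5) by (auto simp: is_inverse_def)
  then have "r 0 = r 1"
    using trig_path_periodic[OF f] by (simp add: r_def)
  then have int0: "((\<lambda>t. \<tau> (r' t * H t)) has_integral 0) {0..1}"
    using int by simp
  have intf: "((\<lambda>t. \<tau> (f' t * (G t * H t))) has_integral w - 0) {0..1}"
  proof (rule has_integral_eq[OF _ has_integral_diff[OF F(6) int0]])
    fix t :: real assume t: "t \<in> {0..1}"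
    have "r' t * H t = (1 - r t) * (F' t * G t) * H t - f' t * (G t * H t)"
      by (simp add: r'_def G'_def r_def left_diff_distrib mult.assoc)
    then have "\<tau> (r' t * H t) = \<tau> (F' t * G t) - \<tau> (f' t * (G t * H t))"
      by (simp add: linear_simps conjugate[OF H[OF t]])
    then show "\<tau> (F' t * G t) - \<tau> (r' t * H t) = \<tau> (f' t * (G t * H t))"
      by simp
  qed
  have "\<exists>(n::nat) (d::nat) e. (\<forall>i<n. \<forall>j<n. (\<Sum>l<n. e i l * e l j) = e i j) \<and>
    ((\<lambda>t. \<tau> (f' t * (G t * H t))) has_integral 2 * pi * \<i> * ((\<Sum>i<n. \<tau> (e i i)) - of_nat d * \<tau> 1)) {0..1}"
    by (rule trig_loop_idempotent[OF f f'(2) inv_f])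
  then obtain n :: nat and d e where e: "\<forall>i<n. \<forall>j<n. (\<Sum>l<n. e i l * e l j) = e i j"
    and "((\<lambda>t. \<tau> (f' t * (G t * H t))) has_integral 2 * pi * \<i> * ((\<Sum>i<n. \<tau> (e i i)) - of_nat d * \<tau> 1)) {0..1}"
    by blast
  from has_integral_unique[OF intf this(2)]
  have "w = 2 * pi * \<i> * ((\<Sum>i<n. \<tau> (e i i)) - of_nat d * \<tau> 1)"
    by simp
  with e show ?thesis by blast
qed

end

section \<open>Matrices and Whitehead's lemma\<close>

text \<open>Indexing by a finite type turns each matrix algebra into an instance of the Banach
  algebra class, so everything proved about \<open>bounded_trace\<close> applies to it
  again.\<close>

typedef ('a, 'n) sq_matrix = "UNIV :: ('n \<Rightarrow> 'n \<Rightarrow> 'a) set"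
  morphisms entry Mat by simp

lemma entry_Mat [simp]: "entry (Mat f) = f"
  by (simp add: Mat_inverse)

lemma sq_matrix_eq_iff: "x = y \<longleftrightarrow> (\<forall>i j. entry x i j = entry y i j)"
  by (metis entry_inject ext)

instantiation sq_matrix :: (complex_banach_algebra, finite) real_normed_vector
begin

definition zero_sq_matrix :: "('a, 'b) sq_matrix" where "zero_sq_matrix = Mat (\<lambda>i j. 0)"
definition plus_sq_matrix :: "('a, 'b) sq_matrix \<Rightarrow> ('a, 'b) sq_matrix \<Rightarrow> ('a, 'b) sq_matrix"
  where "plus_sq_matrix x y = Mat (\<lambda>i j. entry x i j + entry y i j)"
definition minus_sq_matrix :: "('a, 'b) sq_matrix \<Rightarrow> ('a, 'b) sq_matrix \<Rightarrow> ('a, 'b) sq_matrix"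
  where "minus_sq_matrix x y = Mat (\<lambda>i j. entry x i j - entry y i j)"
definition uminus_sq_matrix :: "('a, 'b) sq_matrix \<Rightarrow> ('a, 'b) sq_matrix"
  where "uminus_sq_matrix x = Mat (\<lambda>i j. - entry x i j)"
definition scaleR_sq_matrix :: "real \<Rightarrow> ('a, 'b) sq_matrix \<Rightarrow> ('a, 'b) sq_matrix"
  where "scaleR_sq_matrix r x = Mat (\<lambda>i j. r *\<^sub>R entry x i j)"
text \<open>The sum of all entry norms is submultiplicative and makes completeness an entrywise
  matter; the price is that the identity may have norm greater than 1.\<close>

definition norm_sq_matrix :: "('a, 'b) sq_matrix \<Rightarrow> real"
  where "norm_sq_matrix x = (\<Sum>i\<in>UNIV. \<Sum>j\<in>UNIV. norm (entry x i j))"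
definition dist_sq_matrix :: "('a, 'b) sq_matrix \<Rightarrow> ('a, 'b) sq_matrix \<Rightarrow> real"
  where "dist_sq_matrix x y = norm (x - y)"
definition sgn_sq_matrix :: "('a, 'b) sq_matrix \<Rightarrow> ('a, 'b) sq_matrix"
  where "sgn_sq_matrix x = inverse (norm x) *\<^sub>R x"
definition uniformity_sq_matrix :: "(('a, 'b) sq_matrix \<times> ('a, 'b) sq_matrix) filter"
  where "uniformity_sq_matrix = (INF e\<in>{0 <..}. principal {(x, y). dist x y < e})"
definition open_sq_matrix :: "('a, 'b) sq_matrix set \<Rightarrow> bool"
  where "open_sq_matrix U \<longleftrightarrow> (\<forall>x\<in>U. eventually (\<lambda>(x', y). x' = x \<longrightarrow> y \<in> U) uniformity)"

lemma entry_linear_simps: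
  "entry (0 :: ('a, 'b) sq_matrix) i j = 0"
  "entry (x + y :: ('a, 'b) sq_matrix) i j = entry x i j + entry y i j"
  "entry (x - y :: ('a, 'b) sq_matrix) i j = entry x i j - entry y i j"
  "entry (- x :: ('a, 'b) sq_matrix) i j = - entry x i j"
  "entry (r *\<^sub>R x :: ('a, 'b) sq_matrix) i j = r *\<^sub>R entry x i j"
  by (simp_all add: zero_sq_matrix_def plus_sq_matrix_def minus_sq_matrix_def
      uminus_sq_matrix_def scaleR_sq_matrix_def)

instance
proof
  fix x y z :: "('a, 'b) sq_matrix" and r s :: real
  show "x + y + z = x + (y + z)" "x + y = y + x" "0 + x = x" "- x + x = 0" "x - y = x + - y"
    "r *\<^sub>R (x + y) = r *\<^sub>R x + r *\<^sub>R y" "(r + s) *\<^sub>R x = r *\<^sub>R x + s *\<^sub>R x"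
    "r *\<^sub>R s *\<^sub>R x = (r * s) *\<^sub>R x" "1 *\<^sub>R x = x"
    by (simp_all add: sq_matrix_eq_iff entry_linear_simps scaleR_add_left scaleR_add_right)
  show "norm x = 0 \<longleftrightarrow> x = 0"
    by (simp add: norm_sq_matrix_def sum_nonneg_eq_0_iff sum_nonneg sq_matrix_eq_iff entry_linear_simps)
  show "norm (x + y) \<le> norm x + norm y"
    unfolding norm_sq_matrix_def sum.distrib[symmetric] entry_linear_simps by (intro sum_mono norm_triangle_ineq)
  show "norm (r *\<^sub>R x) = \<bar>r\<bar> * norm x"
    by (simp add: norm_sq_matrix_def entry_linear_simps sum_distrib_left)
qed (fact dist_sq_matrix_def sgn_sq_matrix_def uniformity_sq_matrix_def open_sq_matrix_def)+

end

lemma norm_entry_le: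
  fixes x :: "('a::complex_banach_algebra, 'b::finite) sq_matrix"
  shows "norm (entry x i j) \<le> norm x"
proof -
  have "norm (entry x i j) \<le> (\<Sum>j\<in>UNIV. norm (entry x i j))"
    by (rule member_le_sum) auto
  also have "\<dots> \<le> norm x"
    unfolding norm_sq_matrix_def by (rule member_le_sum) (auto intro: sum_nonneg)
  finally show ?thesis .
qed

instantiation sq_matrix :: (complex_banach_algebra, finite) complex_banach_algebra
begin

definition one_sq_matrix :: "('a, 'b) sq_matrix" where "one_sq_matrix = Mat (\<lambda>i j. if i = j then 1 else 0)"
definition times_sq_matrix :: "('a, 'b) sq_matrix \<Rightarrow> ('a, 'b) sq_matrix \<Rightarrow> ('a, 'b) sq_matrix"
  where "times_sq_matrix x y = Mat (\<lambda>i j. \<Sum>k\<in>UNIV. entry x i k * entry y k j)"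
definition scaleC_sq_matrix :: "complex \<Rightarrow> ('a, 'b) sq_matrix \<Rightarrow> ('a, 'b) sq_matrix"
  where "scaleC_sq_matrix z x = Mat (\<lambda>i j. scaleC z (entry x i j))"

lemma entry_simps:
  "entry (1 :: ('a, 'b) sq_matrix) i j = (if i = j then 1 else 0)"
  "entry (x * y :: ('a, 'b) sq_matrix) i j = (\<Sum>k\<in>UNIV. entry x i k * entry y k j)"
  "entry (scaleC z x :: ('a, 'b) sq_matrix) i j = scaleC z (entry x i j)"
  by (simp_all add: one_sq_matrix_def times_sq_matrix_def scaleC_sq_matrix_def)

instance
proof
  fix x y z :: "('a, 'b) sq_matrix" and r s :: real and c d :: complex
  show "scaleC c (x + y) = scaleC c x + scaleC c y" "scaleC (c + d) x = scaleC c x + scaleC d x"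
    "scaleC c (scaleC d x) = scaleC (c * d) x" "scaleC (complex_of_real r) x = r *\<^sub>R x"
    by (simp_all add: sq_matrix_eq_iff entry_simps entry_linear_simps scaleC_add_left
        scaleC_add_right scaleC_scaleC scaleC_of_real)
  show "(x + y) * z = x * z + y * z" "x * (y + z) = x * y + x * z"
    "r *\<^sub>R x * y = r *\<^sub>R (x * y)" "x * r *\<^sub>R y = r *\<^sub>R (x * y)"
    "scaleC c x * y = scaleC c (x * y)" "x * scaleC c y = scaleC c (x * y)"
    by (simp_all add: sq_matrix_eq_iff entry_simps entry_linear_simps distrib_left distrib_right sum.distrib
        scaleR_sum_right scaleC_sum_right scaleC_mult_left scaleC_mult_right)
  show "1 * x = x" "x * 1 = x"
    by (simp_all add: sq_matrix_eq_iff entry_simps if_distrib[where f = "\<lambda>a. a * _"]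
        if_distrib[where f = "\<lambda>a. _ * a"] cong: if_cong)
  show "x * y * z = x * (y * z)"
    unfolding sq_matrix_eq_iff entry_simps sum_distrib_left sum_distrib_right
    by (subst sum.swap) (simp add: mult.assoc)
  show "norm (scaleC c x) = cmod c * norm x"
    by (simp add: norm_sq_matrix_def entry_simps sum_distrib_left norm_scaleC)
  show "norm (x * y) \<le> norm x * norm y"
  proof -
    have "norm (x * y) \<le> (\<Sum>i\<in>UNIV. \<Sum>j\<in>UNIV. \<Sum>k\<in>UNIV. norm (entry x i k) * norm (entry y k j))"
      unfolding norm_sq_matrix_def entry_simps
      by (intro sum_mono order_trans[OF norm_sum] norm_mult_ineq)
    also have "\<dots> = (\<Sum>i\<in>UNIV. \<Sum>k\<in>UNIV. norm (entry x i k) * (\<Sum>j\<in>UNIV. norm (entry y k j)))"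
      unfolding sum_distrib_left by (intro sum.cong refl sum.swap)
    also have "\<dots> \<le> (\<Sum>i\<in>UNIV. \<Sum>k\<in>UNIV. norm (entry x i k) * norm y)"
    proof (intro sum_mono mult_left_mono norm_ge_zero)
      show "(\<Sum>j\<in>UNIV. norm (entry y k j)) \<le> norm y" for k
        unfolding norm_sq_matrix_def by (rule member_le_sum) (auto intro: sum_nonneg)
    qed
    also have "\<dots> = norm x * norm y"
      by (simp add: norm_sq_matrix_def sum_distrib_right)
    finally show ?thesis .
  qed
next
  fix X :: "nat \<Rightarrow> ('a, 'b) sq_matrix"
  assume X: "Cauchy X"
  have "Cauchy (\<lambda>n. entry (X n) i j)" for i j
  proof (rule CauchyI)
    fix e :: real assume "0 < e"
    then obtain M where M: "\<And>m n. m \<ge> M \<Longrightarrow> n \<ge> M \<Longrightarrow> norm (X m - X n) < e"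
      using CauchyD[OF X] by blast
    have "norm (entry (X m) i j - entry (X n) i j) < e" if "m \<ge> M" "n \<ge> M" for m n
      using le_less_trans[OF norm_entry_le[of "X m - X n" i j] M[OF that]]
      by (simp add: entry_linear_simps)
    then show "\<exists>M. \<forall>m\<ge>M. \<forall>n\<ge>M. norm (entry (X m) i j - entry (X n) i j) < e"
      by blast
  qed
  then have "\<exists>l. (\<lambda>n. entry (X n) i j) \<longlonglongrightarrow> l" for i j
    using Cauchy_convergent_iff convergent_def by blast
  then obtain l where l: "\<And>i j. (\<lambda>n. entry (X n) i j) \<longlonglongrightarrow> l i j"
    by metis
  have "(\<lambda>n. \<Sum>i\<in>UNIV. \<Sum>j\<in>UNIV. norm (entry (X n) i j - l i j)) \<longlonglongrightarrow> (\<Sum>i\<in>(UNIV::'b set). \<Sum>j\<in>(UNIV::'b set). 0)"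
    by (intro tendsto_sum tendsto_norm_zero LIM_zero l)
  then have "(\<lambda>n. norm (X n - Mat l)) \<longlonglongrightarrow> 0"
    by (simp add: norm_sq_matrix_def entry_linear_simps)
  then have "X \<longlonglongrightarrow> Mat l"
    by (rule LIM_zero_cancel[OF tendsto_norm_zero_cancel])
  then show "convergent X"
    unfolding convergent_def ..
qed

end

section \<open>Matrix units and elementary matrices\<close>

definition unitm :: "'n \<Rightarrow> 'n \<Rightarrow> 'a::zero \<Rightarrow> ('a, 'n) sq_matrix" where
  "unitm p q x = Mat (\<lambda>i j. if i = p \<and> j = q then x else 0)"

lemma unitm_simps:
  fixes x y :: "'a::complex_banach_algebra" and p q :: "'n::finite"
  shows "unitm p q 0 = 0" "unitm p q (x + y) = unitm p q x + unitm p q y"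
    "unitm p q (x - y) = unitm p q x - unitm p q y" "unitm p q (- x) = - unitm p q x"
  by (auto simp: unitm_def sq_matrix_eq_iff entry_linear_simps)

lemma unitm_mult:
  fixes x y :: "'a::complex_banach_algebra" and p q :: "'n::finite"
  shows "unitm p q x * unitm r s y = (if q = r then unitm p s (x * y) else 0)"
proof -
  have "(\<Sum>k\<in>UNIV. (if i = p \<and> k = q then x else 0) * (if k = r \<and> j = s then y else 0))
      = (\<Sum>k\<in>UNIV. if k = q then (if i = p \<and> q = r \<and> j = s then x * y else 0) else 0)" for i j
    by (intro sum.cong) auto
  then show ?thesis
    by (auto simp: unitm_def sq_matrix_eq_iff entry_simps entry_linear_simps)
qed

lemma norm_unitm:
  fixes x :: "'a::complex_banach_algebra" and p q :: "'n::finite"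
  shows "norm (unitm p q x) = norm x"
proof -
  have "norm (unitm p q x) = (\<Sum>i\<in>UNIV. \<Sum>j\<in>UNIV. if j = q then (if i = p then norm x else 0) else 0)"
    unfolding unitm_def norm_sq_matrix_def entry_Mat by (intro sum.cong refl) auto
  then show ?thesis by simp
qed

lemma unitm_power_Suc:
  fixes x :: "'a::complex_banach_algebra" and p :: "'n::finite"
  shows "unitm p p x ^ Suc k = unitm p p (x ^ Suc k)"
  by (induction k) (simp_all add: unitm_mult)

definition diag_at :: "'n::finite \<Rightarrow> 'a::complex_banach_algebra \<Rightarrow> ('a, 'n) sq_matrix" where
  "diag_at p u = 1 + unitm p p (u - 1)"

lemma diag_at_one [simp]: "diag_at p 1 = 1"
  by (simp add: diag_at_def unitm_simps)

lemma diag_at_mult: "diag_at p u * diag_at p v = diag_at p (u * v)"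
  by (simp add: diag_at_def algebra_simps unitm_simps unitm_mult)

lemma diag_at_commute: "p \<noteq> q \<Longrightarrow> diag_at p u * diag_at q v = diag_at q v * diag_at p u"
  by (simp add: diag_at_def algebra_simps unitm_simps unitm_mult)

lemma is_inverse_diag_at: "is_inverse u v \<Longrightarrow> is_inverse (diag_at p u) (diag_at p v)"
  by (simp add: is_inverse_def diag_at_mult)

text \<open>The classical factorisation: writing \<open>w(u)\<close> for the first three elementary
  factors, the last three are \<open>w(-1)\<close>, and \<open>w(u)\<close> times
  \<open>w(-1)\<close> is diagonal. Every factor is of the form treated in
  \<open>connects_nilpotent\<close>.\<close>

lemma whitehead:
  fixes u :: "'a::complex_banach_algebra" and p q :: "'n::finite"
  assumes "is_inverse u v" and pq: "p \<noteq> q"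
  shows "diag_at p u * diag_at q v =
    (1 + unitm p q u) * (1 + unitm q p (- v)) * (1 + unitm p q u) *
    ((1 + unitm p q (- 1)) * (1 + unitm q p 1) * (1 + unitm p q (- 1)))"
proof -
  have uv: "u * v = 1" "v * u = 1" using assms by (auto simp: is_inverse_def)
  show ?thesis
    using pq not_sym[OF pq] by (simp add: diag_at_def distrib_left distrib_right unitm_simps unitm_mult uv algebra_simps)
qed

context bounded_trace
begin

definition sq_trace :: "('r, 'n::finite) sq_matrix \<Rightarrow> complex" where
  "sq_trace x = (\<Sum>i\<in>UNIV. \<tau> (entry x i i))"

lemma bounded_trace_sq_trace: "bounded_trace (sq_trace :: ('r, 'n::finite) sq_matrix \<Rightarrow> complex)"
proof (rule bounded_trace.intro)
  obtain K where K: "K > 0" "\<And>x. norm (\<tau> x) \<le> K * norm x"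
    using bound by blast
  show "bounded_linear (sq_trace :: ('r, 'n) sq_matrix \<Rightarrow> complex)"
  proof
    fix x y :: "('r, 'n) sq_matrix" and r :: real
    show "sq_trace (x + y) = sq_trace x + sq_trace y"
      by (simp add: sq_trace_def entry_linear_simps linear_simps sum.distrib)
    show "sq_trace (r *\<^sub>R x) = r *\<^sub>R sq_trace x"
      by (simp add: sq_trace_def entry_linear_simps linear_scale[OF bounded_linear.linear[OF blin]] scaleR_sum_right)
    have "norm (sq_trace x) \<le> (of_nat CARD('n) * K) * norm x" for x :: "('r, 'n) sq_matrix"
    proof -
      have "norm (sq_trace x) \<le> (\<Sum>i\<in>(UNIV::'n set). K * norm x)"
        unfolding sq_trace_def
        by (intro sum_norm_le order_trans[OF K(2)] mult_left_mono norm_entry_le) (use K in simp)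
      then show ?thesis by (simp add: mult.assoc)
    qed
    then show "\<exists>K. \<forall>x :: ('r, 'n) sq_matrix. norm (sq_trace x) \<le> norm x * K"
      by (metis mult.commute)
  qed
  show "sq_trace (scaleC z x) = z * sq_trace x" for z and x :: "('r, 'n) sq_matrix"
    by (simp add: sq_trace_def entry_simps scale sum_distrib_left)
  show "sq_trace (x * y) = sq_trace (y * x)" for x y :: "('r, 'n) sq_matrix"
    unfolding sq_trace_def entry_simps linear_simps
    by (subst sum.swap) (simp add: commute)
qed

lemma sq_trace_unitm: "sq_trace (unitm p q x :: ('r, 'n::finite) sq_matrix) = (if p = q then \<tau> x else 0)"
proof -
  have "sq_trace (unitm p q x :: ('r, 'n) sq_matrix) = (\<Sum>i\<in>UNIV. if i = p then (if p = q then \<tau> x else 0) else 0)"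
    unfolding sq_trace_def unitm_def by (intro sum.cong) (auto simp: linear_simps)
  then show ?thesis by simp
qed

lemma log_series_unitm:
  "bounded_trace.log_series sq_trace (unitm p p x :: ('r, 'n::finite) sq_matrix) = log_series x"
  unfolding log_series_def bounded_trace.log_series_def[OF bounded_trace_sq_trace] unitm_power_Suc
  by (simp add: sq_trace_unitm)

lemma connects_whitehead:
  assumes uv: "is_inverse u v" and pq: "p \<noteq> (q::'n::finite)"
  shows "bounded_trace.connects sq_trace (diag_at p u * diag_at q v) 0"
proof -
  interpret M: bounded_trace "sq_trace :: ('r, 'n) sq_matrix \<Rightarrow> complex"
    by (rule bounded_trace_sq_trace)
  have el: "M.connects (1 + unitm r s x) 0" if "r \<noteq> s" for r s x
    using that not_sym[OF that] by (intro M.connects_nilpotent) (simp_all add: unitm_mult sq_trace_unitm)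
  have m: "M.connects (g * h) 0" if "M.connects g 0" "M.connects h 0" for g h
    using M.connects_mult[OF that] by simp
  show ?thesis
    unfolding whitehead[OF uv pq] using pq by (intro m el) auto
qed

text \<open>Correct \<open>u\<close> by its inverse at place \<open>q\<close> and \<open>v\<close>
  by its inverse at place \<open>r\<close>. The four corrected matrices, multiplied in commutator
  order, leave the commutator at \<open>p\<close> and \<open>u' * u\<close>, \<open>v' * v\<close>
  at the other places; separate places keep the corrections from interfering.\<close>

lemma connects_commutator:
  assumes u: "is_inverse u u'" and v: "is_inverse v v'" and pqr: "p \<noteq> q" "p \<noteq> r" "q \<noteq> (r::'n::finite)"
  shows "bounded_trace.connects sq_trace (diag_at p (u * v * u' * v')) 0"
proof -
  interpret M: bounded_trace "sq_trace :: ('r, 'n) sq_matrix \<Rightarrow> complex"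
    by (rule bounded_trace_sq_trace)
  have m: "M.connects (g * h) 0" if "M.connects g 0" "M.connects h 0" for g h
    using M.connects_mult[OF that] by simp
  have "M.connects ((diag_at p u * diag_at q u') * (diag_at p v * diag_at r v') *
      (diag_at p u' * diag_at q u) * (diag_at p v' * diag_at r v)) 0"
    by (intro m connects_whitehead u v is_inverse_sym[OF u] is_inverse_sym[OF v] pqr)
  also have "(diag_at p u * diag_at q u') * (diag_at p v * diag_at r v') *
      (diag_at p u' * diag_at q u) * (diag_at p v' * diag_at r v)
    = diag_at p (u * v * u' * v') * diag_at q (u' * u) * diag_at r (v' * v)"
    by (simp only: diag_at_mult[symmetric] mult.assoc)
       (metis (no_types, lifting) diag_at_commute pqr mult.assoc)
  finally show ?thesis
    using u v by (simp add: is_inverse_def)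
qed

end

section \<open>All unital C*-algebras inside one Banach algebra\<close>

context unital_cstar_algebra
begin

lemma scalar_simps [simp]:
  "carrier complex_ring = UNIV" "z \<otimes>\<^bsub>complex_ring\<^esub> w = z * w" "z \<oplus>\<^bsub>complex_ring\<^esub> w = z + w"
  "\<one>\<^bsub>complex_ring\<^esub> = 1" "\<zero>\<^bsub>complex_ring\<^esub> = 0"
  by (simp_all add: complex_ring_def)

lemma smult_closed [simp]: "x \<in> carrier A \<Longrightarrow> z \<odot>\<^bsub>A\<^esub> x \<in> carrier A"
  using scalars.smult_closed[of z x] by simp

lemma smult_add_left: "x \<in> carrier A \<Longrightarrow> (z + w) \<odot>\<^bsub>A\<^esub> x = z \<odot>\<^bsub>A\<^esub> x \<oplus> w \<odot>\<^bsub>A\<^esub> x"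
  using scalars.smult_l_distr[of z w x] by simp

lemma smult_add_right: "x \<in> carrier A \<Longrightarrow> y \<in> carrier A \<Longrightarrow> z \<odot>\<^bsub>A\<^esub> (x \<oplus> y) = z \<odot>\<^bsub>A\<^esub> x \<oplus> z \<odot>\<^bsub>A\<^esub> y"
  using scalars.smult_r_distr[of z x y] by simp

lemma smult_smult: "x \<in> carrier A \<Longrightarrow> z \<odot>\<^bsub>A\<^esub> (w \<odot>\<^bsub>A\<^esub> x) = (z * w) \<odot>\<^bsub>A\<^esub> x"
  using scalars.smult_assoc1[of z w x] by simp

lemma smult_one [simp]: "x \<in> carrier A \<Longrightarrow> 1 \<odot>\<^bsub>A\<^esub> x = x"
  using scalars.smult_one[of x] by simp

lemma smult_zero [simp]: "x \<in> carrier A \<Longrightarrow> 0 \<odot>\<^bsub>A\<^esub> x = \<zero>"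
  using scalars.smult_l_null[of x] by simp

lemma smult_minus_one:
  assumes x: "x \<in> carrier A"
  shows "(-1) \<odot>\<^bsub>A\<^esub> x = \<ominus> x"
proof -
  have "(-1) \<odot>\<^bsub>A\<^esub> x \<oplus> x = (-1 + 1) \<odot>\<^bsub>A\<^esub> x"
    using x by (simp only: smult_add_left smult_one)
  also have "\<dots> = \<zero>" using x by simp
  finally show ?thesis
    using x by (intro minus_equality[symmetric]) auto
qed

lemma cnorm_zero [simp]: "cnorm A \<zero> = 0"
  by (simp add: cnorm_eq_0)

lemma cnorm_minus: "x \<in> carrier A \<Longrightarrow> cnorm A (\<ominus> x) = cnorm A x"
  using cnorm_smult[of x "-1"] by (simp add: smult_minus_one)

lemma cnorm_nonneg: "x \<in> carrier A \<Longrightarrow> 0 \<le> cnorm A x"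
  using cnorm_triangle[of x "\<ominus> x"] by (simp add: cnorm_minus r_neg)

lemma cnorm_minus_commute: "x \<in> carrier A \<Longrightarrow> y \<in> carrier A \<Longrightarrow> cnorm A (x \<ominus> y) = cnorm A (y \<ominus> x)"
  using cnorm_minus[of "x \<ominus> y"] by (simp add: minus_eq minus_add r_neg l_neg a_comm)

lemma star_one: "star A \<one> = \<one>"
proof -
  have "star A (star A \<one> \<otimes> \<one>) = star A \<one> \<otimes> star A (star A \<one>)"
    by (rule star_mult) (simp_all add: star_closed)
  then show ?thesis
    by (simp add: star_closed star_star)
qed

text \<open>By the C*-identity the norm of the unit equals its own square; the value 0 occurs for
  the zero algebra, so equality cannot be claimed.\<close>

lemma cnorm_one_le: "cnorm A \<one> \<le> 1"
proof -
  have "cnorm A \<one> = (cnorm A \<one>)\<^sup>2"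
    using cstar_identity[of \<one>] by (simp add: star_one)
  then have "cnorm A \<one> = 0 \<or> cnorm A \<one> = 1"
    by (simp add: power2_eq_square)
  then show ?thesis by auto
qed

lemma Metric_space_cstar: "Metric_space (carrier A) (cstar_dist A)"
proof
  fix x y z
  show "0 \<le> cstar_dist A x y"
    by (simp add: cstar_dist_def cnorm_nonneg)
  show "cstar_dist A x y = cstar_dist A y x"
    by (simp add: cstar_dist_def cnorm_minus_commute)
  assume x: "x \<in> carrier A" and y: "y \<in> carrier A"
  then have "x \<ominus> y = \<zero> \<longleftrightarrow> x = y"
    by (auto simp: minus_eq r_neg) (metis minus_equality minus_minus a_inv_closed)
  then show "cstar_dist A x y = 0 \<longleftrightarrow> x = y"
    using x y by (simp add: cstar_dist_def cnorm_eq_0)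
  assume z: "z \<in> carrier A"
  have "x \<ominus> z = (x \<ominus> y) \<oplus> (y \<ominus> z)"
    using x y z by (simp add: minus_eq) (metis a_assoc a_inv_closed add.m_closed l_neg r_zero)
  then show "cstar_dist A x z \<le> cstar_dist A x y + cstar_dist A y z"
    using cnorm_triangle[of "x \<ominus> y" "y \<ominus> z"] x y z by (simp add: cstar_dist_def)
qed

sublocale metric: Metric_space "carrier A" "cstar_dist A"
  by (rule Metric_space_cstar)

lemma cstar_dist_eq: "x \<in> carrier A \<Longrightarrow> y \<in> carrier A \<Longrightarrow> cstar_dist A x y = cnorm A (x \<ominus> y)"
  by (simp add: cstar_dist_def)

end

text \<open>A type cannot depend on a given C*-algebra. The bounded families over all unital C*-algebras with
  elements in \<^typ>\<open>'a\<close> form a single type, a Banach algebra in the sense of type classes, into which each of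
  these algebras embeds.\<close>

typedef ('a, 'b) cstar_prod =
  "{f :: ('a, 'b) cstar_struct_scheme \<Rightarrow> 'a.
     (\<forall>A. unital_cstar_algebra A \<longrightarrow> f A \<in> carrier A) \<and> (\<forall>A. \<not> unital_cstar_algebra A \<longrightarrow> f A = undefined) \<and>
     (\<exists>K. \<forall>A. unital_cstar_algebra A \<longrightarrow> cnorm A (f A) \<le> K)}"
  morphisms comp Abs_cstar_prod
proof -
  have "cnorm A \<zero>\<^bsub>A\<^esub> \<le> 0" "\<zero>\<^bsub>A\<^esub> \<in> carrier A" if "unital_cstar_algebra A" for A :: "('a, 'b) cstar_struct_scheme"
  proof -
    interpret unital_cstar_algebra A by fact
    show "cnorm A \<zero>\<^bsub>A\<^esub> \<le> 0" "\<zero>\<^bsub>A\<^esub> \<in> carrier A" by auto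
  qed
  then show ?thesis
    by (intro exI[of _ "\<lambda>A. if unital_cstar_algebra A then \<zero>\<^bsub>A\<^esub> else undefined"]) auto
qed

definition family :: "(('a, 'b) cstar_struct_scheme \<Rightarrow> 'a) \<Rightarrow> ('a, 'b) cstar_prod" where
  "family f = Abs_cstar_prod (\<lambda>A. if unital_cstar_algebra A then f A else undefined)"

lemma comp_family:
  assumes "\<And>A. unital_cstar_algebra A \<Longrightarrow> f A \<in> carrier A" "\<And>A. unital_cstar_algebra A \<Longrightarrow> cnorm A (f A) \<le> K"
    and "unital_cstar_algebra A"
  shows "comp (family f) A = f A"
  unfolding family_def by (subst Abs_cstar_prod_inverse) (use assms in auto)

lemma comp_closed [simp]: "unital_cstar_algebra A \<Longrightarrow> comp x A \<in> carrier A"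
  using comp[of x] by auto

lemma comp_bounded: "\<exists>K. \<forall>A. unital_cstar_algebra A \<longrightarrow> cnorm A (comp x A) \<le> K"
  using comp[of x] by auto

lemma cstar_prod_eqI:
  assumes "\<And>A. unital_cstar_algebra A \<Longrightarrow> comp x A = comp y A"
  shows "x = y"
proof -
  have "comp x A = comp y A" for A
    using comp[of x] comp[of y] assms by (cases "unital_cstar_algebra A") auto
  then show ?thesis
    by (simp add: comp_inject[symmetric] fun_eq_iff)
qed

instantiation cstar_prod :: (type, type) real_normed_vector
begin

definition zero_cstar_prod :: "('a, 'b) cstar_prod" where
  "zero_cstar_prod = family (\<lambda>A. \<zero>\<^bsub>A\<^esub>)"
definition plus_cstar_prod :: "('a, 'b) cstar_prod \<Rightarrow> ('a, 'b) cstar_prod \<Rightarrow> ('a, 'b) cstar_prod" where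
  "plus_cstar_prod x y = family (\<lambda>A. comp x A \<oplus>\<^bsub>A\<^esub> comp y A)"
definition uminus_cstar_prod :: "('a, 'b) cstar_prod \<Rightarrow> ('a, 'b) cstar_prod" where
  "uminus_cstar_prod x = family (\<lambda>A. \<ominus>\<^bsub>A\<^esub> comp x A)"
definition minus_cstar_prod :: "('a, 'b) cstar_prod \<Rightarrow> ('a, 'b) cstar_prod \<Rightarrow> ('a, 'b) cstar_prod" where
  "minus_cstar_prod x y = x + - y"
definition scaleR_cstar_prod :: "real \<Rightarrow> ('a, 'b) cstar_prod \<Rightarrow> ('a, 'b) cstar_prod" where
  "scaleR_cstar_prod r x = family (\<lambda>A. of_real r \<odot>\<^bsub>A\<^esub> comp x A)"
text \<open>Structures that are not C*-algebras contribute 0, so that the supremum is over a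
  nonempty bounded set of nonnegative numbers.\<close>

definition norm_cstar_prod :: "('a, 'b) cstar_prod \<Rightarrow> real" where
  "norm_cstar_prod x = (SUP A. if unital_cstar_algebra A then cnorm A (comp x A) else 0)"
definition dist_cstar_prod :: "('a, 'b) cstar_prod \<Rightarrow> ('a, 'b) cstar_prod \<Rightarrow> real" where
  "dist_cstar_prod x y = norm (x - y)"
definition sgn_cstar_prod :: "('a, 'b) cstar_prod \<Rightarrow> ('a, 'b) cstar_prod" where
  "sgn_cstar_prod x = inverse (norm x) *\<^sub>R x"
definition uniformity_cstar_prod :: "(('a, 'b) cstar_prod \<times> ('a, 'b) cstar_prod) filter" where
  "uniformity_cstar_prod = (INF e\<in>{0 <..}. principal {(x, y). dist x y < e})"
definition open_cstar_prod :: "('a, 'b) cstar_prod set \<Rightarrow> bool" where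
  "open_cstar_prod U \<longleftrightarrow> (\<forall>x\<in>U. eventually (\<lambda>(x', y). x' = x \<longrightarrow> y \<in> U) uniformity)"

lemma comp_zero: "unital_cstar_algebra A \<Longrightarrow> comp (0 :: ('a, 'b) cstar_prod) A = \<zero>\<^bsub>A\<^esub>"
  unfolding zero_cstar_prod_def
proof (rule comp_family[where K = 0])
  fix A :: "('a, 'b) cstar_struct_scheme" assume "unital_cstar_algebra A"
  then interpret unital_cstar_algebra A .
  show "\<zero>\<^bsub>A\<^esub> \<in> carrier A" "cnorm A \<zero>\<^bsub>A\<^esub> \<le> 0" by simp_all
qed

lemma comp_add: "unital_cstar_algebra A \<Longrightarrow> comp (x + y :: ('a, 'b) cstar_prod) A = comp x A \<oplus>\<^bsub>A\<^esub> comp y A"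
proof -
  obtain K L where KL: "\<And>A. unital_cstar_algebra A \<Longrightarrow> cnorm A (comp x A) \<le> K"
    "\<And>A. unital_cstar_algebra A \<Longrightarrow> cnorm A (comp y A) \<le> L"
    using comp_bounded by metis
  assume "unital_cstar_algebra A"
  then show ?thesis
    unfolding plus_cstar_prod_def
  proof (rule comp_family[where K = "K + L", rotated 2])
    fix A :: "('a, 'b) cstar_struct_scheme" assume A: "unital_cstar_algebra A"
    then interpret unital_cstar_algebra A .
    show "comp x A \<oplus>\<^bsub>A\<^esub> comp y A \<in> carrier A"
      using A by simp
    show "cnorm A (comp x A \<oplus>\<^bsub>A\<^esub> comp y A) \<le> K + L"
      using cnorm_triangle[of "comp x A" "comp y A"] KL(1)[OF A] KL(2)[OF A] A by simp
  qed
qed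

lemma comp_uminus: "unital_cstar_algebra A \<Longrightarrow> comp (- x :: ('a, 'b) cstar_prod) A = \<ominus>\<^bsub>A\<^esub> comp x A"
proof -
  obtain K where K: "\<And>A. unital_cstar_algebra A \<Longrightarrow> cnorm A (comp x A) \<le> K"
    using comp_bounded by metis
  assume "unital_cstar_algebra A"
  then show ?thesis
    unfolding uminus_cstar_prod_def
  proof (rule comp_family[where K = K, rotated 2])
    fix A :: "('a, 'b) cstar_struct_scheme" assume A: "unital_cstar_algebra A"
    then interpret unital_cstar_algebra A .
    show "\<ominus>\<^bsub>A\<^esub> comp x A \<in> carrier A" "cnorm A (\<ominus>\<^bsub>A\<^esub> comp x A) \<le> K"
      using A K by (simp_all add: cnorm_minus)
  qed
qed

lemma comp_minus: "unital_cstar_algebra A \<Longrightarrow> comp (x - y :: ('a, 'b) cstar_prod) A = comp x A \<ominus>\<^bsub>A\<^esub> comp y A"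
  unfolding minus_cstar_prod_def a_minus_def by (simp add: comp_add comp_uminus)

lemma comp_family_smult:
  assumes "unital_cstar_algebra A"
  shows "comp (family (\<lambda>A. z \<odot>\<^bsub>A\<^esub> comp (x :: ('a, 'b) cstar_prod) A)) A = z \<odot>\<^bsub>A\<^esub> comp x A"
proof -
  obtain K where K: "\<And>A. unital_cstar_algebra A \<Longrightarrow> cnorm A (comp x A) \<le> K"
    using comp_bounded by metis
  show ?thesis
  proof (rule comp_family[where K = "cmod z * K", OF _ _ assms])
    fix A :: "('a, 'b) cstar_struct_scheme" assume A: "unital_cstar_algebra A"
    then interpret unital_cstar_algebra A .
    show "z \<odot>\<^bsub>A\<^esub> comp x A \<in> carrier A" "cnorm A (z \<odot>\<^bsub>A\<^esub> comp x A) \<le> cmod z * K"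
      using A K by (simp_all add: cnorm_smult mult_left_mono)
  qed
qed

lemma comp_scaleR:
  "unital_cstar_algebra A \<Longrightarrow> comp (r *\<^sub>R x :: ('a, 'b) cstar_prod) A = of_real r \<odot>\<^bsub>A\<^esub> comp x A"
  unfolding scaleR_cstar_prod_def by (rule comp_family_smult)

lemma cnorm_comp_le:
  assumes "unital_cstar_algebra A"
  shows "cnorm A (comp x A) \<le> norm (x :: ('a, 'b) cstar_prod)"
proof -
  obtain K where K: "\<And>A. unital_cstar_algebra A \<Longrightarrow> cnorm A (comp x A) \<le> K"
    using comp_bounded by metis
  have "(if unital_cstar_algebra A then cnorm A (comp x A) else 0) \<le> norm x"
    unfolding norm_cstar_prod_def
    by (rule cSUP_upper) (auto intro!: bdd_aboveI[of _ "max K 0"] simp: K le_max_iff_disj)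
  then show ?thesis using assms by simp
qed

lemma norm_cstar_prod_leI:
  assumes "\<And>A. unital_cstar_algebra A \<Longrightarrow> cnorm A (comp x A) \<le> K" "0 \<le> K"
  shows "norm (x :: ('a, 'b) cstar_prod) \<le> K"
  unfolding norm_cstar_prod_def by (rule cSUP_least) (use assms in auto)

lemma norm_cstar_prod_nonneg: "0 \<le> norm (x :: ('a, 'b) cstar_prod)"
proof -
  obtain K where K: "\<And>A. unital_cstar_algebra A \<Longrightarrow> cnorm A (comp x A) \<le> K"
    using comp_bounded by metis
  define A0 :: "('a, 'b) cstar_struct_scheme" where "A0 = undefined"
  have "0 \<le> (if unital_cstar_algebra A0 then cnorm A0 (comp x A0) else 0)"
    by (simp add: unital_cstar_algebra.cnorm_nonneg)
  also have "\<dots> \<le> norm x"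
    unfolding norm_cstar_prod_def
    by (rule cSUP_upper) (auto intro!: bdd_aboveI[of _ "max K 0"] simp: K le_max_iff_disj)
  finally show ?thesis .
qed

lemmas comp_linear_simps = comp_zero comp_add comp_uminus comp_minus comp_scaleR

instance
proof
  fix x y z :: "('a, 'b) cstar_prod" and r s :: real
  have "x + y + z = x + (y + z) \<and> x + y = y + x \<and> 0 + x = x \<and> - x + x = 0 \<and> x - y = x + - y \<and>
    r *\<^sub>R (x + y) = r *\<^sub>R x + r *\<^sub>R y \<and> (r + s) *\<^sub>R x = r *\<^sub>R x + s *\<^sub>R x \<and>
    r *\<^sub>R s *\<^sub>R x = (r * s) *\<^sub>R x \<and> 1 *\<^sub>R x = x"
  proof (intro conjI cstar_prod_eqI)
    fix A :: "('a, 'b) cstar_struct_scheme" assume A: "unital_cstar_algebra A"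
    interpret unital_cstar_algebra A by fact
    note c = comp_closed[OF A]
    show "comp (x + y + z) A = comp (x + (y + z)) A" using A by (simp add: comp_linear_simps a_assoc c)
    show "comp (x + y) A = comp (y + x) A" using A by (simp add: comp_linear_simps a_comm c)
    show "comp (0 + x) A = comp x A" using A by (simp add: comp_linear_simps c)
    show "comp (- x + x) A = comp 0 A" using A by (simp add: comp_linear_simps l_neg c)
    show "comp (x - y) A = comp (x + - y) A" using A by (simp add: comp_linear_simps a_minus_def)
    show "comp (r *\<^sub>R (x + y)) A = comp (r *\<^sub>R x + r *\<^sub>R y) A"
      using A by (simp add: comp_linear_simps smult_add_right c)
    show "comp ((r + s) *\<^sub>R x) A = comp (r *\<^sub>R x + s *\<^sub>R x) A"
      using A by (simp add: comp_linear_simps smult_add_left c)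
    show "comp (r *\<^sub>R s *\<^sub>R x) A = comp ((r * s) *\<^sub>R x) A"
      using A by (simp add: comp_linear_simps smult_smult c)
    show "comp (1 *\<^sub>R x) A = comp x A" using A by (simp add: comp_linear_simps c)
  qed
  then show "x + y + z = x + (y + z)" "x + y = y + x" "0 + x = x" "- x + x = 0" "x - y = x + - y"
    "r *\<^sub>R (x + y) = r *\<^sub>R x + r *\<^sub>R y" "(r + s) *\<^sub>R x = r *\<^sub>R x + s *\<^sub>R x"
    "r *\<^sub>R s *\<^sub>R x = (r * s) *\<^sub>R x" "1 *\<^sub>R x = x"
    by blast+
  show "norm x = 0 \<longleftrightarrow> x = 0"
  proof
    assume x: "norm x = 0"
    show "x = 0"
    proof (rule cstar_prod_eqI)
      fix A :: "('a, 'b) cstar_struct_scheme" assume A: "unital_cstar_algebra A"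
      interpret unital_cstar_algebra A by fact
      have "cnorm A (comp x A) = 0"
        using cnorm_comp_le[OF A, of x] cnorm_nonneg[OF comp_closed[OF A], of x] x by simp
      then show "comp x A = comp 0 A"
        using A by (simp add: cnorm_eq_0 comp_zero)
    qed
  next
    assume "x = 0"
    then have "norm x \<le> 0"
      by (intro norm_cstar_prod_leI) (simp_all add: comp_zero unital_cstar_algebra.cnorm_zero)
    then show "norm x = 0"
      using norm_cstar_prod_nonneg[of x] by simp
  qed
  show "norm (x + y) \<le> norm x + norm y"
  proof (rule norm_cstar_prod_leI)
    fix A :: "('a, 'b) cstar_struct_scheme" assume A: "unital_cstar_algebra A"
    interpret unital_cstar_algebra A by fact
    show "cnorm A (comp (x + y) A) \<le> norm x + norm y"
      using cnorm_triangle[of "comp x A" "comp y A"] cnorm_comp_le[OF A, of x] cnorm_comp_le[OF A, of y] A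
      by (simp add: comp_add)
  qed (simp add: norm_cstar_prod_nonneg)
  have le: "norm (r *\<^sub>R x) \<le> \<bar>r\<bar> * norm x" for r and x :: "('a, 'b) cstar_prod"
  proof (rule norm_cstar_prod_leI)
    fix A :: "('a, 'b) cstar_struct_scheme" assume A: "unital_cstar_algebra A"
    interpret unital_cstar_algebra A by fact
    show "cnorm A (comp (r *\<^sub>R x) A) \<le> \<bar>r\<bar> * norm x"
      using A cnorm_comp_le[OF A, of x] by (simp add: comp_scaleR cnorm_smult mult_left_mono)
  qed (simp add: norm_cstar_prod_nonneg)
  show "norm (r *\<^sub>R x) = \<bar>r\<bar> * norm x"
  proof (cases "r = 0")
    case True
    then show ?thesis
      using le[of r x] norm_cstar_prod_nonneg[of "r *\<^sub>R x"] by simp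
  next
    case False
    have "inverse r *\<^sub>R r *\<^sub>R x = x"
    proof (rule cstar_prod_eqI)
      fix A :: "('a, 'b) cstar_struct_scheme" assume A: "unital_cstar_algebra A"
      interpret unital_cstar_algebra A by fact
      show "comp (inverse r *\<^sub>R r *\<^sub>R x) A = comp x A"
        using A False by (simp add: comp_scaleR smult_smult flip: of_real_mult)
    qed
    then have "norm x \<le> \<bar>inverse r\<bar> * norm (r *\<^sub>R x)"
      using le[of "inverse r" "r *\<^sub>R x"] by simp
    then have "\<bar>r\<bar> * norm x \<le> norm (r *\<^sub>R x)"
      using False by (simp add: field_simps abs_inverse)
    with le[of r x] show ?thesis by simp
  qed
qed (fact dist_cstar_prod_def sgn_cstar_prod_def uniformity_cstar_prod_def open_cstar_prod_def)+

end

instantiation cstar_prod :: (type, type) complex_banach_algebra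
begin

definition one_cstar_prod :: "('a, 'b) cstar_prod" where
  "one_cstar_prod = family (\<lambda>A. \<one>\<^bsub>A\<^esub>)"
definition times_cstar_prod :: "('a, 'b) cstar_prod \<Rightarrow> ('a, 'b) cstar_prod \<Rightarrow> ('a, 'b) cstar_prod" where
  "times_cstar_prod x y = family (\<lambda>A. comp x A \<otimes>\<^bsub>A\<^esub> comp y A)"
definition scaleC_cstar_prod :: "complex \<Rightarrow> ('a, 'b) cstar_prod \<Rightarrow> ('a, 'b) cstar_prod" where
  "scaleC_cstar_prod z x = family (\<lambda>A. z \<odot>\<^bsub>A\<^esub> comp x A)"

lemma comp_one: "unital_cstar_algebra A \<Longrightarrow> comp (1 :: ('a, 'b) cstar_prod) A = \<one>\<^bsub>A\<^esub>"
  unfolding one_cstar_prod_def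
proof (rule comp_family[where K = 1])
  fix A :: "('a, 'b) cstar_struct_scheme" assume "unital_cstar_algebra A"
  then interpret unital_cstar_algebra A .
  show "\<one>\<^bsub>A\<^esub> \<in> carrier A" "cnorm A \<one>\<^bsub>A\<^esub> \<le> 1" by (simp_all add: cnorm_one_le)
qed

lemma comp_scaleC: "unital_cstar_algebra A \<Longrightarrow> comp (scaleC z x :: ('a, 'b) cstar_prod) A = z \<odot>\<^bsub>A\<^esub> comp x A"
  unfolding scaleC_cstar_prod_def by (rule comp_family_smult)

lemma comp_mult: "unital_cstar_algebra A \<Longrightarrow> comp (x * y :: ('a, 'b) cstar_prod) A = comp x A \<otimes>\<^bsub>A\<^esub> comp y A"
  unfolding times_cstar_prod_def
proof (rule comp_family[where K = "norm x * norm y"])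
  fix A :: "('a, 'b) cstar_struct_scheme" assume A: "unital_cstar_algebra A"
  then interpret unital_cstar_algebra A .
  show "comp x A \<otimes>\<^bsub>A\<^esub> comp y A \<in> carrier A" using A by simp
  have "cnorm A (comp x A \<otimes>\<^bsub>A\<^esub> comp y A) \<le> cnorm A (comp x A) * cnorm A (comp y A)"
    using A by (intro cnorm_mult) auto
  also have "\<dots> \<le> norm x * norm y"
    by (intro mult_mono cnorm_comp_le[OF A] cnorm_nonneg comp_closed[OF A] norm_ge_zero)
  finally show "cnorm A (comp x A \<otimes>\<^bsub>A\<^esub> comp y A) \<le> norm x * norm y" .
qed

lemmas comp_simps = comp_linear_simps comp_one comp_scaleC comp_mult

instance
proof
  fix x y z :: "('a, 'b) cstar_prod" and r s :: real and c d :: complex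
  have "scaleC c (x + y) = scaleC c x + scaleC c y \<and> scaleC (c + d) x = scaleC c x + scaleC d x \<and>
    scaleC c (scaleC d x) = scaleC (c * d) x \<and> scaleC (complex_of_real r) x = r *\<^sub>R x \<and>
    (x + y) * z = x * z + y * z \<and> x * (y + z) = x * y + x * z \<and>
    r *\<^sub>R x * y = r *\<^sub>R (x * y) \<and> x * r *\<^sub>R y = r *\<^sub>R (x * y) \<and>
    scaleC c x * y = scaleC c (x * y) \<and> x * scaleC c y = scaleC c (x * y) \<and>
    1 * x = x \<and> x * 1 = x \<and> x * y * z = x * (y * z)"
  proof (intro conjI cstar_prod_eqI)
    fix A :: "('a, 'b) cstar_struct_scheme" assume A: "unital_cstar_algebra A"
    interpret unital_cstar_algebra A by fact
    note [simp] = A comp_simps smult_add_left smult_add_right smult_smult l_distr r_distr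
      smult_mult_left smult_mult_right m_assoc
    show "comp (scaleC c (x + y)) A = comp (scaleC c x + scaleC c y) A" by simp
    show "comp (scaleC (c + d) x) A = comp (scaleC c x + scaleC d x) A" by simp
    show "comp (scaleC c (scaleC d x)) A = comp (scaleC (c * d) x) A" by simp
    show "comp (scaleC (complex_of_real r) x) A = comp (r *\<^sub>R x) A" by simp
    show "comp ((x + y) * z) A = comp (x * z + y * z) A" by simp
    show "comp (x * (y + z)) A = comp (x * y + x * z) A" by simp
    show "comp (r *\<^sub>R x * y) A = comp (r *\<^sub>R (x * y)) A" by simp
    show "comp (x * r *\<^sub>R y) A = comp (r *\<^sub>R (x * y)) A" by simp
    show "comp (scaleC c x * y) A = comp (scaleC c (x * y)) A" by simp
    show "comp (x * scaleC c y) A = comp (scaleC c (x * y)) A" by simp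
    show "comp (1 * x) A = comp x A" by simp
    show "comp (x * 1) A = comp x A" by simp
    show "comp (x * y * z) A = comp (x * (y * z)) A" by simp
  qed
  then show "scaleC c (x + y) = scaleC c x + scaleC c y" "scaleC (c + d) x = scaleC c x + scaleC d x"
    "scaleC c (scaleC d x) = scaleC (c * d) x" "scaleC (complex_of_real r) x = r *\<^sub>R x"
    "(x + y) * z = x * z + y * z" "x * (y + z) = x * y + x * z"
    "r *\<^sub>R x * y = r *\<^sub>R (x * y)" "x * r *\<^sub>R y = r *\<^sub>R (x * y)"
    "scaleC c x * y = scaleC c (x * y)" "x * scaleC c y = scaleC c (x * y)"
    "1 * x = x" "x * 1 = x" "x * y * z = x * (y * z)"
    by blast+
  show "norm (x * y) \<le> norm x * norm y"
  proof (rule norm_cstar_prod_leI)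
    fix A :: "('a, 'b) cstar_struct_scheme" assume A: "unital_cstar_algebra A"
    interpret unital_cstar_algebra A by fact
    have "cnorm A (comp (x * y) A) \<le> cnorm A (comp x A) * cnorm A (comp y A)"
      using A by (simp add: comp_mult cnorm_mult)
    also have "\<dots> \<le> norm x * norm y"
      by (intro mult_mono cnorm_comp_le[OF A] cnorm_nonneg comp_closed[OF A] norm_ge_zero)
    finally show "cnorm A (comp (x * y) A) \<le> norm x * norm y" .
  qed simp
  have le: "norm (scaleC c x) \<le> cmod c * norm x" for c and x :: "('a, 'b) cstar_prod"
  proof (rule norm_cstar_prod_leI)
    fix A :: "('a, 'b) cstar_struct_scheme" assume A: "unital_cstar_algebra A"
    interpret unital_cstar_algebra A by fact
    show "cnorm A (comp (scaleC c x) A) \<le> cmod c * norm x"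
      using A cnorm_comp_le[OF A, of x] by (simp add: comp_scaleC cnorm_smult mult_left_mono)
  qed simp
  show "norm (scaleC c x) = cmod c * norm x"
  proof (cases "c = 0")
    case True
    then show ?thesis
      using le[of c x] norm_ge_zero[of "scaleC c x"] by simp
  next
    case False
    have "scaleC (inverse c) (scaleC c x) = x"
    proof (rule cstar_prod_eqI)
      fix A :: "('a, 'b) cstar_struct_scheme" assume A: "unital_cstar_algebra A"
      interpret unital_cstar_algebra A by fact
      show "comp (scaleC (inverse c) (scaleC c x)) A = comp x A"
        using A False by (simp add: comp_scaleC smult_smult)
    qed
    then have "norm x \<le> cmod (inverse c) * norm (scaleC c x)"
      using le[of "inverse c" "scaleC c x"] by simp
    then have "cmod c * norm x \<le> norm (scaleC c x)"
      using False by (simp add: field_simps norm_divide)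
    with le[of c x] show ?thesis by simp
  qed
next
  fix X :: "nat \<Rightarrow> ('a, 'b) cstar_prod"
  assume X: "Cauchy X"
  \<comment> \<open>Limits are taken place by place; what remains is uniformity over all algebras,
    by which the family of limits is bounded and is the limit in norm.\<close>
  have "\<exists>l. limitin (Metric_space.mtopology (carrier A) (cstar_dist A)) (\<lambda>n. comp (X n) A) l sequentially"
    if A: "unital_cstar_algebra A" for A :: "('a, 'b) cstar_struct_scheme"
  proof -
    interpret unital_cstar_algebra A by fact
    have "metric.MCauchy (\<lambda>n. comp (X n) A)"
      unfolding metric.MCauchy_def
    proof (intro conjI allI impI)
      show "range (\<lambda>n. comp (X n) A) \<subseteq> carrier A" using A by auto
      fix e :: real assume "0 < e"
      then obtain M where M: "\<And>m n. m \<ge> M \<Longrightarrow> n \<ge> M \<Longrightarrow> norm (X m - X n) < e"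
        using CauchyD[OF X] by blast
      show "\<exists>N. \<forall>n n'. N \<le> n \<longrightarrow> N \<le> n' \<longrightarrow> cstar_dist A (comp (X n) A) (comp (X n') A) < e"
      proof (intro exI[of _ M] allI impI)
        fix n n' assume "M \<le> n" "M \<le> n'"
        then show "cstar_dist A (comp (X n) A) (comp (X n') A) < e"
          using le_less_trans[OF cnorm_comp_le[OF A] M[of n n']] A by (simp add: cstar_dist_eq comp_minus)
      qed
    qed
    then show ?thesis
      using complete unfolding metric.mcomplete_def by blast
  qed
  then obtain l where l: "\<And>A. unital_cstar_algebra A \<Longrightarrow>
      limitin (Metric_space.mtopology (carrier A) (cstar_dist A)) (\<lambda>n. comp (X n) A) (l A) sequentially"
    by metis
  have lA: "l A \<in> carrier A" if A: "unital_cstar_algebra A" for A :: "('a, 'b) cstar_struct_scheme"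
  proof -
    interpret unital_cstar_algebra A by fact
    show ?thesis using metric.limitin_mspace[OF l[OF A]] .
  qed
  have close: "cnorm A (comp (X n) A \<ominus>\<^bsub>A\<^esub> l A) \<le> e"
    if A: "unital_cstar_algebra A" and M: "\<And>m n. m \<ge> M \<Longrightarrow> n \<ge> M \<Longrightarrow> norm (X m - X n) < e" and n: "n \<ge> M" for A e M n
  proof (rule field_le_epsilon)
    interpret unital_cstar_algebra A by fact
    fix d :: real assume "0 < d"
    with l[OF A] obtain N where N: "\<And>m. m \<ge> N \<Longrightarrow> cstar_dist A (comp (X m) A) (l A) < d"
      unfolding metric.limit_metric_sequentially by blast
    define m where "m = max M N"
    have "cstar_dist A (comp (X n) A) (l A) \<le> cstar_dist A (comp (X n) A) (comp (X m) A) + cstar_dist A (comp (X m) A) (l A)"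
      using A by (intro metric.triangle lA) auto
    also have "cstar_dist A (comp (X n) A) (comp (X m) A) \<le> e"
      using cnorm_comp_le[OF A, of "X n - X m"] M[of n m] n A by (simp add: cstar_dist_eq comp_minus m_def)
    also have "cstar_dist A (comp (X m) A) (l A) \<le> d"
      using N[of m] by (simp add: m_def)
    finally show "cnorm A (comp (X n) A \<ominus>\<^bsub>A\<^esub> l A) \<le> e + d"
      using A lA by (simp add: cstar_dist_eq)
  qed
  \<comment> \<open>A single term of the sequence, within distance 1 of the limit at every place,
    bounds the family \<open>l\<close> uniformly, as membership in the type demands.\<close>
  obtain M1 where M1: "\<And>m n. m \<ge> M1 \<Longrightarrow> n \<ge> M1 \<Longrightarrow> norm (X m - X n) < 1"
    using CauchyD[OF X, of 1] by auto
  have cl: "comp (family l) A = l A" if A: "unital_cstar_algebra A" for A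
  proof (rule comp_family[OF lA _ A])
    fix A :: "('a, 'b) cstar_struct_scheme" assume A: "unital_cstar_algebra A"
    interpret unital_cstar_algebra A by fact
    have "l A = (l A \<ominus>\<^bsub>A\<^esub> comp (X M1) A) \<oplus>\<^bsub>A\<^esub> comp (X M1) A"
      using A lA[OF A] by (simp add: a_minus_def a_assoc l_neg)
    then have "cnorm A (l A) \<le> cnorm A (l A \<ominus>\<^bsub>A\<^esub> comp (X M1) A) + cnorm A (comp (X M1) A)"
      using cnorm_triangle[of "l A \<ominus>\<^bsub>A\<^esub> comp (X M1) A" "comp (X M1) A"] A lA[OF A] by simp
    also have "\<dots> \<le> 1 + norm (X M1)"
      using close[OF A M1, of M1] cnorm_comp_le[OF A, of "X M1"] A lA[OF A]
        cnorm_minus_commute[of "l A" "comp (X M1) A"] by (simp add: add_mono)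
    finally show "cnorm A (l A) \<le> 1 + norm (X M1)" .
  qed
  have "X \<longlonglongrightarrow> family l"
  proof (rule LIMSEQ_I)
    fix e :: real assume "0 < e"
    then obtain M where M: "\<And>m n. m \<ge> M \<Longrightarrow> n \<ge> M \<Longrightarrow> norm (X m - X n) < e / 2"
      using CauchyD[OF X, of "e / 2"] by auto
    have half: "norm (X n - family l) \<le> e / 2" if n: "n \<ge> M" for n
    proof (rule norm_cstar_prod_leI)
      show "cnorm A (comp (X n - family l) A) \<le> e / 2" if A: "unital_cstar_algebra A" for A
        using close[OF A M n] A by (simp add: comp_minus cl)
    qed (use \<open>0 < e\<close> in simp)
    then show "\<exists>no. \<forall>n\<ge>no. norm (X n - family l) < e"
      using \<open>0 < e\<close> by (intro exI[of _ M]) (auto intro!: le_less_trans[OF half])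
  qed
  then show "convergent X"
    unfolding convergent_def ..
qed

end

section \<open>A single algebra inside the product\<close>

text \<open>Additive, multiplicative and isometric on \<open>A\<close>, but the unit of
  \<open>A\<close> in general goes to an idempotent other than 1; hence the separate
  \<open>unit_at\<close> for units.\<close>

definition inject_at :: "('a, 'b) cstar_struct_scheme \<Rightarrow> 'a \<Rightarrow> ('a, 'b) cstar_prod" where
  "inject_at A x = family (\<lambda>B. if B = A then x else \<zero>\<^bsub>B\<^esub>)"

context unital_cstar_algebra
begin

lemma unital: "unital_cstar_algebra A"
  by (rule unital_cstar_algebra_axioms)

lemma comp_inject_at:
  assumes x: "x \<in> carrier A" and B: "unital_cstar_algebra B"
  shows "comp (inject_at A x) B = (if B = A then x else \<zero>\<^bsub>B\<^esub>)"
  unfolding inject_at_def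
proof (rule comp_family[where K = "cnorm A x", OF _ _ B])
  fix B :: "('a, 'b) cstar_struct_scheme" assume "unital_cstar_algebra B"
  then interpret B: unital_cstar_algebra B .
  show "(if B = A then x else \<zero>\<^bsub>B\<^esub>) \<in> carrier B" "cnorm B (if B = A then x else \<zero>\<^bsub>B\<^esub>) \<le> cnorm A x"
    using x by (auto simp: cnorm_nonneg)
qed

lemma comp_inject_at_self [simp]: "x \<in> carrier A \<Longrightarrow> comp (inject_at A x) A = x"
  by (simp add: comp_inject_at unital)

lemma inject_at_mult: "x \<in> carrier A \<Longrightarrow> y \<in> carrier A \<Longrightarrow> inject_at A (x \<otimes> y) = inject_at A x * inject_at A y"
proof (rule cstar_prod_eqI)
  fix B :: "('a, 'b) cstar_struct_scheme" assume B: "unital_cstar_algebra B" and xy: "x \<in> carrier A" "y \<in> carrier A"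
  interpret B: unital_cstar_algebra B by fact
  from B xy show "comp (inject_at A (x \<otimes> y)) B = comp (inject_at A x * inject_at A y) B"
    by (auto simp: comp_mult comp_inject_at)
qed

lemma inject_at_add: "x \<in> carrier A \<Longrightarrow> y \<in> carrier A \<Longrightarrow> inject_at A (x \<oplus> y) = inject_at A x + inject_at A y"
proof (rule cstar_prod_eqI)
  fix B :: "('a, 'b) cstar_struct_scheme" assume B: "unital_cstar_algebra B" and xy: "x \<in> carrier A" "y \<in> carrier A"
  interpret B: unital_cstar_algebra B by fact
  from B xy show "comp (inject_at A (x \<oplus> y)) B = comp (inject_at A x + inject_at A y) B"
    by (auto simp: comp_add comp_inject_at)
qed

lemma inject_at_uminus: "x \<in> carrier A \<Longrightarrow> inject_at A (\<ominus> x) = - inject_at A x"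
proof (rule cstar_prod_eqI)
  fix B :: "('a, 'b) cstar_struct_scheme" assume B: "unital_cstar_algebra B" and xy: "x \<in> carrier A"
  interpret B: unital_cstar_algebra B by fact
  from B xy show "comp (inject_at A (\<ominus> x)) B = comp (- inject_at A x) B"
    by (auto simp: comp_uminus comp_inject_at)
qed

lemma inject_at_minus: "x \<in> carrier A \<Longrightarrow> y \<in> carrier A \<Longrightarrow> inject_at A (x \<ominus> y) = inject_at A x - inject_at A y"
  by (simp add: a_minus_def inject_at_add inject_at_uminus)

lemma norm_inject_at:
  assumes x: "x \<in> carrier A"
  shows "norm (inject_at A x) = cnorm A x"
proof (rule antisym)
  show "norm (inject_at A x) \<le> cnorm A x"
    using x by (intro norm_cstar_prod_leI) (auto simp: comp_inject_at cnorm_nonneg unital_cstar_algebra.cnorm_zero)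
  show "cnorm A x \<le> norm (inject_at A x)"
    using cnorm_comp_le[OF unital, of "inject_at A x"] x by simp
qed

lemma comp_sum: "finite S \<Longrightarrow> comp (sum f S) A = (\<Oplus>i\<in>S. comp (f i) A)"
  by (induction S rule: finite_induct) (simp_all add: comp_zero comp_add unital)

lemma comp_power: "comp (x ^ n) A = comp x A [^] n"
proof (induction n)
  case (Suc n)
  have "comp (x ^ Suc n) A = comp (x ^ n * x) A"
    by (simp add: power_commutes)
  then show ?case using Suc by (simp add: comp_mult unital)
qed (simp add: comp_one unital)

text \<open>The unit \<open>u\<close> at the place \<open>A\<close>, and \<open>1\<close> elsewhere.\<close>

definition unit_at :: "'a \<Rightarrow> ('a, 'b) cstar_prod" where
  "unit_at u = 1 - inject_at A (\<one> \<ominus> u)"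

lemma unit_at_one: "unit_at \<one> = 1"
  by (simp add: unit_at_def inject_at_minus)

lemma unit_at_mult:
  assumes "u \<in> carrier A" "v \<in> carrier A"
  shows "unit_at (u \<otimes> v) = unit_at u * unit_at v"
proof -
  have "inject_at A \<one> * inject_at A x = inject_at A x" "inject_at A x * inject_at A \<one> = inject_at A x" if "x \<in> carrier A" for x
    using that by (simp_all flip: inject_at_mult)
  then show ?thesis
    using assms by (simp add: unit_at_def inject_at_minus inject_at_mult algebra_simps)
qed

lemma is_inverse_unit_at:
  assumes "u \<in> carrier A" "v \<in> carrier A" "u \<otimes> v = \<one>" "v \<otimes> u = \<one>"
  shows "is_inverse (unit_at u) (unit_at v)"
  using assms by (simp add: is_inverse_def unit_at_one flip: unit_at_mult)

end

section \<open>Tracial algebras and the determinant on their units\<close>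

locale tracial_cstar_algebra = unital_cstar_algebra A
  for A :: "('a, 'b) cstar_struct_scheme" (structure) +
  fixes \<tau> :: "'a \<Rightarrow> complex"
  assumes is_trace: "is_trace A \<tau>"
begin

lemma trace_add: "x \<in> carrier A \<Longrightarrow> y \<in> carrier A \<Longrightarrow> \<tau> (x \<oplus> y) = \<tau> x + \<tau> y"
  and trace_smult: "x \<in> carrier A \<Longrightarrow> \<tau> (z \<odot>\<^bsub>A\<^esub> x) = z * \<tau> x"
  and trace_commute: "x \<in> carrier A \<Longrightarrow> y \<in> carrier A \<Longrightarrow> \<tau> (x \<otimes> y) = \<tau> (y \<otimes> x)"
  using is_trace by (auto simp: is_trace_def)

lemma trace_zero [simp]: "\<tau> \<zero> = 0"
  using trace_smult[of \<zero> 0] by simp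

lemma trace_finsum: "finite S \<Longrightarrow> f \<in> S \<rightarrow> carrier A \<Longrightarrow> \<tau> (\<Oplus>i\<in>S. f i) = (\<Sum>i\<in>S. \<tau> (f i))"
  by (induction S rule: finite_induct) (simp_all add: trace_add Pi_def)

text \<open>Continuity at zero together with scaling. The bound makes the set under the supremum in
  \<open>functional_norm\<close> bounded.\<close>

lemma trace_bounded: "\<exists>K. \<forall>x\<in>carrier A. cmod (\<tau> x) \<le> K * cnorm A x"
proof -
  have "continuous_map metric.mtopology euclidean \<tau>"
    using is_trace by (simp add: is_trace_def cstar_topology_def)
  then have "continuous_map metric.mtopology (Metric_space.mtopology UNIV dist) \<tau>"
    by (simp add: mtopology_is_euclidean)
  then obtain d where d: "d > 0" "\<And>x. x \<in> carrier A \<Longrightarrow> cstar_dist A \<zero> x < d \<Longrightarrow> dist (\<tau> \<zero>) (\<tau> x) < 1"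
    unfolding metric.metric_continuous_map[OF Met_TC.Metric_space_axioms] by (metis zero_closed zero_less_one)
  have "cmod (\<tau> x) \<le> (2 / d) * cnorm A x" if x: "x \<in> carrier A" for x
  proof (cases "cnorm A x = 0")
    case True
    then show ?thesis using x by (simp add: cnorm_eq_0)
  next
    case False
    then have pos: "cnorm A x > 0" using cnorm_nonneg[OF x] by simp
    \<comment> \<open>Scales \<open>x\<close> to norm \<open>d / 2\<close>, inside the ball where
      \<open>\<tau>\<close> has modulus below 1; this is the origin of the constant
      \<open>2 / d\<close>.\<close>
    define c where "c = d / (2 * cnorm A x)"
    have c: "c > 0" using d pos by (simp add: c_def)
    have "cnorm A (of_real c \<odot>\<^bsub>A\<^esub> x) = d / 2"
      using x pos c by (simp add: cnorm_smult) (simp add: c_def)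
    then have "cstar_dist A \<zero> (of_real c \<odot>\<^bsub>A\<^esub> x) < d"
      using x d by (simp add: cstar_dist_eq a_minus_def cnorm_minus)
    from d(2)[OF _ this] have "cmod (of_real c * \<tau> x) < 1"
      using x by (simp add: trace_smult dist_norm)
    then have "c * cmod (\<tau> x) < 1"
      using c by (simp add: norm_mult)
    then show ?thesis
      using pos d by (simp add: c_def field_simps)
  qed
  then show ?thesis by blast
qed

lemma trace_le_functional_norm:
  assumes x: "x \<in> carrier A"
  shows "cmod (\<tau> x) \<le> functional_norm A \<tau> * cnorm A x"
proof (cases "cnorm A x = 0")
  case True
  then show ?thesis using x by (simp add: cnorm_eq_0)
next
  case False
  then have pos: "cnorm A x > 0" using cnorm_nonneg[OF x] by simp
  obtain K where K: "\<And>x. x \<in> carrier A \<Longrightarrow> cmod (\<tau> x) \<le> K * cnorm A x"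
    using trace_bounded by blast
  define y where "y = of_real (1 / cnorm A x) \<odot>\<^bsub>A\<^esub> x"
  have y: "y \<in> carrier A" "cnorm A y = 1"
    using x pos by (simp_all add: y_def cnorm_smult norm_divide)
  have "cmod (\<tau> y) \<le> functional_norm A \<tau>"
    unfolding functional_norm_def
  proof (rule cSUP_upper)
    have "cmod (\<tau> x) \<le> \<bar>K\<bar>" if "x \<in> carrier A" "cnorm A x \<le> 1" for x
    proof -
      have "cmod (\<tau> x) \<le> \<bar>K\<bar> * cnorm A x"
        by (rule order_trans[OF K mult_right_mono]) (use that cnorm_nonneg in auto)
      also have "\<dots> \<le> \<bar>K\<bar> * 1"
        by (rule mult_left_mono) (use that in auto)
      finally show ?thesis by simp
    qed
    then show "bdd_above ((\<lambda>x. cmod (\<tau> x)) ` {x \<in> carrier A. cnorm A x \<le> 1})"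
      by (intro bdd_aboveI[of _ "\<bar>K\<bar>"]) auto
  qed (use y in simp)
  moreover have "cmod (\<tau> y) = cmod (\<tau> x) / cnorm A x"
    using x pos by (simp add: y_def trace_smult norm_mult norm_divide)
  ultimately show ?thesis
    using pos by (simp add: field_simps)
qed

definition trace_prod :: "('a, 'b) cstar_prod \<Rightarrow> complex" where
  "trace_prod x = \<tau> (comp x A)"

lemma bounded_trace_prod: "bounded_trace trace_prod"
proof (rule bounded_trace.intro)
  obtain K where K: "\<And>x. x \<in> carrier A \<Longrightarrow> cmod (\<tau> x) \<le> K * cnorm A x"
    using trace_bounded by blast
  show "bounded_linear trace_prod"
  proof
    fix x y :: "('a, 'b) cstar_prod" and r :: real
    show "trace_prod (x + y) = trace_prod x + trace_prod y"
      by (simp add: trace_prod_def comp_add unital trace_add)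
    show "trace_prod (r *\<^sub>R x) = r *\<^sub>R trace_prod x"
      by (simp add: trace_prod_def comp_scaleR unital trace_smult scaleR_conv_of_real)
    have "norm (trace_prod x) \<le> norm x * \<bar>K\<bar>" for x
    proof -
      have "norm (trace_prod x) \<le> \<bar>K\<bar> * cnorm A (comp x A)"
        unfolding trace_prod_def
        by (rule order_trans[OF K mult_right_mono]) (auto simp: unital cnorm_nonneg)
      also have "\<dots> \<le> \<bar>K\<bar> * norm x"
        by (intro mult_left_mono cnorm_comp_le unital) simp
      finally show ?thesis by (simp add: mult.commute)
    qed
    then show "\<exists>K. \<forall>x. norm (trace_prod x) \<le> norm x * K"
      by blast
  qed
  show "trace_prod (scaleC z x) = z * trace_prod x" for z x
    by (simp add: trace_prod_def comp_scaleC unital trace_smult)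
  show "trace_prod (x * y) = trace_prod (y * x)" for x y
    by (simp add: trace_prod_def comp_mult unital trace_commute)
qed

sublocale prod: bounded_trace trace_prod
  by (rule bounded_trace_prod)

text \<open>The series converges in the product algebra, and passing to the component at
  \<open>A\<close> does not increase norms, so the partial sums converge in the metric of
  \<open>A\<close>. Uniqueness of limits then evaluates the description in
  \<open>cstar_log\<close>.\<close>

lemma cstar_log_series:
  assumes u: "u \<in> carrier A" and small: "cnorm A (u \<ominus> \<one>) < 1"
  defines "x \<equiv> inject_at A (\<one> \<ominus> u)"
  shows "cstar_log A u = comp (- suminf (\<lambda>k. (1 / of_nat (Suc k) :: real) *\<^sub>R x ^ Suc k)) A"
    and "summable (\<lambda>k. (1 / of_nat (Suc k) :: real) *\<^sub>R x ^ Suc k)"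
    and "norm x = cnorm A (u \<ominus> \<one>)"
proof -
  let ?f = "\<lambda>k. (1 / of_nat (Suc k) :: real) *\<^sub>R x ^ Suc k"
  show nx: "norm x = cnorm A (u \<ominus> \<one>)"
    unfolding x_def using u by (simp add: norm_inject_at cnorm_minus_commute)
  have fk: "norm (?f k) \<le> norm x ^ Suc k" for k
  proof -
    have "norm (?f k) \<le> 1 * norm (x ^ Suc k)"
      unfolding norm_scaleR by (rule mult_right_mono) (auto simp: divide_le_eq)
    then show ?thesis using norm_power_Suc_le[of x k] by simp
  qed
  have geo: "summable (\<lambda>k. norm x ^ Suc k)"
    by (subst summable_Suc_iff) (simp add: summable_geometric nx small cnorm_nonneg u)
  show sum: "summable ?f"
    by (rule summable_comparison_test'[OF geo fk])
  define S where "S N = - (\<Sum>k=1..N. (1 / of_nat k :: real) *\<^sub>R x ^ k)" for N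
  have compS: "comp (S N) A = \<ominus> (\<Oplus>k\<in>{1..N}. (1 / of_nat k) \<odot>\<^bsub>A\<^esub> ((\<one> \<ominus> u) [^] (k::nat)))" for N
    unfolding S_def using u by (simp add: comp_uminus unital comp_sum comp_scaleR comp_power x_def)
  have "(\<lambda>N. - (\<Sum>k<N. ?f k)) \<longlonglongrightarrow> - suminf ?f"
    by (intro tendsto_minus summable_LIMSEQ sum)
  moreover have "S = (\<lambda>N. - (\<Sum>k<N. ?f k))"
    unfolding S_def by (intro ext) (simp add: sum.atLeast1_atMost_eq)
  ultimately have S: "S \<longlonglongrightarrow> - suminf ?f" by simp
  have lim: "limitin (cstar_topology A) (\<lambda>N. comp (S N) A) (comp (- suminf ?f) A) sequentially"
    unfolding cstar_topology_def metric.limit_metric_sequentially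
  proof (intro conjI allI impI)
    fix e :: real assume "0 < e"
    then obtain M where M: "\<And>N. N \<ge> M \<Longrightarrow> norm (S N - - suminf ?f) < e"
      using LIMSEQ_D[OF S] by blast
    show "\<exists>M. \<forall>N\<ge>M. comp (S N) A \<in> carrier A \<and> cstar_dist A (comp (S N) A) (comp (- suminf ?f) A) < e"
    proof (intro exI[of _ M] allI impI conjI)
      fix N assume "N \<ge> M"
      then show "cstar_dist A (comp (S N) A) (comp (- suminf ?f) A) < e"
        using le_less_trans[OF cnorm_comp_le[OF unital] M[of N]]
        by (simp add: cstar_dist_eq comp_minus[symmetric] unital)
    qed (simp add: unital)
  qed (simp add: unital)
  show "cstar_log A u = comp (- suminf ?f) A"
    unfolding cstar_log_def
  proof (rule the_equality)
    show lim': "limitin (cstar_topology A)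
      (\<lambda>N. \<ominus> (\<Oplus>k\<in>{1..N}. (1 / of_nat k) \<odot>\<^bsub>A\<^esub> ((\<one> \<ominus> u) [^] (k::nat)))) (comp (- suminf ?f) A) sequentially"
      using lim unfolding compS .
    show "l = comp (- suminf ?f) A" if "limitin (cstar_topology A)
      (\<lambda>N. \<ominus> (\<Oplus>k\<in>{1..N}. (1 / of_nat k) \<odot>\<^bsub>A\<^esub> ((\<one> \<ominus> u) [^] (k::nat)))) l sequentially" for l
      using metric.limitin_metric_unique[OF that[unfolded cstar_topology_def] lim'[unfolded cstar_topology_def]] by simp
  qed
qed

lemma trace_log:
  assumes u: "u \<in> carrier A" and small: "cnorm A (u \<ominus> \<one>) < 1"
  shows "\<tau> (cstar_log A u) = - prod.log_series (inject_at A (\<one> \<ominus> u))"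
proof -
  define x where "x = inject_at A (\<one> \<ominus> u)"
  note l = cstar_log_series[OF u small, folded x_def]
  have "\<tau> (cstar_log A u) = - trace_prod (suminf (\<lambda>k. (1 / of_nat (Suc k) :: real) *\<^sub>R x ^ Suc k))"
    unfolding l(1) by (simp only: trace_prod_def[symmetric] prod.linear_simps)
  also have "trace_prod (suminf (\<lambda>k. (1 / of_nat (Suc k) :: real) *\<^sub>R x ^ Suc k))
      = suminf (\<lambda>k. trace_prod ((1 / of_nat (Suc k) :: real) *\<^sub>R x ^ Suc k))"
    by (rule bounded_linear.suminf[OF prod.blin l(2)])
  also have "\<dots> = prod.log_series x"
    unfolding prod.log_series_def
    by (intro suminf_cong)
       (simp add: linear_scale[OF bounded_linear.linear[OF prod.blin]] scaleR_conv_of_real del: power_Suc of_nat_Suc)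
  finally show ?thesis by (simp add: x_def)
qed

text \<open>Comparison with a geometric series of ratio 1/2, whose sum is the factor 2. A bound
  linear in the distance to the unit and in the norm of the trace is what later makes the defect
  sequences null.\<close>

lemma trace_log_bound:
  assumes u: "u \<in> carrier A" and small: "cnorm A (u \<ominus> \<one>) \<le> 1 / 2"
  shows "cmod (\<tau> (cstar_log A u)) \<le> functional_norm A \<tau> * (2 * cnorm A (u \<ominus> \<one>))"
proof -
  define x where "x = inject_at A (\<one> \<ominus> u)"
  have small': "cnorm A (u \<ominus> \<one>) < 1" using small by simp
  note l = cstar_log_series[OF u small', folded x_def]
  let ?f = "\<lambda>k. (1 / of_nat (Suc k) :: real) *\<^sub>R x ^ Suc k"
  have fk: "norm (?f k) \<le> norm x * (1 / 2) ^ k" for k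
  proof -
    have "norm (?f k) \<le> 1 * norm (x ^ Suc k)"
      unfolding norm_scaleR by (rule mult_right_mono) (auto simp: divide_le_eq)
    also have "\<dots> \<le> norm x * norm x ^ k"
      using norm_power_Suc_le[of x k] by simp
    also have "\<dots> \<le> norm x * (1 / 2) ^ k"
      using small unfolding l(3)[symmetric] by (intro mult_left_mono power_mono) auto
    finally show ?thesis .
  qed
  have geo: "(\<lambda>k. norm x * (1 / 2) ^ k) sums (norm x * (1 / (1 - 1 / 2)))"
    by (intro sums_mult geometric_sums) simp
  have "cnorm A (cstar_log A u) \<le> norm (- suminf ?f)"
    unfolding l(1) by (rule cnorm_comp_le[OF unital])
  also have "\<dots> \<le> suminf (\<lambda>k. norm x * (1 / 2) ^ k)"
    unfolding norm_minus_cancel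
    by (rule norm_suminf_le[OF fk sums_summable[OF geo]])
  also have "\<dots> = 2 * cnorm A (u \<ominus> \<one>)"
    using sums_unique[OF geo] by (simp add: l(3))
  finally have le: "cnorm A (cstar_log A u) \<le> 2 * cnorm A (u \<ominus> \<one>)" .
  have cl: "cstar_log A u \<in> carrier A"
    unfolding l(1) by (simp add: unital)
  have "0 \<le> functional_norm A \<tau>"
  proof -
    have "0 \<le> cmod (\<tau> \<zero>)" by simp
    also have "\<dots> \<le> functional_norm A \<tau>"
      unfolding functional_norm_def
    proof (rule cSUP_upper)
      obtain K where K: "\<And>x. x \<in> carrier A \<Longrightarrow> cmod (\<tau> x) \<le> K * cnorm A x"
        using trace_bounded by blast
      have "cmod (\<tau> x) \<le> \<bar>K\<bar>" if "x \<in> carrier A" "cnorm A x \<le> 1" for x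
        using order_trans[OF K[OF that(1)] mult_mono[of K "\<bar>K\<bar>" "cnorm A x" 1]] that cnorm_nonneg[OF that(1)] by simp
      then show "bdd_above ((\<lambda>x. cmod (\<tau> x)) ` {x \<in> carrier A. cnorm A x \<le> 1})"
        by (intro bdd_aboveI[of _ "\<bar>K\<bar>"]) auto
    qed simp
    finally show ?thesis .
  qed
  then show ?thesis
    using order_trans[OF trace_le_functional_norm[OF cl] mult_left_mono[OF le]] by simp
qed

text \<open>The constant 1/4 comes from \<open>1/4 + 1/4 + 1/16 < 1\<close>, the hypothesis of
  \<open>log_series_add\<close> for the images \<open>x\<close>, \<open>y\<close> of
  \<open>\<one> \<ominus> u\<close>, \<open>\<one> \<ominus> v\<close>; the image of
  \<open>\<one> \<ominus> u \<otimes> v\<close> is \<open>x + y - x * y\<close>.\<close>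

lemma trace_log_mult:
  assumes u: "u \<in> carrier A" and v: "v \<in> carrier A"
    and "cnorm A (u \<ominus> \<one>) \<le> 1 / 4" "cnorm A (v \<ominus> \<one>) \<le> 1 / 4"
  shows "\<tau> (cstar_log A (u \<otimes> v)) = \<tau> (cstar_log A u) + \<tau> (cstar_log A v)"
    and "cnorm A (u \<otimes> v \<ominus> \<one>) < 1"
proof -
  define x where "x = inject_at A (\<one> \<ominus> u)"
  define y where "y = inject_at A (\<one> \<ominus> v)"
  have x: "norm x \<le> 1 / 4" "norm y \<le> 1 / 4"
    unfolding x_def y_def using assms by (simp_all add: norm_inject_at cnorm_minus_commute)
  have "norm x * norm y \<le> 1 / 4 * (1 / 4)"
    using x by (intro mult_mono) auto
  then have small: "norm x + norm y + norm x * norm y < 1"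
    using x by simp
  have eq: "inject_at A (\<one> \<ominus> u \<otimes> v) = x + y - x * y"
  proof -
    have "1 - inject_at A (\<one> \<ominus> u \<otimes> v) = (1 - x) * (1 - y)"
      using unit_at_mult[OF u v] by (simp add: unit_at_def x_def y_def)
    then show ?thesis by (simp add: algebra_simps)
  qed
  have "cnorm A (u \<otimes> v \<ominus> \<one>) = norm (x + y - x * y)"
    using u v by (simp add: eq[symmetric] norm_inject_at cnorm_minus_commute)
  also have "\<dots> \<le> norm x + norm y + norm x * norm y"
    by (intro order_trans[OF norm_triangle_ineq4] add_mono norm_triangle_ineq norm_mult_ineq)
  finally show uv: "cnorm A (u \<otimes> v \<ominus> \<one>) < 1" using small by simp
  have "cnorm A (u \<ominus> \<one>) < 1" "cnorm A (v \<ominus> \<one>) < 1" using assms by simp_all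
  then show "\<tau> (cstar_log A (u \<otimes> v)) = \<tau> (cstar_log A u) + \<tau> (cstar_log A v)"
    using u v uv by (simp add: trace_log eq x_def[symmetric] y_def[symmetric] prod.log_series_add[OF small])
qed

text \<open>Powers of a conjugate are conjugates of powers, so the series agree term by term under
  the trace. Smallness of the conjugate is a separate hypothesis because \<open>g\<close> may be any
  unit.\<close>

lemma trace_log_conjugate:
  assumes u: "u \<in> carrier A" and g: "g \<in> carrier A" "h \<in> carrier A" "g \<otimes> h = \<one>" "h \<otimes> g = \<one>"
    and small: "cnorm A (u \<ominus> \<one>) < 1" "cnorm A (g \<otimes> u \<otimes> h \<ominus> \<one>) < 1"
  shows "\<tau> (cstar_log A (g \<otimes> u \<otimes> h)) = \<tau> (cstar_log A u)"
proof -
  define x where "x = inject_at A (\<one> \<ominus> u)"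
  have inv: "is_inverse (unit_at g) (unit_at h)"
    using g by (intro is_inverse_unit_at)
  have eq: "inject_at A (\<one> \<ominus> g \<otimes> u \<otimes> h) = unit_at g * x * unit_at h"
  proof -
    have "1 - inject_at A (\<one> \<ominus> g \<otimes> u \<otimes> h) = unit_at g * (1 - x) * unit_at h"
      using unit_at_mult[of "g \<otimes> u" h] unit_at_mult[of g u] u g by (simp add: unit_at_def x_def)
    then show ?thesis
      by (simp add: algebra_simps is_inverse_cancel[OF inv])
  qed
  have "(unit_at g * x * unit_at h) ^ Suc k = unit_at g * x ^ Suc k * unit_at h" for k
    by (induction k) (simp_all add: mult.assoc is_inverse_cancel[OF inv])
  then have "prod.log_series (unit_at g * x * unit_at h) = prod.log_series x"
    unfolding prod.log_series_def by (simp only: prod.conjugate[OF inv])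
  then show ?thesis
    using u g small by (simp add: trace_log eq x_def[symmetric])
qed

text \<open>The three places of the matrix algebra are what the proof that commutators lie in the kernel of the
  determinant needs.\<close>

definition det_log :: "'a \<Rightarrow> complex \<Rightarrow> bool" where
  "det_log u w \<longleftrightarrow> bounded_trace.connects prod.sq_trace (diag_at (1::3) (unit_at u)) w"

sublocale sq: bounded_trace "prod.sq_trace :: (('a, 'b) cstar_prod, 3) sq_matrix \<Rightarrow> complex"
  by (rule prod.bounded_trace_sq_trace)

lemma det_log_one: "det_log \<one> 0"
  by (simp add: det_log_def unit_at_one sq.connects_one)

lemma det_log_mult:
  "u \<in> carrier A \<Longrightarrow> v \<in> carrier A \<Longrightarrow> det_log u w \<Longrightarrow> det_log v z \<Longrightarrow> det_log (u \<otimes> v) (w + z)"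
  unfolding det_log_def by (simp add: unit_at_mult diag_at_mult[symmetric] sq.connects_mult)

lemma det_log_inverse:
  assumes "u \<in> carrier A" "v \<in> carrier A" "u \<otimes> v = \<one>" "v \<otimes> u = \<one>" "det_log u w"
  shows "det_log v (- w)"
  using assms unfolding det_log_def by (blast intro: sq.connects_inverse is_inverse_diag_at is_inverse_unit_at)

lemma det_log_conjugate:
  assumes "u \<in> carrier A" "v \<in> carrier A" "u \<otimes> v = \<one>" "v \<otimes> u = \<one>" "x \<in> carrier A" "det_log x w"
  shows "det_log (u \<otimes> x \<otimes> v) w"
  using sq.connects_conjugate[OF assms(6)[unfolded det_log_def] is_inverse_diag_at[where p = "1::3", OF is_inverse_unit_at[OF assms(1-4)]]] assms
  unfolding det_log_def by (simp add: unit_at_mult diag_at_mult)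

lemma det_log_commutator:
  assumes "u \<in> carrier A" "u' \<in> carrier A" "u \<otimes> u' = \<one>" "u' \<otimes> u = \<one>"
    and "v \<in> carrier A" "v' \<in> carrier A" "v \<otimes> v' = \<one>" "v' \<otimes> v = \<one>"
  shows "det_log (u \<otimes> v \<otimes> u' \<otimes> v') 0"
  using prod.connects_commutator[OF is_inverse_unit_at[OF assms(1-4)] is_inverse_unit_at[OF assms(5-8)], of "1::3" 2 3] assms
  unfolding det_log_def by (simp add: unit_at_mult)

text \<open>The straight segment from 1 to the stabilised unit; at a diagonal matrix unit the
  logarithm series over matrices is the series over the product algebra.\<close>

lemma det_log_log:
  assumes u: "u \<in> carrier A" and small: "cnorm A (u \<ominus> \<one>) < 1"
  shows "det_log u (\<tau> (cstar_log A u))"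
proof -
  define x where "x = inject_at A (\<one> \<ominus> u)"
  have "norm (unitm (1::3) 1 x) < 1"
    using cstar_log_series(3)[OF u small] small by (simp add: norm_unitm x_def)
  from sq.connects_one_minus[OF this] show ?thesis
    by (simp add: det_log_def diag_at_def unit_at_def x_def[symmetric] prod.log_series_unitm
        trace_log[OF u small] unitm_simps)
qed

end

section \<open>Traces on $K_0$\<close>

context tracial_cstar_algebra
begin

lemma mats_closed: "x \<in> mats A m n \<Longrightarrow> i < m \<Longrightarrow> j < n \<Longrightarrow> x (i, j) \<in> carrier A"
  by (auto simp: mats_def PiE_def Pi_def)

lemma mats_ext:
  "x \<in> mats A m n \<Longrightarrow> y \<in> mats A m n \<Longrightarrow> (\<And>i j. i < m \<Longrightarrow> j < n \<Longrightarrow> x (i, j) = y (i, j)) \<Longrightarrow> x = y"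
  unfolding mats_def by (rule PiE_ext) auto

lemma mats_mult_closed:
  "x \<in> mats A m k \<Longrightarrow> y \<in> mats A k n \<Longrightarrow> mats_mult A m k n x y \<in> mats A m n"
  by (auto simp: mats_def mats_mult_def PiE_def Pi_def intro!: finsum_closed m_closed)

lemma mats_mult_apply:
  "i < m \<Longrightarrow> j < n \<Longrightarrow> mats_mult A m k n x y (i, j) = (\<Oplus>l\<in>{..<k}. x (i, l) \<otimes> y (l, j))"
  by (simp add: mats_mult_def)

definition one_mat :: "nat \<Rightarrow> nat \<times> nat \<Rightarrow> 'a" where
  "one_mat k = (\<lambda>(i, j)\<in>{..<k} \<times> {..<k}. if i = j then \<one> else \<zero>)"

lemma one_mat_closed: "one_mat k \<in> mats A k k"
  by (auto simp: one_mat_def mats_def)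

lemma mats_mult_one_right:
  assumes "x \<in> mats A m k"
  shows "mats_mult A m k k x (one_mat k) = x"
proof (rule mats_ext[OF mats_mult_closed[OF assms one_mat_closed] assms])
  fix i j assume ij: "i < m" "j < k"
  have "mats_mult A m k k x (one_mat k) (i, j) = (\<Oplus>l\<in>{..<k}. if j = l then x (i, l) else \<zero>)"
    unfolding mats_mult_apply[OF ij]
    by (rule finsum_cong') (use ij mats_closed[OF assms] in \<open>auto simp: one_mat_def\<close>)
  also have "\<dots> = x (i, j)"
    by (rule finsum_singleton) (use ij mats_closed[OF assms] in auto)
  finally show "mats_mult A m k k x (one_mat k) (i, j) = x (i, j)" .
qed

lemma mats_mult_one_left:
  assumes "x \<in> mats A k n"
  shows "mats_mult A k k n (one_mat k) x = x"
proof (rule mats_ext[OF mats_mult_closed[OF one_mat_closed assms] assms])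
  fix i j assume ij: "i < k" "j < n"
  have "mats_mult A k k n (one_mat k) x (i, j) = (\<Oplus>l\<in>{..<k}. if i = l then x (l, j) else \<zero>)"
    unfolding mats_mult_apply[OF ij]
    by (rule finsum_cong') (use ij mats_closed[OF assms] in \<open>auto simp: one_mat_def\<close>)
  also have "\<dots> = x (i, j)"
    by (rule finsum_singleton) (use ij mats_closed[OF assms] in auto)
  finally show "mats_mult A k k n (one_mat k) x (i, j) = x (i, j)" .
qed

lemma one_mat_idempotent: "(k, one_mat k) \<in> idempotents A"
  by (simp add: idempotents_def one_mat_closed mats_mult_one_right)

lemma mat_trace_one_mat: "mat_trace \<tau> (k, one_mat k) = of_nat k * \<tau> \<one>"
  by (simp add: mat_trace_def one_mat_def)

lemma empty_idempotent: "(0, \<lambda>_. undefined) \<in> idempotents A"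
  by (auto simp: idempotents_def mats_def mats_mult_def)

lemma mat_dsum_closed:
  assumes "snd p \<in> mats A (fst p) (fst p)" "snd q \<in> mats A (fst q) (fst q)"
  shows "snd (mat_dsum A p q) \<in> mats A (fst (mat_dsum A p q)) (fst (mat_dsum A p q))"
proof -
  obtain k e l f where [simp]: "p = (k, e)" "q = (l, f)"
    by (metis surj_pair)
  show ?thesis
    using assms by (auto simp: mat_dsum_def mats_def PiE_def Pi_def less_diff_conv2 add.commute)
qed

lemma mat_trace_dsum: "mat_trace \<tau> (mat_dsum A p q) = mat_trace \<tau> p + mat_trace \<tau> q"
proof -
  obtain k e l f where [simp]: "p = (k, e)" "q = (l, f)"
    by (metis surj_pair)
  define g where "g i = (if i < k then \<tau> (e (i, i)) else \<tau> (f (i - k, i - k)))" for i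
  have "mat_trace \<tau> (mat_dsum A p q) = (\<Sum>i<k + l. g i)"
    by (auto simp: mat_trace_def mat_dsum_def g_def intro!: sum.cong)
  also have "\<dots> = (\<Sum>i<k. g i) + (\<Sum>i=k..<k + l. g i)"
    by (subst sum.union_disjoint[symmetric]) (auto intro!: sum.cong)
  also have "(\<Sum>i=k..<k + l. g i) = (\<Sum>i<l. g (i + k))"
    using sum.shift_bounds_nat_ivl[of g 0 k l] by (simp add: lessThan_atLeast0 add.commute)
  finally show ?thesis by (simp add: mat_trace_def g_def)
qed

text \<open>\<open>x\<close> and \<open>y\<close> are rectangular; exchanging the two summations and
  applying the trace property entrywise turns the trace of one product into that of the
  other.\<close>

lemma mat_trace_equiv:
  assumes "idem_equiv A p q"
  shows "mat_trace \<tau> p = mat_trace \<tau> q"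
proof -
  obtain k e l f where [simp]: "p = (k, e)" "q = (l, f)"
    by (metis surj_pair)
  obtain x y where x: "x \<in> mats A k l" and y: "y \<in> mats A l k"
    and e: "mats_mult A k l k x y = e" and f: "mats_mult A l k l y x = f"
    using assms by (auto simp: idem_equiv_def)
  have "mat_trace \<tau> p = (\<Sum>i<k. \<Sum>j<l. \<tau> (x (i, j) \<otimes> y (j, i)))"
    unfolding mat_trace_def \<open>p = _\<close> e[symmetric]
    by (auto simp: mats_mult_apply mats_closed[OF x] mats_closed[OF y] intro!: sum.cong trace_finsum)
  also have "\<dots> = (\<Sum>j<l. \<Sum>i<k. \<tau> (y (j, i) \<otimes> x (i, j)))"
    by (subst sum.swap) (auto simp: trace_commute mats_closed[OF x] mats_closed[OF y] intro!: sum.cong)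
  also have "\<dots> = mat_trace \<tau> q"
    unfolding mat_trace_def \<open>q = _\<close> f[symmetric]
    by (auto simp: mats_mult_apply mats_closed[OF x] mats_closed[OF y] trace_finsum intro!: sum.cong)
  finally show ?thesis .
qed

text \<open>\<open>K0_trace\<close> picks the only element of an image, so the image must be a
  singleton: nonempty by reflexivity of the relation at \<open>(p, q)\<close>, and constant because
  the trace is additive on direct sums and the trace of \<open>r\<close> cancels.\<close>

lemma K0_trace_class:
  assumes p: "p \<in> idempotents A" and q: "q \<in> idempotents A"
  shows "K0_rel A `` {(p, q)} \<in> carrier (K0 A)"
    and "K0_trace \<tau> (K0_rel A `` {(p, q)}) = mat_trace \<tau> p - mat_trace \<tau> q"
proof -
  have idem: "snd r \<in> mats A (fst r) (fst r)" if "r \<in> idempotents A" for r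
    using that by (auto simp: idempotents_def)
  \<comment> \<open>Reflexivity with the empty matrix as stabilising summand; \<open>D\<close> is
    equivalent to itself through \<open>D\<close> and the identity matrix.\<close>
  define D where "D = mat_dsum A (mat_dsum A p q) (0, \<lambda>_. undefined)"
  have D: "snd D \<in> mats A (fst D) (fst D)"
    unfolding D_def by (intro mat_dsum_closed idem p q empty_idempotent)
  have "idem_equiv A D D"
    unfolding idem_equiv_def
    using D one_mat_closed[of "fst D"] mats_mult_one_right[OF D] mats_mult_one_left[OF D]
    by (cases D) auto
  then have refl: "((p, q), (p, q)) \<in> K0_rel A"
    unfolding K0_rel_def D_def using p q empty_idempotent by auto
  have inv: "mat_trace \<tau> p' - mat_trace \<tau> q' = mat_trace \<tau> p - mat_trace \<tau> q"
    if "((p, q), (p', q')) \<in> K0_rel A" for p' q'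
  proof -
    have "\<exists>r\<in>idempotents A. idem_equiv A (mat_dsum A (mat_dsum A p q') r) (mat_dsum A (mat_dsum A p' q) r)"
      using that unfolding K0_rel_def by simp
    then obtain r where "idem_equiv A (mat_dsum A (mat_dsum A p q') r) (mat_dsum A (mat_dsum A p' q) r)"
      by blast
    from mat_trace_equiv[OF this, unfolded mat_trace_dsum]
    have "mat_trace \<tau> p + mat_trace \<tau> q' = mat_trace \<tau> p' + mat_trace \<tau> q"
      by simp
    then have "mat_trace \<tau> p' = mat_trace \<tau> p + mat_trace \<tau> q' - mat_trace \<tau> q"
      by (simp add: eq_diff_eq)
    then show ?thesis by (simp add: algebra_simps)
  qed
  have "(\<lambda>(p, q). mat_trace \<tau> p - mat_trace \<tau> q) ` (K0_rel A `` {(p, q)}) = {mat_trace \<tau> p - mat_trace \<tau> q}"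
  proof
    show "(\<lambda>(p, q). mat_trace \<tau> p - mat_trace \<tau> q) ` (K0_rel A `` {(p, q)}) \<subseteq> {mat_trace \<tau> p - mat_trace \<tau> q}"
    proof
      fix z assume "z \<in> (\<lambda>(p, q). mat_trace \<tau> p - mat_trace \<tau> q) ` (K0_rel A `` {(p, q)})"
      then obtain pq where "pq \<in> K0_rel A `` {(p, q)}" "z = (\<lambda>(p, q). mat_trace \<tau> p - mat_trace \<tau> q) pq"
        by blast
      moreover obtain p' q' where "pq = (p', q')"
        by (metis surj_pair)
      ultimately have "((p, q), (p', q')) \<in> K0_rel A" "z = mat_trace \<tau> p' - mat_trace \<tau> q'"
        by simp_all
      then show "z \<in> {mat_trace \<tau> p - mat_trace \<tau> q}"
        by (simp only: inv singletonI)
    qed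
    show "{mat_trace \<tau> p - mat_trace \<tau> q} \<subseteq> (\<lambda>(p, q). mat_trace \<tau> p - mat_trace \<tau> q) ` (K0_rel A `` {(p, q)})"
      using image_eqI[of "mat_trace \<tau> p - mat_trace \<tau> q" "\<lambda>(p, q). mat_trace \<tau> p - mat_trace \<tau> q" "(p, q)", OF _ ImageI[OF refl singletonI]]
      by simp
  qed
  then show "K0_trace \<tau> (K0_rel A `` {(p, q)}) = mat_trace \<tau> p - mat_trace \<tau> q"
    by (simp add: K0_trace_def)
  show "K0_rel A `` {(p, q)} \<in> carrier (K0 A)"
    unfolding K0_def using p q by (simp add: quotientI)
qed

lemma K0_trace_image:
  assumes "p \<in> idempotents A" "q \<in> idempotents A"
  shows "mat_trace \<tau> p - mat_trace \<tau> q \<in> K0_trace \<tau> ` carrier (K0 A)"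
  using K0_trace_class[OF assms] by (metis imageI)

lemma zero_in_K0_trace: "0 \<in> K0_trace \<tau> ` carrier (K0 A)"
  using K0_trace_image[OF empty_idempotent empty_idempotent] by simp

lemma sum_div_mod:
  fixes g :: "nat \<Rightarrow> nat \<Rightarrow> 'c::comm_monoid_add"
  assumes "c > 0"
  shows "(\<Sum>l<N * c. g (l div c) (l mod c)) = (\<Sum>i<N. \<Sum>j<c. g i j)"
proof -
  have lt: "i * c + j < N * c" if "i < N" "j < c" for i j
  proof -
    have "i * c + j < Suc i * c" using that by simp
    also have "\<dots> \<le> N * c" using that by (intro mult_le_mono1) simp
    finally show ?thesis .
  qed
  have "(\<Sum>l<N * c. g (l div c) (l mod c)) = (\<Sum>(i, j)\<in>{..<N} \<times> {..<c}. g i j)"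
    by (rule sum.reindex_bij_witness[where j = "\<lambda>l. (l div c, l mod c)" and i = "\<lambda>(i, j). i * c + j"])
       (use assms in \<open>auto simp: less_mult_imp_div_less lt\<close>)
  then show ?thesis by (simp add: sum.cartesian_product)
qed

text \<open>A matrix of matrices is flattened to size \<open>N * c\<close>: index \<open>l\<close>
  stands for block \<open>l div c\<close> and place \<open>l mod c\<close>, the latter carried to
  the index type by \<open>\<phi>\<close>. The component at \<open>A\<close> respects sums and
  products, so idempotency survives the passage from the product algebra to
  \<open>A\<close>.\<close>

lemma matrix_idempotent_trace:
  fixes e :: "nat \<Rightarrow> nat \<Rightarrow> (('a, 'b) cstar_prod, 'n::finite) sq_matrix"
  assumes "\<forall>i<N. \<forall>j<N. (\<Sum>l<N. e i l * e l j) = e i j"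
  shows "\<exists>p\<in>idempotents A. mat_trace \<tau> p = (\<Sum>i<N. prod.sq_trace (e i i))"
proof -
  define c where "c = CARD('n)"
  have c: "c > 0" by (simp add: c_def)
  obtain \<phi> where \<phi>: "bij_betw \<phi> {..<c} (UNIV :: 'n set)"
    using ex_bij_betw_nat_finite[of "UNIV :: 'n set"] by (auto simp: c_def lessThan_atLeast0)
  define h where "h i j = entry (e (i div c) (j div c)) (\<phi> (i mod c)) (\<phi> (j mod c))" for i j
  define E where "E = (\<lambda>(i, j)\<in>{..<N * c} \<times> {..<N * c}. comp (h i j) A)"
  have E: "E \<in> mats A (N * c) (N * c)"
    by (auto simp: E_def mats_def unital)
  have hh: "(\<Sum>l<N * c. h i l * h l j) = h i j" if "i < N * c" "j < N * c" for i j
  proof -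
    have "(\<Sum>l<N * c. h i l * h l j) = (\<Sum>a<N. \<Sum>b<c. entry (e (i div c) a) (\<phi> (i mod c)) (\<phi> b) * entry (e a (j div c)) (\<phi> b) (\<phi> (j mod c)))"
      unfolding h_def
      by (rule sum_div_mod[OF c, of "\<lambda>a b. entry (e (i div c) a) (\<phi> (i mod c)) (\<phi> b) * entry (e a (j div c)) (\<phi> b) (\<phi> (j mod c))"])
    also have "\<dots> = (\<Sum>a<N. entry (e (i div c) a * e a (j div c)) (\<phi> (i mod c)) (\<phi> (j mod c)))"
      unfolding entry_simps by (intro sum.cong refl sum.reindex_bij_betw[OF \<phi>])
    also have "\<dots> = entry (\<Sum>a<N. e (i div c) a * e a (j div c)) (\<phi> (i mod c)) (\<phi> (j mod c))"
      by (induction N) (simp_all add: entry_linear_simps)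
    also have "(\<Sum>a<N. e (i div c) a * e a (j div c)) = e (i div c) (j div c)"
      using assms that by (simp add: less_mult_imp_div_less)
    finally show ?thesis by (simp add: h_def)
  qed
  have "mats_mult A (N * c) (N * c) (N * c) E E = E"
  proof (rule mats_ext[OF mats_mult_closed[OF E E] E])
    fix i j assume ij: "i < N * c" "j < N * c"
    have "mats_mult A (N * c) (N * c) (N * c) E E (i, j) = (\<Oplus>l\<in>{..<N * c}. comp (h i l * h l j) A)"
      unfolding mats_mult_apply[OF ij]
      by (rule finsum_cong') (use ij in \<open>auto simp: E_def comp_mult unital\<close>)
    also have "\<dots> = comp (\<Sum>l<N * c. h i l * h l j) A"
      by (simp add: comp_sum)
    also have "\<dots> = E (i, j)"
      using ij by (simp add: hh E_def)
    finally show "mats_mult A (N * c) (N * c) (N * c) E E (i, j) = E (i, j)" .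
  qed
  with E have "(N * c, E) \<in> idempotents A"
    by (simp add: idempotents_def)
  moreover have "mat_trace \<tau> (N * c, E) = (\<Sum>i<N. prod.sq_trace (e i i))"
  proof -
    have "mat_trace \<tau> (N * c, E) = (\<Sum>i<N * c. trace_prod (h i i))"
      by (auto simp: mat_trace_def E_def trace_prod_def intro!: sum.cong)
    also have "\<dots> = (\<Sum>a<N. \<Sum>b<c. trace_prod (entry (e a a) (\<phi> b) (\<phi> b)))"
      unfolding h_def by (rule sum_div_mod[OF c, of "\<lambda>a b. trace_prod (entry (e a a) (\<phi> b) (\<phi> b))"])
    also have "\<dots> = (\<Sum>i<N. prod.sq_trace (e i i))"
      unfolding prod.sq_trace_def by (intro sum.cong refl sum.reindex_bij_betw[OF \<phi>])
    finally show ?thesis .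
  qed
  ultimately show ?thesis by blast
qed

text \<open>The identity of the 3 by 3 matrices has trace \<open>3 * \<tau> \<one>\<close>, so the
  subtracted multiple is the trace of the identity matrix of size \<open>d * 3\<close>.\<close>

lemma det_log_one_imp:
  assumes "det_log \<one> w"
  shows "1 / (2 * of_real pi * \<i>) * w \<in> K0_trace \<tau> ` carrier (K0 A)"
proof -
  have "sq.connects 1 w"
    using assms by (simp add: det_log_def unit_at_one)
  from sq.connects_one_imp_idempotent[OF this] obtain N d :: nat and e :: "nat \<Rightarrow> nat \<Rightarrow> (('a, 'b) cstar_prod, 3) sq_matrix"
    where e: "\<forall>i<N. \<forall>j<N. (\<Sum>l<N. e i l * e l j) = e i j"
    and w: "w = 2 * pi * \<i> * ((\<Sum>i<N. prod.sq_trace (e i i)) - of_nat d * prod.sq_trace (1 :: (('a, 'b) cstar_prod, 3) sq_matrix))"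
    by blast
  obtain p where p: "p \<in> idempotents A" "mat_trace \<tau> p = (\<Sum>i<N. prod.sq_trace (e i i))"
    using matrix_idempotent_trace[OF e] by blast
  have "prod.sq_trace (1 :: (('a, 'b) cstar_prod, 3) sq_matrix) = 3 * \<tau> \<one>"
    by (simp add: prod.sq_trace_def entry_simps trace_prod_def comp_one unital)
  then have "1 / (2 * of_real pi * \<i>) * w = mat_trace \<tau> p - mat_trace \<tau> (d * 3, one_mat (d * 3))"
    unfolding w p(2) mat_trace_one_mat by simp
  then show ?thesis
    using K0_trace_image[OF p(1) one_mat_idempotent] by metis
qed

end

section \<open>Evaluation of cochains on cycles\<close>

text \<open>The generalisation of \<^const>\<open>cochain_eval\<close> that also evaluates 1-cochains.\<close>

definition frag_eval :: "('c, 'm) monoid_scheme \<Rightarrow> ('s \<Rightarrow> 'c) \<Rightarrow> ('s \<Rightarrow>\<^sub>0 int) \<Rightarrow> 'c" where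
  "frag_eval G f c = (\<Otimes>\<^bsub>G\<^esub>s\<in>Poly_Mapping.keys c. f s [^]\<^bsub>G\<^esub> Poly_Mapping.lookup c s)"

lemma cochain_eval_eq: "cochain_eval = frag_eval"
  by (intro ext) (simp add: cochain_eval_def frag_eval_def)

context comm_group
begin

lemma frag_eval_superset:
  assumes "f \<in> S \<rightarrow> carrier G" "Poly_Mapping.keys c \<subseteq> T" "T \<subseteq> S" "finite T"
  shows "frag_eval G f c = (\<Otimes>s\<in>T. f s [^] Poly_Mapping.lookup c s)"
  unfolding frag_eval_def
  using assms by (intro finprod_mono_neutral_cong_left) (auto simp: in_keys_iff)

lemma frag_eval_closed:
  assumes "f \<in> S \<rightarrow> carrier G" "Poly_Mapping.keys c \<subseteq> S"
  shows "frag_eval G f c \<in> carrier G"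
  unfolding frag_eval_def using assms by (intro finprod_closed) auto

lemma frag_eval_zero [simp]: "frag_eval G f 0 = \<one>"
  by (simp add: frag_eval_def)

lemma frag_eval_of [simp]: "f s \<in> carrier G \<Longrightarrow> frag_eval G f (frag_of s) = f s"
  by (simp add: frag_eval_def)

lemma frag_eval_cong:
  assumes "f \<in> S \<rightarrow> carrier G" "Poly_Mapping.keys c \<subseteq> S" "\<And>s. s \<in> Poly_Mapping.keys c \<Longrightarrow> f s = g s"
  shows "frag_eval G f c = frag_eval G g c"
  unfolding frag_eval_def
proof (rule finprod_cong'[OF refl])
  show "(\<lambda>s. g s [^] Poly_Mapping.lookup c s) \<in> Poly_Mapping.keys c \<rightarrow> carrier G"
    using assms by (metis (no_types, lifting) Pi_I PiE int_pow_closed subsetD)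
qed (use assms in simp)

lemma frag_eval_add:
  assumes f: "f \<in> S \<rightarrow> carrier G" and c: "Poly_Mapping.keys c \<subseteq> S" "Poly_Mapping.keys d \<subseteq> S"
  shows "frag_eval G f (c + d) = frag_eval G f c \<otimes> frag_eval G f d"
proof -
  define T where "T = Poly_Mapping.keys c \<union> Poly_Mapping.keys d"
  have T: "T \<subseteq> S" "finite T" using c by (auto simp: T_def)
  have fT: "f s \<in> carrier G" if "s \<in> T" for s using f T that by auto
  have "frag_eval G f (c + d) = (\<Otimes>s\<in>T. f s [^] Poly_Mapping.lookup (c + d) s)"
    using keys_add[of c d] by (intro frag_eval_superset[OF f _ T]) (auto simp: T_def)
  also have "\<dots> = (\<Otimes>s\<in>T. f s [^] Poly_Mapping.lookup c s \<otimes> f s [^] Poly_Mapping.lookup d s)"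
    by (intro finprod_cong') (auto simp: lookup_add int_pow_mult fT)
  also have "\<dots> = (\<Otimes>s\<in>T. f s [^] Poly_Mapping.lookup c s) \<otimes> (\<Otimes>s\<in>T. f s [^] Poly_Mapping.lookup d s)"
    by (intro finprod_multf) (auto simp: fT)
  also have "\<dots> = frag_eval G f c \<otimes> frag_eval G f d"
    by (simp add: frag_eval_superset[OF f _ T] T_def)
  finally show ?thesis .
qed

lemma frag_eval_diff:
  assumes f: "f \<in> S \<rightarrow> carrier G" and c: "Poly_Mapping.keys c \<subseteq> S" "Poly_Mapping.keys d \<subseteq> S"
  shows "frag_eval G f (c - d) = frag_eval G f c \<otimes> inv frag_eval G f d"
proof -
  have k: "Poly_Mapping.keys (c - d) \<subseteq> S"
    using keys_diff[of c d] c by blast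
  have "frag_eval G f (c - d) \<otimes> frag_eval G f d = frag_eval G f c"
    using frag_eval_add[OF f k c(2)] by simp
  then show ?thesis
    using frag_eval_closed[OF f] k c by (metis inv_solve_right)
qed

lemma frag_eval_mult:
  assumes f: "f \<in> S \<rightarrow> carrier G" and g: "g \<in> S \<rightarrow> carrier G" and c: "Poly_Mapping.keys c \<subseteq> S"
  shows "frag_eval G (\<lambda>s. f s \<otimes> g s) c = frag_eval G f c \<otimes> frag_eval G g c"
proof -
  have fg: "f s \<in> carrier G" "g s \<in> carrier G" if "s \<in> Poly_Mapping.keys c" for s
    using f g c that by auto
  have "frag_eval G (\<lambda>s. f s \<otimes> g s) c
      = (\<Otimes>s\<in>Poly_Mapping.keys c. f s [^] Poly_Mapping.lookup c s \<otimes> g s [^] Poly_Mapping.lookup c s)"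
    unfolding frag_eval_def by (intro finprod_cong') (auto simp: fg int_pow_distrib)
  also have "\<dots> = frag_eval G f c \<otimes> frag_eval G g c"
    unfolding frag_eval_def by (intro finprod_multf) (auto simp: fg)
  finally show ?thesis .
qed

lemma frag_eval_frag_extend:
  assumes f: "f \<in> T \<rightarrow> carrier G" and h: "\<And>s. s \<in> S \<Longrightarrow> Poly_Mapping.keys (h s) \<subseteq> T"
    and c: "Poly_Mapping.keys c \<subseteq> S"
  shows "frag_eval G f (frag_extend h c) = frag_eval G (\<lambda>s. frag_eval G f (h s)) c"
  using c
proof (induction c rule: free_Abelian_group_induct[of _ S, consumes 1])
  have g: "(\<lambda>s. frag_eval G f (h s)) \<in> S \<rightarrow> carrier G"
    using frag_eval_closed[OF f h] by auto
  {
    case 1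
    show ?case by simp
  next
    case (2 x y)
    have k: "Poly_Mapping.keys (frag_extend h x) \<subseteq> T" "Poly_Mapping.keys (frag_extend h y) \<subseteq> T"
      using keys_frag_extend[of h x] keys_frag_extend[of h y] h 2 by blast+
    show ?case
      using 2 by (simp add: frag_extend_diff frag_eval_diff[OF f k] frag_eval_diff[OF g])
  next
    case (3 a)
    then show ?case using frag_eval_closed[OF f h] by simp
  }
qed

text \<open>Naturality serves three times: from the complex numbers into the quotient by
  \<open>det_kernel\<close>, from null sequences to their \<open>n\<close>-th terms, and from null
  sequences to \<open>Q_C\<close>.\<close>

lemma frag_eval_hom:
  assumes H: "comm_group H" and \<pi>: "\<pi> \<in> hom G H" and f: "f \<in> S \<rightarrow> carrier G"
    and c: "Poly_Mapping.keys c \<subseteq> S"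
  shows "\<pi> (frag_eval G f c) = frag_eval H (\<lambda>s. \<pi> (f s)) c"
  using c
proof (induction c rule: free_Abelian_group_induct[of _ S, consumes 1])
  interpret H: comm_group H by fact
  interpret \<pi>: group_hom G H \<pi>
    using \<pi> by unfold_locales
  have g: "(\<lambda>s. \<pi> (f s)) \<in> S \<rightarrow> carrier H"
    using f hom_in_carrier[OF \<pi>] by (auto simp: Pi_iff)
  {
    case 1
    show ?case by simp
  next
    case (2 x y)
    then show ?case
      using frag_eval_closed[OF f] by (simp add: frag_eval_diff[OF f] H.frag_eval_diff[OF g])
  next
    case (3 a)
    then have "f a \<in> carrier G" "\<pi> (f a) \<in> carrier H" using f g by auto
    then show ?case by simp
  }
qed

text \<open>A coboundary vanishes on cycles, because evaluating it is evaluating a 1-cochain on the boundary.\<close>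

lemma coboundary_eval_cycle:
  assumes \<Gamma>: "group \<Gamma>" and \<phi>: "\<phi> \<in> carrier \<Gamma> \<rightarrow> carrier G" and c: "c \<in> cycles2 \<Gamma>"
  shows "frag_eval G (\<lambda>(a, b). \<phi> a \<otimes> inv \<phi> (a \<otimes>\<^bsub>\<Gamma>\<^esub> b) \<otimes> \<phi> b) c = \<one>"
proof -
  interpret \<Gamma>: group \<Gamma> by fact
  let ?h = "\<lambda>(a, b). frag_of a - frag_of (a \<otimes>\<^bsub>\<Gamma>\<^esub> b) + frag_of b"
  have keys: "Poly_Mapping.keys c \<subseteq> carrier \<Gamma> \<times> carrier \<Gamma>" and bd: "frag_extend ?h c = 0"
    using c by (auto simp: cycles2_def bar2_def bar_boundary2_def)
  have k1: "Poly_Mapping.keys (frag_of a - frag_of (a \<otimes>\<^bsub>\<Gamma>\<^esub> b)) \<subseteq> carrier \<Gamma>"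
    if "a \<in> carrier \<Gamma>" "b \<in> carrier \<Gamma>" for a b
    using keys_diff[of "frag_of a" "frag_of (a \<otimes>\<^bsub>\<Gamma>\<^esub> b)"] that by auto
  have k: "Poly_Mapping.keys (?h s) \<subseteq> carrier \<Gamma>" if "s \<in> carrier \<Gamma> \<times> carrier \<Gamma>" for s
    using k1 that keys_add by (fastforce split: prod.splits)
  have "\<one> = frag_eval G \<phi> (frag_extend ?h c)"
    by (simp add: bd)
  also have "\<dots> = frag_eval G (\<lambda>s. frag_eval G \<phi> (?h s)) c"
    by (rule frag_eval_frag_extend[OF \<phi> k keys])
  also have "\<dots> = frag_eval G (\<lambda>(a, b). \<phi> a \<otimes> inv \<phi> (a \<otimes>\<^bsub>\<Gamma>\<^esub> b) \<otimes> \<phi> b) c"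
  proof (rule frag_eval_cong[OF _ keys])
    show "(\<lambda>s. frag_eval G \<phi> (?h s)) \<in> carrier \<Gamma> \<times> carrier \<Gamma> \<rightarrow> carrier G"
      using frag_eval_closed[OF \<phi> k] by auto
    fix s assume "s \<in> Poly_Mapping.keys c"
    then obtain a b where s: "s = (a, b)" "a \<in> carrier \<Gamma>" "b \<in> carrier \<Gamma>"
      using keys by auto
    then have "\<phi> a \<in> carrier G" "\<phi> b \<in> carrier G" "\<phi> (a \<otimes>\<^bsub>\<Gamma>\<^esub> b) \<in> carrier G"
      using \<phi> by auto
    then show "frag_eval G \<phi> (?h s) = (case s of (a, b) \<Rightarrow> \<phi> a \<otimes> inv \<phi> (a \<otimes>\<^bsub>\<Gamma>\<^esub> b) \<otimes> \<phi> b)"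
      using s k1[OF s(2,3)] by (simp add: frag_eval_add[OF \<phi>] frag_eval_diff[OF \<phi>])
  qed
  finally show ?thesis ..
qed

end

section \<open>Independence of the Kronecker pairing from representatives\<close>

lemma boundary2_boundary3:
  assumes \<Gamma>: "group \<Gamma>" and d: "Poly_Mapping.keys d \<subseteq> carrier \<Gamma> \<times> carrier \<Gamma> \<times> carrier \<Gamma>"
  shows "bar_boundary2 \<Gamma> (bar_boundary3 \<Gamma> d) = 0" "Poly_Mapping.keys (bar_boundary3 \<Gamma> d) \<subseteq> carrier \<Gamma> \<times> carrier \<Gamma>"
proof -
  interpret group \<Gamma> by fact
  have "bar_boundary2 \<Gamma> (bar_boundary3 \<Gamma> d) = 0 \<and> Poly_Mapping.keys (bar_boundary3 \<Gamma> d) \<subseteq> carrier \<Gamma> \<times> carrier \<Gamma>"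
    using d
  proof (induction d rule: free_Abelian_group_induct[of _ "carrier \<Gamma> \<times> carrier \<Gamma> \<times> carrier \<Gamma>", consumes 1])
    case 1
    show ?case by (simp add: bar_boundary2_def bar_boundary3_def)
  next
    case (2 x y)
    then show ?case
      using keys_diff[of "bar_boundary3 \<Gamma> x" "bar_boundary3 \<Gamma> y"]
      by (auto simp: bar_boundary2_def bar_boundary3_def frag_extend_diff)
  next
    case (3 s)
    then obtain a b c where s: "s = (a, b, c)" "a \<in> carrier \<Gamma>" "b \<in> carrier \<Gamma>" "c \<in> carrier \<Gamma>"
      by auto
    let ?k = "\<lambda>x y z w. frag_of x - frag_of y + frag_of z - frag_of w :: 'a \<times> 'a \<Rightarrow>\<^sub>0 int"
    have "Poly_Mapping.keys (?k x y z w) \<subseteq> {x, y, z, w}" for x y z w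
      using keys_diff[of "frag_of x - frag_of y + frag_of z" "frag_of w"] keys_add[of "frag_of x - frag_of y" "frag_of z"]
        keys_diff[of "frag_of x" "frag_of y"] by auto
    from this[of "(b, c)" "(a \<otimes>\<^bsub>\<Gamma>\<^esub> b, c)" "(a, b \<otimes>\<^bsub>\<Gamma>\<^esub> c)" "(a, b)"] s show ?case
      by (auto simp: bar_boundary2_def bar_boundary3_def frag_extend_diff frag_extend_add m_assoc)
  qed
  then show "bar_boundary2 \<Gamma> (bar_boundary3 \<Gamma> d) = 0" "Poly_Mapping.keys (bar_boundary3 \<Gamma> d) \<subseteq> carrier \<Gamma> \<times> carrier \<Gamma>"
    by auto
qed

context comm_group
begin

lemma cocycle_eval_boundary:
  assumes \<Gamma>: "group \<Gamma>" and \<omega>: "\<omega> \<in> carrier \<Gamma> \<times> carrier \<Gamma> \<rightarrow> carrier G"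
    and cocycle: "\<And>a b c. a \<in> carrier \<Gamma> \<Longrightarrow> b \<in> carrier \<Gamma> \<Longrightarrow> c \<in> carrier \<Gamma> \<Longrightarrow>
       \<omega> (b, c) \<otimes> \<omega> (a, b \<otimes>\<^bsub>\<Gamma>\<^esub> c) = \<omega> (a \<otimes>\<^bsub>\<Gamma>\<^esub> b, c) \<otimes> \<omega> (a, b)"
    and d: "Poly_Mapping.keys d \<subseteq> carrier \<Gamma> \<times> carrier \<Gamma> \<times> carrier \<Gamma>"
  shows "frag_eval G \<omega> (bar_boundary3 \<Gamma> d) = \<one>"
  using d
proof (induction d rule: free_Abelian_group_induct[of _ "carrier \<Gamma> \<times> carrier \<Gamma> \<times> carrier \<Gamma>", consumes 1])
  case 1
  show ?case by (simp add: bar_boundary3_def)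
next
  case (2 x y)
  have "bar_boundary3 \<Gamma> (x - y) = bar_boundary3 \<Gamma> x - bar_boundary3 \<Gamma> y"
    by (simp add: bar_boundary3_def frag_extend_diff)
  then show ?case
    using 2 by (simp add: frag_eval_diff[OF \<omega> boundary2_boundary3(2)[OF \<Gamma> 2(1)] boundary2_boundary3(2)[OF \<Gamma> 2(2)]])
next
  case (3 s)
  interpret \<Gamma>: group \<Gamma> by fact
  obtain a b c where s: "s = (a, b, c)" "a \<in> carrier \<Gamma>" "b \<in> carrier \<Gamma>" "c \<in> carrier \<Gamma>"
    using 3 by auto
  have w: "\<omega> (x, y) \<in> carrier G" if "x \<in> carrier \<Gamma>" "y \<in> carrier \<Gamma>" for x y
    using \<omega> that by auto
  have k1: "Poly_Mapping.keys (frag_of (b, c) - frag_of (a \<otimes>\<^bsub>\<Gamma>\<^esub> b, c)) \<subseteq> carrier \<Gamma> \<times> carrier \<Gamma>"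
    using keys_diff[of "frag_of (b, c)" "frag_of (a \<otimes>\<^bsub>\<Gamma>\<^esub> b, c)"] s by auto
  have k2: "Poly_Mapping.keys (frag_of (b, c) - frag_of (a \<otimes>\<^bsub>\<Gamma>\<^esub> b, c) + frag_of (a, b \<otimes>\<^bsub>\<Gamma>\<^esub> c)) \<subseteq> carrier \<Gamma> \<times> carrier \<Gamma>"
    using k1 keys_add[of "frag_of (b, c) - frag_of (a \<otimes>\<^bsub>\<Gamma>\<^esub> b, c)" "frag_of (a, b \<otimes>\<^bsub>\<Gamma>\<^esub> c)"] s by auto
  have "frag_eval G \<omega> (bar_boundary3 \<Gamma> (frag_of s))
      = \<omega> (b, c) \<otimes> inv \<omega> (a \<otimes>\<^bsub>\<Gamma>\<^esub> b, c) \<otimes> \<omega> (a, b \<otimes>\<^bsub>\<Gamma>\<^esub> c) \<otimes> inv \<omega> (a, b)"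
    using s k1 k2 by (simp add: bar_boundary3_def frag_eval_diff[OF \<omega>] frag_eval_add[OF \<omega>] w)
  also have "\<dots> = (\<omega> (b, c) \<otimes> \<omega> (a, b \<otimes>\<^bsub>\<Gamma>\<^esub> c)) \<otimes> inv (\<omega> (a \<otimes>\<^bsub>\<Gamma>\<^esub> b, c) \<otimes> \<omega> (a, b))"
    using s w by (simp add: inv_mult m_ac)
  also have "\<dots> = \<one>"
    using s w by (simp add: cocycle)
  finally show ?case .
qed

text \<open>The pairing is the only element of an image, so evaluation must be constant on both
  classes: a coboundary vanishes on cycles and a cocycle vanishes on boundaries.\<close>

theorem kronecker_eq:
  assumes \<Gamma>: "group \<Gamma>" and \<omega>: "\<omega> \<in> cocycles2 \<Gamma> G" and c: "c \<in> cycles2 \<Gamma>"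
  shows "kronecker G (cohomology2_class \<Gamma> G \<omega>) (homology2_class \<Gamma> c) = frag_eval G \<omega> c"
proof -
  interpret \<Gamma>: group \<Gamma> by fact
  let ?S = "carrier \<Gamma> \<times> carrier \<Gamma>"
  have \<omega>S: "\<omega> \<in> ?S \<rightarrow> carrier G"
    and cocycle: "\<And>a b c. a \<in> carrier \<Gamma> \<Longrightarrow> b \<in> carrier \<Gamma> \<Longrightarrow> c \<in> carrier \<Gamma> \<Longrightarrow>
       \<omega> (b, c) \<otimes> \<omega> (a, b \<otimes>\<^bsub>\<Gamma>\<^esub> c) = \<omega> (a \<otimes>\<^bsub>\<Gamma>\<^esub> b, c) \<otimes> \<omega> (a, b)"
    using \<omega> by (auto simp: cocycles2_def cochains2_def product_group_def)
  have cS: "Poly_Mapping.keys c \<subseteq> ?S" and c0: "bar_boundary2 \<Gamma> c = 0"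
    using c by (auto simp: cycles2_def bar2_def)
  have main: "frag_eval G \<omega>' c' = frag_eval G \<omega> c"
    if w: "\<omega>' \<in> cohomology2_class \<Gamma> G \<omega>" and k: "c' \<in> homology2_class \<Gamma> c" for \<omega>' c'
  proof -
    obtain \<beta> where "\<beta> \<in> coboundaries2 \<Gamma> G" and "\<omega>' = \<beta> \<otimes>\<^bsub>cochains2 \<Gamma> G\<^esub> \<omega>"
      using w unfolding cohomology2_class_def r_coset_def by blast
    moreover then obtain \<phi> where \<phi>: "\<phi> \<in> carrier \<Gamma> \<rightarrow> carrier G"
      and "\<beta> = (\<lambda>(a, b)\<in>?S. \<phi> a \<otimes> inv \<phi> (a \<otimes>\<^bsub>\<Gamma>\<^esub> b) \<otimes> \<phi> b)"
      unfolding coboundaries2_def by blast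
    ultimately have \<omega>': "\<omega>' = (\<lambda>s\<in>?S. (\<lambda>(a, b)\<in>?S. \<phi> a \<otimes> inv \<phi> (a \<otimes>\<^bsub>\<Gamma>\<^esub> b) \<otimes> \<phi> b) s \<otimes> \<omega> s)"
      by (simp only: cochains2_def mult_product_group)
    obtain d where d: "Poly_Mapping.keys d \<subseteq> carrier \<Gamma> \<times> carrier \<Gamma> \<times> carrier \<Gamma>" and c': "c' = bar_boundary3 \<Gamma> d + c"
      using k by (auto simp: homology2_class_def boundaries2_def r_coset_def bar2_def)
    note b = boundary2_boundary3[OF \<Gamma> d]
    have c'S: "Poly_Mapping.keys c' \<subseteq> ?S"
      using keys_add[of "bar_boundary3 \<Gamma> d" c] b(2) cS by (auto simp: c')
    have "bar_boundary2 \<Gamma> c' = 0"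
      using b(1) c0 unfolding c' by (simp add: bar_boundary2_def frag_extend_add)
    \<comment> \<open>The coboundary is evaluated at the modified representative \<open>c'\<close>,
      which therefore has to be a cycle itself.\<close>
    then have c'_cycle: "c' \<in> cycles2 \<Gamma>"
      using c'S by (simp add: cycles2_def bar2_def)
    have \<beta>: "(\<lambda>(a, b). \<phi> a \<otimes> inv \<phi> (a \<otimes>\<^bsub>\<Gamma>\<^esub> b) \<otimes> \<phi> b) \<in> ?S \<rightarrow> carrier G"
      using \<phi> by (auto simp: Pi_iff)
    have "frag_eval G \<omega>' c' = frag_eval G (\<lambda>s. (\<lambda>(a, b). \<phi> a \<otimes> inv \<phi> (a \<otimes>\<^bsub>\<Gamma>\<^esub> b) \<otimes> \<phi> b) s \<otimes> \<omega> s) c'"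
    proof (rule frag_eval_cong[OF _ c'S])
      show "\<omega>' \<in> ?S \<rightarrow> carrier G"
        unfolding \<omega>' using \<beta> \<omega>S by (auto simp: Pi_iff)
      show "\<omega>' s = (\<lambda>(a, b). \<phi> a \<otimes> inv \<phi> (a \<otimes>\<^bsub>\<Gamma>\<^esub> b) \<otimes> \<phi> b) s \<otimes> \<omega> s" if "s \<in> Poly_Mapping.keys c'" for s
        unfolding \<omega>' using c'S that by auto
    qed
    also have "\<dots> = frag_eval G (\<lambda>(a, b). \<phi> a \<otimes> inv \<phi> (a \<otimes>\<^bsub>\<Gamma>\<^esub> b) \<otimes> \<phi> b) c' \<otimes> frag_eval G \<omega> c'"
      by (rule frag_eval_mult[OF \<beta> \<omega>S c'S])
    also have "\<dots> = frag_eval G \<omega> c'"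
      using coboundary_eval_cycle[OF \<Gamma> \<phi> c'_cycle] frag_eval_closed[OF \<omega>S c'S] by simp
    also have "\<dots> = frag_eval G \<omega> (bar_boundary3 \<Gamma> d) \<otimes> frag_eval G \<omega> c"
      unfolding c' by (rule frag_eval_add[OF \<omega>S b(2) cS])
    also have "\<dots> = frag_eval G \<omega> c"
      using cocycle_eval_boundary[OF \<Gamma> \<omega>S cocycle d] frag_eval_closed[OF \<omega>S cS] by simp
    finally show ?thesis .
  qed
  have "cohomology2_class \<Gamma> G \<omega> \<noteq> {}" "homology2_class \<Gamma> c \<noteq> {}"
    by (auto simp: cohomology2_class_def coboundaries2_def homology2_class_def boundaries2_def r_coset_def)
  then have "(\<lambda>(\<omega>, c). frag_eval G \<omega> c) ` (cohomology2_class \<Gamma> G \<omega> \<times> homology2_class \<Gamma> c) = {frag_eval G \<omega> c}"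
    using main by (force simp: image_iff)
  then show ?thesis
    by (simp add: kronecker_def cochain_eval_eq)
qed

end

lemma (in group) comm_group_Mod:
  assumes N: "N \<lhd> G" and comm: "\<And>x y. x \<in> carrier G \<Longrightarrow> y \<in> carrier G \<Longrightarrow> x \<otimes> y \<otimes> inv x \<otimes> inv y \<in> N"
  shows "comm_group (G Mod N)"
proof (rule group.group_comm_groupI)
  interpret N: normal N G by fact
  show "group (G Mod N)" by (rule N.factorgroup_is_group)
  fix X Y assume "X \<in> carrier (G Mod N)" "Y \<in> carrier (G Mod N)"
  then obtain x y where xy: "x \<in> carrier G" "X = N #> x" "y \<in> carrier G" "Y = N #> y"
    by (auto simp: FactGroup_def RCOSETS_def)
  have "x \<otimes> y = (x \<otimes> y \<otimes> inv x \<otimes> inv y) \<otimes> (y \<otimes> x)"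
    using xy by (simp add: m_assoc) (simp add: m_assoc[symmetric])
  then have "N #> (x \<otimes> y) = N #> (y \<otimes> x)"
    using xy comm[OF xy(1,3)] N.subset by (metis coset_assoc coset_join2 coset_mult_assoc m_closed N.subgroup_axioms N.mem_carrier)
  then show "X \<otimes>\<^bsub>G Mod N\<^esub> Y = Y \<otimes>\<^bsub>G Mod N\<^esub> X"
    using xy by (simp add: N.rcos_sum)
qed

text \<open>The additive group in multiplicative notation, so that \<open>frag_eval\<close> and
  group homomorphisms apply to it.\<close>

definition complex_add :: "complex monoid" where
  "complex_add = \<lparr>carrier = UNIV, monoid.mult = (+), one = 0\<rparr>"

lemma complex_add_simps [simp]:
  "carrier complex_add = UNIV" "x \<otimes>\<^bsub>complex_add\<^esub> y = x + y" "\<one>\<^bsub>complex_add\<^esub> = 0"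
  by (simp_all add: complex_add_def)

lemma comm_group_complex_add: "comm_group complex_add"
  by (rule comm_groupI) (auto simp: add.assoc intro: exI[of _ "- x" for x])

lemma inv_complex_add [simp]: "inv\<^bsub>complex_add\<^esub> x = - x"
proof -
  interpret comm_group complex_add by (rule comm_group_complex_add)
  show ?thesis by (rule inv_equality) auto
qed

lemma int_pow_complex_add [simp]: "x [^]\<^bsub>complex_add\<^esub> (k::int) = of_int k * x"
proof -
  interpret comm_group complex_add by (rule comm_group_complex_add)
  have nat: "x [^]\<^bsub>complex_add\<^esub> (n::nat) = of_nat n * x" for n
    by (induction n) (simp_all add: algebra_simps)
  show ?thesis
    by (simp add: int_pow_def2 nat)
qed

lemma frag_eval_complex_add:
  fixes f :: "'s \<Rightarrow> complex"
  shows "frag_eval complex_add f c = (\<Sum>s\<in>Poly_Mapping.keys c. of_int (Poly_Mapping.lookup c s) * f s)"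
proof -
  interpret comm_group complex_add by (rule comm_group_complex_add)
  have "finite S \<Longrightarrow> finprod complex_add g S = sum g S" for g and S :: "'s set"
    by (induction S rule: finite_induct) auto
  then show ?thesis
    by (simp add: frag_eval_def)
qed

section \<open>The determinant of a cycle\<close>

context tracial_cstar_algebra
begin

lemma unitary_inverse:
  assumes "u \<in> unitary_group A"
  shows "u \<in> Units A" "inv u = star A u"
proof -
  have u: "u \<in> carrier A" "star A u \<in> carrier A" "star A u \<otimes> u = \<one>" "u \<otimes> star A u = \<one>"
    using assms by (auto simp: unitary_group_def star_closed)
  then show "u \<in> Units A" by (auto simp: Units_def)
  show "inv u = star A u"
    using u by (intro inv_char) auto
qed

lemma cnorm_unitary_le:
  assumes "u \<in> unitary_group A"
  shows "cnorm A u \<le> 1" "cnorm A (star A u) \<le> 1"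
proof -
  have u: "u \<in> carrier A" "star A u \<in> carrier A" "star A u \<otimes> u = \<one>" "u \<otimes> star A u = \<one>"
    using assms by (auto simp: unitary_group_def star_closed)
  have le: "cnorm A x \<le> 1" if "x \<in> carrier A" "star A x \<otimes> x = \<one>" for x
  proof -
    have "(cnorm A x)\<^sup>2 \<le> 1"
      using cstar_identity[OF that(1)] that(2) cnorm_one_le by simp
    then show ?thesis
      using power2_le_imp_le[of "cnorm A x" 1] by simp
  qed
  show "cnorm A u \<le> 1" "cnorm A (star A u) \<le> 1"
    using u le[of u] le[of "star A u"] by (simp_all add: star_star)
qed

text \<open>The graph of the multivalued logarithm of the determinant; \<open>(\<one>, w)\<close>
  belongs to it exactly if \<open>w\<close> is a value at the unit.\<close>

definition det_kernel :: "('a \<times> complex) set" where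
  "det_kernel = {(u, w). u \<in> Units A \<and> det_log u w}"

abbreviation det_group :: "('a \<times> complex) monoid" where
  "det_group \<equiv> units_of A \<times>\<times> complex_add"

lemma group_det_group: "group det_group"
  by (intro DirProd_group units_group comm_group.axioms(2) comm_group_complex_add)

lemma det_group_simps:
  "carrier det_group = Units A \<times> UNIV"
  "x \<otimes>\<^bsub>det_group\<^esub> y = (fst x \<otimes> fst y, snd x + snd y)"
  "\<one>\<^bsub>det_group\<^esub> = (\<one>, 0)"
  "carrier (units_of A) = Units A"
  by (auto simp: DirProd_def units_of_def split: prod.splits)

lemma inv_det_group: "u \<in> Units A \<Longrightarrow> inv\<^bsub>det_group\<^esub> (u, w) = (inv u, - w)"
  using inv_DirProd[OF units_group comm_group.axioms(2)[OF comm_group_complex_add], of u w]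
  by (simp add: units_of_carrier units_of_inv)

lemma normal_det_kernel: "det_kernel \<lhd> det_group"
proof -
  interpret K: group det_group by (rule group_det_group)
  have "subgroup det_kernel det_group"
  proof (rule K.subgroupI)
    show "det_kernel \<subseteq> carrier det_group"
      by (auto simp: det_kernel_def det_group_simps)
    have "(\<one>, 0) \<in> det_kernel"
      by (simp add: det_kernel_def det_log_one)
    then show "det_kernel \<noteq> {}" by blast
    show "inv\<^bsub>det_group\<^esub> x \<in> det_kernel" if "x \<in> det_kernel" for x
    proof -
      obtain u w where x: "x = (u, w)" "u \<in> Units A" "det_log u w"
        using \<open>x \<in> det_kernel\<close> by (auto simp: det_kernel_def)
      then show ?thesis
        using det_log_inverse[of u "inv u" w] by (simp add: inv_det_group det_kernel_def Units_closed)
    qed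
    show "x \<otimes>\<^bsub>det_group\<^esub> y \<in> det_kernel" if "x \<in> det_kernel" "y \<in> det_kernel" for x y
      using that by (auto simp: det_kernel_def det_group_simps Units_closed intro: det_log_mult)
  qed
  moreover have "x \<otimes>\<^bsub>det_group\<^esub> h \<otimes>\<^bsub>det_group\<^esub> inv\<^bsub>det_group\<^esub> x \<in> det_kernel"
    if x: "x \<in> carrier det_group" and h: "h \<in> det_kernel" for x h
  proof -
    obtain u w where u: "x = (u, w)" "u \<in> Units A"
      using x by (auto simp: det_group_simps)
    obtain v z where v: "h = (v, z)" "v \<in> Units A" "det_log v z"
      using h by (auto simp: det_kernel_def)
    show ?thesis
      using u v det_log_conjugate[of u "inv u" v z]
      by (simp add: inv_det_group det_group_simps(2) units_of_mult det_kernel_def Units_closed)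
  qed
  ultimately show ?thesis
    unfolding K.normal_inv_iff by blast
qed

abbreviation det_quotient :: "('a \<times> complex) set monoid" where
  "det_quotient \<equiv> det_group Mod det_kernel"

text \<open>A commutator in \<open>det_group\<close> has second component 0, which is a value at the
  commutator of the first components.\<close>

lemma comm_group_det_quotient: "comm_group det_quotient"
proof (rule group.comm_group_Mod[OF group_det_group normal_det_kernel])
  fix x y assume "x \<in> carrier det_group" "y \<in> carrier det_group"
  then obtain u w v z where "x = (u, w)" "y = (v, z)" "u \<in> Units A" "v \<in> Units A"
    by (auto simp: det_group_simps)
  then show "x \<otimes>\<^bsub>det_group\<^esub> y \<otimes>\<^bsub>det_group\<^esub> inv\<^bsub>det_group\<^esub> x \<otimes>\<^bsub>det_group\<^esub> inv\<^bsub>det_group\<^esub> y \<in> det_kernel"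
    using det_log_commutator[of u "inv u" v "inv v"]
    by (simp add: inv_det_group det_group_simps(2) units_of_mult det_kernel_def Units_closed)
qed

text \<open>In the abelian quotient of \<open>det_group\<close> the class of \<open>(\<rho> a \<rho> b (\<rho> (a b))\<^sup>-\<^sup>1, 0)\<close> is both a coboundary in
  \<open>a\<close>, \<open>b\<close> and the class of \<open>(1, - \<omega> (a, b))\<close>.\<close>

lemma det_log_cycle:
  assumes \<Gamma>: "group \<Gamma>" and c: "c \<in> cycles2 \<Gamma>" and \<rho>: "\<rho> \<in> carrier \<Gamma> \<rightarrow> Units A"
    and \<omega>: "\<And>a b. (a, b) \<in> Poly_Mapping.keys c \<Longrightarrow> det_log (\<rho> a \<otimes> \<rho> b \<otimes> inv \<rho> (a \<otimes>\<^bsub>\<Gamma>\<^esub> b)) (\<omega> (a, b))"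
  shows "det_log \<one> (\<Sum>s\<in>Poly_Mapping.keys c. of_int (Poly_Mapping.lookup c s) * \<omega> s)"
proof -
  interpret \<Gamma>: group \<Gamma> by fact
  interpret K: group det_group by (rule group_det_group)
  interpret N: normal det_kernel det_group by (rule normal_det_kernel)
  interpret Q: comm_group det_quotient by (rule comm_group_det_quotient)
  interpret C: comm_group complex_add by (rule comm_group_complex_add)
  define \<pi> where "\<pi> x = det_kernel #>\<^bsub>det_group\<^esub> x" for x
  have \<pi>: "\<pi> \<in> hom det_group det_quotient"
    unfolding \<pi>_def by (rule N.r_coset_hom_Mod)
  interpret \<pi>: group_hom det_group det_quotient \<pi>
    using \<pi> by unfold_locales
  have \<pi>_eq: "\<pi> x = \<pi> y" if "x \<in> carrier det_group" "y \<in> carrier det_group"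
    "x \<otimes>\<^bsub>det_group\<^esub> inv\<^bsub>det_group\<^esub> y \<in> det_kernel" for x y
  proof -
    have "det_kernel #>\<^bsub>det_group\<^esub> x
        = det_kernel #>\<^bsub>det_group\<^esub> ((x \<otimes>\<^bsub>det_group\<^esub> inv\<^bsub>det_group\<^esub> y) \<otimes>\<^bsub>det_group\<^esub> y)"
      using K.inv_solve_right'[of x _ y] that(1,2) K.m_assoc[of x "inv\<^bsub>det_group\<^esub> y" y] by (simp only: K.inv_closed K.l_inv K.r_one)
    also have "\<dots> = (det_kernel #>\<^bsub>det_group\<^esub> (x \<otimes>\<^bsub>det_group\<^esub> inv\<^bsub>det_group\<^esub> y)) #>\<^bsub>det_group\<^esub> y"
      by (intro K.coset_mult_assoc[symmetric] N.subset K.m_closed K.inv_closed that)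
    also have "\<dots> = det_kernel #>\<^bsub>det_group\<^esub> y"
      by (subst K.coset_join2[OF _ N.subgroup_axioms that(3)]) (intro refl K.m_closed K.inv_closed that)+
    finally show ?thesis by (simp only: \<pi>_def)
  qed
  \<comment> \<open>\<open>\<psi>\<close> is the quotient map on scalars. It carries the evaluation
    of the cocycle on \<open>c\<close> into the quotient, and its kernel consists of the values of
    the determinant at the unit.\<close>
  define \<psi> where "\<psi> z = \<pi> (\<one>, z)" for z
  have \<psi>: "\<psi> \<in> hom complex_add det_quotient"
  proof (rule homI)
    show "\<psi> z \<in> carrier det_quotient" for z
      unfolding \<psi>_def by (rule \<pi>.hom_closed) (simp add: det_group_simps)
    show "\<psi> (z \<otimes>\<^bsub>complex_add\<^esub> w) = \<psi> z \<otimes>\<^bsub>det_quotient\<^esub> \<psi> w" for z w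
      unfolding \<psi>_def by (subst \<pi>.hom_mult[symmetric]) (simp_all add: det_group_simps units_of_mult)
  qed
  define \<phi> where "\<phi> a = \<pi> (\<rho> a, 0)" for a
  have \<phi>: "\<phi> \<in> carrier \<Gamma> \<rightarrow> carrier det_quotient"
    unfolding \<phi>_def using \<rho> by (auto intro!: \<pi>.hom_closed simp: det_group_simps)
  have keys: "Poly_Mapping.keys c \<subseteq> carrier \<Gamma> \<times> carrier \<Gamma>"
    using c by (auto simp: cycles2_def bar2_def)
  have eq: "\<phi> a \<otimes>\<^bsub>det_quotient\<^esub> inv\<^bsub>det_quotient\<^esub> \<phi> (a \<otimes>\<^bsub>\<Gamma>\<^esub> b) \<otimes>\<^bsub>det_quotient\<^esub> \<phi> b
      = \<psi> (- \<omega> (a, b))" if ab: "(a, b) \<in> Poly_Mapping.keys c" for a b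
  proof -
    have \<Gamma>ab: "a \<in> carrier \<Gamma>" "b \<in> carrier \<Gamma>" using keys ab by auto
    then have U: "\<rho> a \<in> Units A" "\<rho> b \<in> Units A" "\<rho> (a \<otimes>\<^bsub>\<Gamma>\<^esub> b) \<in> Units A"
      using \<rho> by auto
    then have cU: "(\<rho> a, 0) \<in> carrier det_group" "(\<rho> b, 0) \<in> carrier det_group" "(\<rho> (a \<otimes>\<^bsub>\<Gamma>\<^esub> b), 0) \<in> carrier det_group"
      by (simp_all add: det_group_simps)
    have "\<phi> a \<otimes>\<^bsub>det_quotient\<^esub> inv\<^bsub>det_quotient\<^esub> \<phi> (a \<otimes>\<^bsub>\<Gamma>\<^esub> b) \<otimes>\<^bsub>det_quotient\<^esub> \<phi> b
      = \<phi> a \<otimes>\<^bsub>det_quotient\<^esub> \<phi> b \<otimes>\<^bsub>det_quotient\<^esub> inv\<^bsub>det_quotient\<^esub> \<phi> (a \<otimes>\<^bsub>\<Gamma>\<^esub> b)"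
    proof -
      have "\<phi> a \<in> carrier det_quotient" "\<phi> b \<in> carrier det_quotient"
        "inv\<^bsub>det_quotient\<^esub> \<phi> (a \<otimes>\<^bsub>\<Gamma>\<^esub> b) \<in> carrier det_quotient"
        using \<phi> \<Gamma>ab by (auto intro!: Q.inv_closed)
      then show ?thesis
        by (simp only: Q.m_ac)
    qed
    also have "\<dots> = \<pi> ((\<rho> a, 0) \<otimes>\<^bsub>det_group\<^esub> (\<rho> b, 0) \<otimes>\<^bsub>det_group\<^esub> inv\<^bsub>det_group\<^esub> (\<rho> (a \<otimes>\<^bsub>\<Gamma>\<^esub> b), 0))"
      unfolding \<phi>_def using cU by (simp only: \<pi>.hom_mult \<pi>.hom_inv K.inv_closed K.m_closed)
    also have "\<dots> = \<pi> (\<rho> a \<otimes> \<rho> b \<otimes> inv \<rho> (a \<otimes>\<^bsub>\<Gamma>\<^esub> b), 0)"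
      using U by (simp add: inv_det_group det_group_simps(2) units_of_mult)
    \<comment> \<open>With \<open>u\<close> the defect, \<open>(u, 0)\<close> and
      \<open>(\<one>, - \<omega> (a, b))\<close> differ by \<open>(u, \<omega> (a, b))\<close>,
      which lies in \<open>det_kernel\<close> by hypothesis.\<close>
    also have "\<dots> = \<psi> (- \<omega> (a, b))"
      unfolding \<psi>_def
      by (rule \<pi>_eq) (use U \<omega>[OF ab] in \<open>simp_all add: inv_det_group det_group_simps units_of_mult det_kernel_def Units_closed\<close>)
    finally show ?thesis .
  qed
  have "\<psi> (frag_eval complex_add (\<lambda>s. - \<omega> s) c) = frag_eval det_quotient (\<lambda>s. \<psi> (- \<omega> s)) c"
    by (rule C.frag_eval_hom[OF Q.comm_group_axioms \<psi> _ subset_refl]) simp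
  also have "\<dots> = frag_eval det_quotient (\<lambda>(a, b). \<phi> a \<otimes>\<^bsub>det_quotient\<^esub>
      inv\<^bsub>det_quotient\<^esub> \<phi> (a \<otimes>\<^bsub>\<Gamma>\<^esub> b) \<otimes>\<^bsub>det_quotient\<^esub> \<phi> b) c"
    by (rule Q.frag_eval_cong[OF _ subset_refl]) (use hom_in_carrier[OF \<psi>] eq in auto)
  also have "\<dots> = \<one>\<^bsub>det_quotient\<^esub>"
    by (rule Q.coboundary_eval_cycle[OF \<Gamma> \<phi> c])
  finally have "\<psi> (frag_eval complex_add (\<lambda>s. - \<omega> s) c) = det_kernel"
    by (simp add: FactGroup_def)
  then have "(\<one>, frag_eval complex_add (\<lambda>s. - \<omega> s) c) \<in> det_kernel"
    using K.rcos_self[OF _ N.subgroup_axioms, of "(\<one>, frag_eval complex_add (\<lambda>s. - \<omega> s) c)"]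
    by (simp add: \<psi>_def \<pi>_def det_group_simps)
  then have "det_log \<one> (- (\<Sum>s\<in>Poly_Mapping.keys c. of_int (Poly_Mapping.lookup c s) * \<omega> s))"
    by (simp add: det_kernel_def frag_eval_complex_add sum_negf)
  \<comment> \<open>The computation yields the negative of the sum; inverting the unit element
    removes the sign.\<close>
  from det_log_inverse[OF _ _ _ _ this, of \<one>] show ?thesis by simp
qed

text \<open>An exact statement about one algebra: distance below 1 makes every logarithm a value of
  the determinant, and the cycle condition turns their combination into a value at the unit.\<close>

lemma cycle_log_in_K0_trace:
  assumes \<Gamma>: "group \<Gamma>" and c: "c \<in> cycles2 \<Gamma>" and \<rho>: "\<rho> \<in> carrier \<Gamma> \<rightarrow> unitary_group A"
    and small: "\<And>a b. (a, b) \<in> Poly_Mapping.keys c \<Longrightarrow> cnorm A (\<rho> a \<otimes> \<rho> b \<otimes> inv \<rho> (a \<otimes>\<^bsub>\<Gamma>\<^esub> b) \<ominus> \<one>) < 1"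
  shows "(\<Sum>(a, b)\<in>Poly_Mapping.keys c. of_int (Poly_Mapping.lookup c (a, b)) *
      (1 / (2 * of_real pi * \<i>) * \<tau> (cstar_log A (\<rho> a \<otimes> \<rho> b \<otimes> inv \<rho> (a \<otimes>\<^bsub>\<Gamma>\<^esub> b)))))
    \<in> K0_trace \<tau> ` carrier (K0 A)"
proof -
  interpret \<Gamma>: group \<Gamma> by fact
  have \<rho>U: "\<rho> \<in> carrier \<Gamma> \<rightarrow> Units A"
    using \<rho> unitary_inverse by auto
  have keys: "Poly_Mapping.keys c \<subseteq> carrier \<Gamma> \<times> carrier \<Gamma>"
    using c by (auto simp: cycles2_def bar2_def)
  define \<omega> where "\<omega> = (\<lambda>(a, b). \<tau> (cstar_log A (\<rho> a \<otimes> \<rho> b \<otimes> inv \<rho> (a \<otimes>\<^bsub>\<Gamma>\<^esub> b))))"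
  have "det_log \<one> (\<Sum>s\<in>Poly_Mapping.keys c. of_int (Poly_Mapping.lookup c s) * \<omega> s)"
  proof (rule det_log_cycle[OF \<Gamma> c \<rho>U])
    fix a b assume ab: "(a, b) \<in> Poly_Mapping.keys c"
    then have "\<rho> a \<in> Units A" "\<rho> b \<in> Units A" "\<rho> (a \<otimes>\<^bsub>\<Gamma>\<^esub> b) \<in> Units A"
      using keys \<rho>U by auto
    then show "det_log (\<rho> a \<otimes> \<rho> b \<otimes> inv \<rho> (a \<otimes>\<^bsub>\<Gamma>\<^esub> b)) (\<omega> (a, b))"
      unfolding \<omega>_def prod.case by (intro det_log_log small ab) (simp add: Units_closed)
  qed
  from det_log_one_imp[OF this] show ?thesis
    by (simp add: \<omega>_def sum_distrib_left sum_divide_distrib case_prod_unfold mult_ac)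
qed

text \<open>The left difference is \<open>(x \<ominus> y) \<otimes> inv y\<close>, and
  \<open>inv y\<close> has norm at most 1.\<close>

lemma defect_close:
  assumes "x \<in> carrier A" "y \<in> unitary_group A"
  shows "cnorm A (x \<otimes> inv y \<ominus> \<one>) \<le> cnorm A (x \<ominus> y)"
proof -
  have y: "y \<in> carrier A" "star A y \<in> carrier A" "y \<otimes> star A y = \<one>"
    using assms by (auto simp: unitary_group_def star_closed)
  have "x \<otimes> inv y \<ominus> \<one> = (x \<ominus> y) \<otimes> star A y"
    using assms(1) y unitary_inverse[OF assms(2)] by (simp add: a_minus_def l_distr l_minus)
  then have "cnorm A (x \<otimes> inv y \<ominus> \<one>) \<le> cnorm A (x \<ominus> y) * cnorm A (star A y)"
    using cnorm_mult[of "x \<ominus> y" "star A y"] assms(1) y by simp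
  also have "\<dots> \<le> cnorm A (x \<ominus> y) * 1"
    using assms(1) y cnorm_unitary_le[OF assms(2)] by (intro mult_left_mono cnorm_nonneg) auto
  finally show ?thesis by simp
qed

text \<open>\<open>\<rho> a\<close> conjugates the defect of \<open>(b, c)\<close>, and
  \<open>\<rho> a u(b,c) (\<rho> a)\<^sup>-\<^sup>1 u(a,bc) = u(a,b) u(ab,c)\<close>.\<close>

lemma defect_cocycle_identity:
  assumes x: "x \<in> unitary_group A" "y \<in> unitary_group A" "z \<in> unitary_group A"
    and p: "p \<in> unitary_group A" "q \<in> unitary_group A" "r \<in> unitary_group A"
    and small: "cnorm A (y \<otimes> z \<otimes> inv q \<ominus> \<one>) \<le> 1 / 4" "cnorm A (x \<otimes> q \<otimes> inv r \<ominus> \<one>) \<le> 1 / 4"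
      "cnorm A (p \<otimes> z \<otimes> inv r \<ominus> \<one>) \<le> 1 / 4" "cnorm A (x \<otimes> y \<otimes> inv p \<ominus> \<one>) \<le> 1 / 4"
  shows "\<tau> (cstar_log A (y \<otimes> z \<otimes> inv q)) + \<tau> (cstar_log A (x \<otimes> q \<otimes> inv r))
    = \<tau> (cstar_log A (p \<otimes> z \<otimes> inv r)) + \<tau> (cstar_log A (x \<otimes> y \<otimes> inv p))"
proof -
  have U: "x \<in> Units A" "y \<in> Units A" "z \<in> Units A" "p \<in> Units A" "q \<in> Units A" "r \<in> Units A"
    using x p unitary_inverse by auto
  note cl = U[THEN Units_closed] U[THEN Units_inv_closed]
  define u where "u = y \<otimes> z \<otimes> inv q"
  have u: "u \<in> carrier A" unfolding u_def using cl by simp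
  \<comment> \<open>Conjugation by the unitary \<open>x\<close> does not increase the distance to
    \<open>\<one>\<close>, so \<open>trace_log_mult\<close> also applies to the conjugated
    defect.\<close>
  have "x \<otimes> u \<otimes> inv x \<ominus> \<one> = x \<otimes> (u \<ominus> \<one>) \<otimes> inv x"
    using cl u U by (simp add: a_minus_def l_distr r_distr r_minus l_minus)
  then have "cnorm A (x \<otimes> u \<otimes> inv x \<ominus> \<one>) \<le> cnorm A (x \<otimes> (u \<ominus> \<one>)) * cnorm A (inv x)"
    using cnorm_mult[of "x \<otimes> (u \<ominus> \<one>)" "inv x"] cl u by simp
  also have "\<dots> \<le> cnorm A (x \<otimes> (u \<ominus> \<one>)) * 1"
    using cnorm_unitary_le[OF x(1)] unitary_inverse[OF x(1)] cl u by (intro mult_left_mono cnorm_nonneg) auto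
  also have "\<dots> \<le> cnorm A x * cnorm A (u \<ominus> \<one>)"
    using cnorm_mult[of x "u \<ominus> \<one>"] cl u by simp
  also have "\<dots> \<le> 1 * cnorm A (u \<ominus> \<one>)"
    using cnorm_unitary_le[OF x(1)] u by (intro mult_right_mono cnorm_nonneg) auto
  finally have conj_small: "cnorm A (x \<otimes> u \<otimes> inv x \<ominus> \<one>) \<le> 1 / 4"
    using small(1) by (simp add: u_def)
  have eq: "(x \<otimes> u \<otimes> inv x) \<otimes> (x \<otimes> q \<otimes> inv r) = (x \<otimes> y \<otimes> inv p) \<otimes> (p \<otimes> z \<otimes> inv r)"
  proof -
    have c: "inv x \<otimes> (x \<otimes> w) = w" "inv q \<otimes> (q \<otimes> w) = w" "inv p \<otimes> (p \<otimes> w) = w" if "w \<in> carrier A" for w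
      using that U cl by (simp_all add: m_assoc[symmetric])
    show ?thesis
      unfolding u_def using cl by (simp add: m_assoc c)
  qed
  have h1: "\<tau> (cstar_log A ((x \<otimes> u \<otimes> inv x) \<otimes> (x \<otimes> q \<otimes> inv r)))
      = \<tau> (cstar_log A (x \<otimes> u \<otimes> inv x)) + \<tau> (cstar_log A (x \<otimes> q \<otimes> inv r))"
    using cl u by (intro trace_log_mult conj_small small) auto
  have h2: "\<tau> (cstar_log A ((x \<otimes> y \<otimes> inv p) \<otimes> (p \<otimes> z \<otimes> inv r)))
      = \<tau> (cstar_log A (x \<otimes> y \<otimes> inv p)) + \<tau> (cstar_log A (p \<otimes> z \<otimes> inv r))"
    using cl by (intro trace_log_mult small) auto
  have h3: "\<tau> (cstar_log A (x \<otimes> u \<otimes> inv x)) = \<tau> (cstar_log A u)"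
    using U cl u conj_small small(1) by (intro trace_log_conjugate) (auto simp: u_def)
  show ?thesis
    using h1[unfolded eq] h2 h3 unfolding u_def by (simp add: add.commute)
qed

end

section \<open>Null sequences and the proof of the theorem\<close>

lemma c0_group_simps:
  "carrier (c0_group G) = {x. (\<forall>n. x n \<in> G n) \<and> x \<longlonglongrightarrow> 0}"
  "x \<otimes>\<^bsub>c0_group G\<^esub> y = (\<lambda>n. x n + y n)" "\<one>\<^bsub>c0_group G\<^esub> = (\<lambda>n. 0)"
  by (simp_all add: c0_group_def)

abbreviation null_seqs :: "(nat \<Rightarrow> complex) monoid" where
  "null_seqs \<equiv> c0_group (\<lambda>_. UNIV)"

abbreviation finite_seqs :: "(nat \<Rightarrow> complex) set" where
  "finite_seqs \<equiv> c00 (\<lambda>_. UNIV)"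

lemma comm_group_c0: "comm_group null_seqs"
proof (rule comm_groupI)
  fix x assume "x \<in> carrier null_seqs"
  then have "x \<longlonglongrightarrow> 0" by (simp add: c0_group_simps)
  then have "(\<lambda>n. - x n) \<longlonglongrightarrow> 0" using tendsto_minus by fastforce
  then show "\<exists>y\<in>carrier null_seqs. y \<otimes>\<^bsub>null_seqs\<^esub> x = \<one>\<^bsub>null_seqs\<^esub>"
    by (intro bexI[of _ "\<lambda>n. - x n"]) (auto simp: c0_group_simps)
qed (auto simp: c0_group_simps add.assoc add.commute intro: tendsto_add_zero)

lemma inv_c0: "x \<longlonglongrightarrow> 0 \<Longrightarrow> inv\<^bsub>null_seqs\<^esub> x = (\<lambda>n. - x n)"
proof -
  interpret comm_group "null_seqs" by (rule comm_group_c0)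
  assume "x \<longlonglongrightarrow> 0"
  moreover from this have "(\<lambda>n. - x n) \<longlonglongrightarrow> 0" using tendsto_minus by fastforce
  ultimately show ?thesis
    by (intro inv_equality) (auto simp: c0_group_simps)
qed

lemma c00_tendsto:
  assumes "x \<in> c00 G"
  shows "x \<longlonglongrightarrow> 0"
proof -
  have "\<forall>\<^sub>F n in cofinite. x n = 0"
    using assms by (simp add: c00_def eventually_cofinite)
  then show ?thesis
    by (intro tendsto_eventually) (simp add: cofinite_eq_sequentially)
qed

lemma subgroup_c00: "subgroup finite_seqs null_seqs"
proof -
  interpret comm_group "null_seqs" by (rule comm_group_c0)
  show ?thesis
  proof (rule subgroupI)
    show "finite_seqs \<subseteq> carrier null_seqs"
      using c00_tendsto by (auto simp: c0_group_simps)
    show "finite_seqs \<noteq> {}"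
      by (auto simp: c00_def intro!: exI[of _ "\<lambda>_. 0"])
    show "inv\<^bsub>null_seqs\<^esub> x \<in> finite_seqs" if "x \<in> finite_seqs" for x
      using that inv_c0[OF c00_tendsto[OF that]] by (simp add: c00_def)
    show "x \<otimes>\<^bsub>null_seqs\<^esub> y \<in> finite_seqs" if "x \<in> finite_seqs" "y \<in> finite_seqs" for x y
    proof -
      have "{n. x n + y n \<noteq> 0} \<subseteq> {n. x n \<noteq> 0} \<union> {n. y n \<noteq> 0}" by auto
      then show ?thesis
        using that by (auto simp: c00_def c0_group_simps intro: finite_subset)
    qed
  qed
qed

lemma comm_group_Q_C: "comm_group Q_C"
  unfolding Q_C_def by (rule comm_group.abelian_FactGroup[OF comm_group_c0 subgroup_c00])

definition Q_class :: "(nat \<Rightarrow> complex) \<Rightarrow> (nat \<Rightarrow> complex) set" where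
  "Q_class x = finite_seqs #>\<^bsub>null_seqs\<^esub> x"

lemma Q_class_hom: "Q_class \<in> hom null_seqs Q_C"
proof -
  interpret comm_group "null_seqs" by (rule comm_group_c0)
  interpret N: normal "finite_seqs" "null_seqs"
    by (rule subgroup_imp_normal[OF subgroup_c00])
  have "Q_class = (\<lambda>x. finite_seqs #>\<^bsub>null_seqs\<^esub> x)"
    by (simp add: fun_eq_iff Q_class_def)
  then show ?thesis
    unfolding Q_C_def using N.r_coset_hom_Mod by simp
qed

lemma Q_class_eqI:
  assumes "eventually (\<lambda>n. x n = y n) sequentially"
  shows "Q_class x = Q_class y"
proof -
  have "Q_class x \<subseteq> Q_class y" if ev: "eventually (\<lambda>n. x n = y n) sequentially" for x y
  proof
    fix z assume "z \<in> Q_class x"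
    then obtain h where h: "finite {n. h n \<noteq> 0}" and z: "z = (\<lambda>n. h n + x n)"
      by (auto simp: Q_class_def r_coset_def c00_def c0_group_simps)
    have "finite {n. x n \<noteq> y n}"
      using ev by (simp add: cofinite_eq_sequentially[symmetric] eventually_cofinite)
    then have "finite {n. h n + (x n - y n) \<noteq> 0}"
      by (rule finite_subset[rotated, OF finite_UnI[OF h]]) auto
    then have "(\<lambda>n. h n + (x n - y n)) \<in> finite_seqs"
      by (simp add: c00_def)
    then show "z \<in> Q_class y"
      unfolding Q_class_def r_coset_def z by (auto simp: c0_group_simps intro!: bexI)
  qed
  from this[OF assms] this[of y x] assms show ?thesis
    by (simp add: eq_commute[of "y _"] subset_antisym)
qed

text \<open>\<open>G\<close> is any family of sets containing 0: the zero sequence then lies in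
  \<open>c00 G\<close>, so \<open>x\<close> lies in its own coset, and adding all finitely supported
  sequences to that coset gives the class in \<open>Q_C\<close>.\<close>

lemma Q_class_in_Q_sub:
  assumes "x \<longlonglongrightarrow> 0" "\<And>n. x n \<in> G n" "\<And>n. 0 \<in> G n"
  shows "Q_class x \<in> Q_sub G"
proof -
  let ?X = "c00 G #>\<^bsub>c0_group G\<^esub> x"
  have "?X \<in> carrier (c0_group G Mod c00 G)"
    using assms by (auto simp: FactGroup_def RCOSETS_def c0_group_simps)
  moreover have "Q_class x = finite_seqs <#>\<^bsub>null_seqs\<^esub> ?X"
  proof
    show "Q_class x \<subseteq> finite_seqs <#>\<^bsub>null_seqs\<^esub> ?X"
    proof
      fix z assume "z \<in> Q_class x"
      then obtain h where h: "h \<in> finite_seqs" "z = (\<lambda>n. h n + x n)"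
        by (auto simp: Q_class_def r_coset_def c0_group_simps)
      have "(\<lambda>_. 0) \<in> c00 G"
        using assms(3) by (simp add: c00_def)
      then have "(\<lambda>_. 0) \<otimes>\<^bsub>c0_group G\<^esub> x \<in> ?X"
        unfolding r_coset_def by blast
      then have "x \<in> ?X"
        by (simp add: c0_group_simps)
      with h(1) have "h \<otimes>\<^bsub>null_seqs\<^esub> x \<in> finite_seqs <#>\<^bsub>null_seqs\<^esub> ?X"
        unfolding set_mult_def by blast
      with h(2) show "z \<in> finite_seqs <#>\<^bsub>null_seqs\<^esub> ?X"
        by (simp add: c0_group_simps)
    qed
    show "finite_seqs <#>\<^bsub>null_seqs\<^esub> ?X \<subseteq> Q_class x"
    proof
      fix z assume "z \<in> finite_seqs <#>\<^bsub>null_seqs\<^esub> ?X"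
      then obtain h k where h: "h \<in> finite_seqs" and k: "k \<in> c00 G" and z: "z = (\<lambda>n. h n + (k n + x n))"
        by (auto simp: set_mult_def r_coset_def c0_group_simps)
      have "finite {n. h n \<noteq> 0}" "finite {n. k n \<noteq> 0}"
        using h k by (auto simp: c00_def)
      then have "finite {n. h n + k n \<noteq> 0}"
        by (rule finite_subset[rotated, OF finite_UnI]) auto
      then have "(\<lambda>n. h n + k n) \<in> finite_seqs" by (simp add: c00_def)
      then have "(\<lambda>n. h n + k n) \<otimes>\<^bsub>null_seqs\<^esub> x \<in> Q_class x"
        unfolding Q_class_def r_coset_def by blast
      then show "z \<in> Q_class x"
        by (simp add: z c0_group_simps add.assoc)
    qed
  qed
  ultimately show ?thesis
    unfolding Q_sub_def by blast
qed

section \<open>The class of the asymptotic representation and its values on cycles\<close>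

locale asymptotic_representation =
  fixes \<Gamma> :: "('g, 'm) monoid_scheme"
    and A :: "nat \<Rightarrow> ('a, 'b) cstar_struct_scheme"
    and \<tau> :: "nat \<Rightarrow> 'a \<Rightarrow> complex"
    and \<rho> :: "nat \<Rightarrow> 'g \<Rightarrow> 'a"
  assumes group: "group \<Gamma>"
    and tracial: "tracial_cstar_algebra (A n) (\<tau> n)"
    and bounded: "bdd_above (range (\<lambda>n. functional_norm (A n) (\<tau> n)))"
    and unitary: "\<rho> n \<in> carrier \<Gamma> \<rightarrow> unitary_group (A n)"
    and asymptotic: "a \<in> carrier \<Gamma> \<Longrightarrow> b \<in> carrier \<Gamma> \<Longrightarrow>
      (\<lambda>n. cnorm (A n) (\<rho> n a \<otimes>\<^bsub>A n\<^esub> \<rho> n b \<ominus>\<^bsub>A n\<^esub> \<rho> n (a \<otimes>\<^bsub>\<Gamma>\<^esub> b))) \<longlonglongrightarrow> 0"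
begin

sublocale \<Gamma>: group \<Gamma> by (rule group)

definition defect :: "'g \<Rightarrow> 'g \<Rightarrow> nat \<Rightarrow> 'a" where
  "defect a b n = \<rho> n a \<otimes>\<^bsub>A n\<^esub> \<rho> n b \<otimes>\<^bsub>A n\<^esub> inv\<^bsub>A n\<^esub> (\<rho> n (a \<otimes>\<^bsub>\<Gamma>\<^esub> b))"

lemma unitary_apply: "a \<in> carrier \<Gamma> \<Longrightarrow> \<rho> n a \<in> unitary_group (A n)"
  using unitary by blast

lemma \<rho>_closed: "a \<in> carrier \<Gamma> \<Longrightarrow> \<rho> n a \<in> carrier (A n)"
  using unitary_apply[of a n] by (simp add: unitary_group_def)

lemma defect_closed:
  assumes "a \<in> carrier \<Gamma>" "b \<in> carrier \<Gamma>"
  shows "defect a b n \<in> carrier (A n)"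
proof -
  interpret tracial_cstar_algebra "A n" "\<tau> n" by (rule tracial)
  show ?thesis
    unfolding defect_def
    using assms Units_inv_closed[OF unitary_inverse(1)[OF unitary_apply[of "a \<otimes>\<^bsub>\<Gamma>\<^esub> b"]]]
    by (simp add: \<rho>_closed)
qed

lemma defect_tendsto:
  assumes "a \<in> carrier \<Gamma>" "b \<in> carrier \<Gamma>"
  shows "(\<lambda>n. cnorm (A n) (defect a b n \<ominus>\<^bsub>A n\<^esub> \<one>\<^bsub>A n\<^esub>)) \<longlonglongrightarrow> 0"
proof (rule tendsto_sandwich[OF _ _ tendsto_const asymptotic[OF assms]])
  have "0 \<le> cnorm (A n) (defect a b n \<ominus>\<^bsub>A n\<^esub> \<one>\<^bsub>A n\<^esub>)" for n
  proof -
    interpret tracial_cstar_algebra "A n" "\<tau> n" by (rule tracial)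
    show ?thesis using defect_closed[OF assms] by (intro cnorm_nonneg) simp
  qed
  then show "eventually (\<lambda>n. 0 \<le> cnorm (A n) (defect a b n \<ominus>\<^bsub>A n\<^esub> \<one>\<^bsub>A n\<^esub>)) sequentially"
    by simp
  have "cnorm (A n) (defect a b n \<ominus>\<^bsub>A n\<^esub> \<one>\<^bsub>A n\<^esub>)
      \<le> cnorm (A n) (\<rho> n a \<otimes>\<^bsub>A n\<^esub> \<rho> n b \<ominus>\<^bsub>A n\<^esub> \<rho> n (a \<otimes>\<^bsub>\<Gamma>\<^esub> b))" for n
  proof -
    interpret tracial_cstar_algebra "A n" "\<tau> n" by (rule tracial)
    show ?thesis
      unfolding defect_def by (intro defect_close unitary_apply m_closed \<rho>_closed assms) (use assms in simp)
  qed
  then show "eventually (\<lambda>n. cnorm (A n) (defect a b n \<ominus>\<^bsub>A n\<^esub> \<one>\<^bsub>A n\<^esub>)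
      \<le> cnorm (A n) (\<rho> n a \<otimes>\<^bsub>A n\<^esub> \<rho> n b \<ominus>\<^bsub>A n\<^esub> \<rho> n (a \<otimes>\<^bsub>\<Gamma>\<^esub> b))) sequentially"
    by simp
qed

lemma defect_small:
  assumes "a \<in> carrier \<Gamma>" "b \<in> carrier \<Gamma>" "0 < e"
  shows "eventually (\<lambda>n. cnorm (A n) (defect a b n \<ominus>\<^bsub>A n\<^esub> \<one>\<^bsub>A n\<^esub>) < e) sequentially"
  using order_tendstoD(2)[OF defect_tendsto[OF assms(1,2)] assms(3)] .

lemma defect_seq_eq:
  assumes "cnorm (A n) (defect a b n \<ominus>\<^bsub>A n\<^esub> \<one>\<^bsub>A n\<^esub>) < 1"
  shows "defect_seq \<Gamma> A \<tau> \<rho> a b n = 1 / (2 * of_real pi * \<i>) * \<tau> n (cstar_log (A n) (defect a b n))"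
  using assms by (simp add: defect_seq_def defect_def Let_def)

text \<open>The common bound \<open>K\<close> on the norms of the traces enters here:
  \<open>trace_log_bound\<close> becomes an estimate whose constant does not depend on
  \<open>n\<close>.\<close>

lemma defect_seq_tendsto:
  assumes ab: "a \<in> carrier \<Gamma>" "b \<in> carrier \<Gamma>"
  shows "defect_seq \<Gamma> A \<tau> \<rho> a b \<longlonglongrightarrow> 0"
proof -
  obtain K where K: "\<And>n. functional_norm (A n) (\<tau> n) \<le> K"
    using bounded by (auto simp: bdd_above_def)
  define C where "C = cmod (1 / (2 * of_real pi * \<i>))"
  have C: "C \<ge> 0" by (simp add: C_def)
  show ?thesis
  proof (rule Lim_null_comparison)
    have "(\<lambda>n. C * (K * (2 * cnorm (A n) (defect a b n \<ominus>\<^bsub>A n\<^esub> \<one>\<^bsub>A n\<^esub>)))) \<longlonglongrightarrow> C * (K * (2 * 0))"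
      by (intro tendsto_intros defect_tendsto ab)
    then show "(\<lambda>n. C * (K * (2 * cnorm (A n) (defect a b n \<ominus>\<^bsub>A n\<^esub> \<one>\<^bsub>A n\<^esub>)))) \<longlonglongrightarrow> 0"
      by simp
    have "eventually (\<lambda>n. cnorm (A n) (defect a b n \<ominus>\<^bsub>A n\<^esub> \<one>\<^bsub>A n\<^esub>) < 1 / 2) sequentially"
      by (rule defect_small[OF ab]) simp
    then show "eventually (\<lambda>n. norm (defect_seq \<Gamma> A \<tau> \<rho> a b n)
        \<le> C * (K * (2 * cnorm (A n) (defect a b n \<ominus>\<^bsub>A n\<^esub> \<one>\<^bsub>A n\<^esub>)))) sequentially"
    proof eventually_elim
      case (elim n)
      interpret tracial_cstar_algebra "A n" "\<tau> n" by (rule tracial)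
      have cl: "defect a b n \<ominus>\<^bsub>A n\<^esub> \<one>\<^bsub>A n\<^esub> \<in> carrier (A n)"
        using defect_closed[OF ab] by simp
      have "norm (defect_seq \<Gamma> A \<tau> \<rho> a b n) = C * cmod (\<tau> n (cstar_log (A n) (defect a b n)))"
        using elim by (subst defect_seq_eq) (simp_all add: C_def norm_mult norm_divide)
      also have "\<dots> \<le> C * (functional_norm (A n) (\<tau> n) * (2 * cnorm (A n) (defect a b n \<ominus>\<^bsub>A n\<^esub> \<one>\<^bsub>A n\<^esub>)))"
        using elim by (intro mult_left_mono C trace_log_bound defect_closed ab) simp
      also have "\<dots> \<le> C * (K * (2 * cnorm (A n) (defect a b n \<ominus>\<^bsub>A n\<^esub> \<one>\<^bsub>A n\<^esub>)))"
        by (intro mult_left_mono mult_right_mono C K) (use cnorm_nonneg[OF cl] in simp)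
      finally show ?case .
    qed
  qed
qed

text \<open>For large \<open>n\<close> all four defects are within 1/4 of the unit, where
  \<open>defect_cocycle_identity\<close> holds exactly; eventual equality is equality in
  \<open>Q_C\<close>.\<close>

lemma defect_seq_cocycle:
  assumes abc: "a \<in> carrier \<Gamma>" "b \<in> carrier \<Gamma>" "c \<in> carrier \<Gamma>"
  shows "eventually (\<lambda>n. defect_seq \<Gamma> A \<tau> \<rho> b c n + defect_seq \<Gamma> A \<tau> \<rho> a (b \<otimes>\<^bsub>\<Gamma>\<^esub> c) n
    = defect_seq \<Gamma> A \<tau> \<rho> (a \<otimes>\<^bsub>\<Gamma>\<^esub> b) c n + defect_seq \<Gamma> A \<tau> \<rho> a b n) sequentially"
proof -
  have small: "eventually (\<lambda>n. cnorm (A n) (defect x y n \<ominus>\<^bsub>A n\<^esub> \<one>\<^bsub>A n\<^esub>) < 1 / 4) sequentially"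
    if "x \<in> carrier \<Gamma>" "y \<in> carrier \<Gamma>" for x y
    by (rule defect_small[OF that]) simp
  have "eventually (\<lambda>n. cnorm (A n) (defect b c n \<ominus>\<^bsub>A n\<^esub> \<one>\<^bsub>A n\<^esub>) < 1 / 4) sequentially"
    "eventually (\<lambda>n. cnorm (A n) (defect a (b \<otimes>\<^bsub>\<Gamma>\<^esub> c) n \<ominus>\<^bsub>A n\<^esub> \<one>\<^bsub>A n\<^esub>) < 1 / 4) sequentially"
    "eventually (\<lambda>n. cnorm (A n) (defect (a \<otimes>\<^bsub>\<Gamma>\<^esub> b) c n \<ominus>\<^bsub>A n\<^esub> \<one>\<^bsub>A n\<^esub>) < 1 / 4) sequentially"
    "eventually (\<lambda>n. cnorm (A n) (defect a b n \<ominus>\<^bsub>A n\<^esub> \<one>\<^bsub>A n\<^esub>) < 1 / 4) sequentially"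
    by (intro small abc \<Gamma>.m_closed)+
  then show ?thesis
  proof eventually_elim
    case (elim n)
    interpret tracial_cstar_algebra "A n" "\<tau> n" by (rule tracial)
    have "\<tau> n (cstar_log (A n) (defect b c n)) + \<tau> n (cstar_log (A n) (defect a (b \<otimes>\<^bsub>\<Gamma>\<^esub> c) n))
      = \<tau> n (cstar_log (A n) (defect (a \<otimes>\<^bsub>\<Gamma>\<^esub> b) c n)) + \<tau> n (cstar_log (A n) (defect a b n))"
      using defect_cocycle_identity[of "\<rho> n a" "\<rho> n b" "\<rho> n c" "\<rho> n (a \<otimes>\<^bsub>\<Gamma>\<^esub> b)" "\<rho> n (b \<otimes>\<^bsub>\<Gamma>\<^esub> c)" "\<rho> n (a \<otimes>\<^bsub>\<Gamma>\<^esub> b \<otimes>\<^bsub>\<Gamma>\<^esub> c)"]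
        elim abc by (simp add: unitary_apply defect_def \<Gamma>.m_assoc)
    then show ?case
      using elim by (simp add: defect_seq_eq distrib_left[symmetric] add_divide_distrib[symmetric])
  qed
qed

lemma defect_cocycle_apply:
  "a \<in> carrier \<Gamma> \<Longrightarrow> b \<in> carrier \<Gamma> \<Longrightarrow> defect_cocycle \<Gamma> A \<tau> \<rho> (a, b) = Q_class (defect_seq \<Gamma> A \<tau> \<rho> a b)"
  by (simp add: defect_cocycle_def Q_class_def)

lemma defect_cocycle_in: "defect_cocycle \<Gamma> A \<tau> \<rho> \<in> cocycles2 \<Gamma> Q_C"
proof -
  have c0: "defect_seq \<Gamma> A \<tau> \<rho> a b \<in> carrier null_seqs" if "a \<in> carrier \<Gamma>" "b \<in> carrier \<Gamma>" for a b
    using defect_seq_tendsto[OF that] by (simp add: c0_group_simps)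
  have "defect_cocycle \<Gamma> A \<tau> \<rho> \<in> carrier (cochains2 \<Gamma> Q_C)"
    using hom_in_carrier[OF Q_class_hom c0]
    by (auto simp: cochains2_def defect_cocycle_def Q_class_def)
  moreover have "defect_cocycle \<Gamma> A \<tau> \<rho> (b, c) \<otimes>\<^bsub>Q_C\<^esub> defect_cocycle \<Gamma> A \<tau> \<rho> (a, b \<otimes>\<^bsub>\<Gamma>\<^esub> c)
      = defect_cocycle \<Gamma> A \<tau> \<rho> (a \<otimes>\<^bsub>\<Gamma>\<^esub> b, c) \<otimes>\<^bsub>Q_C\<^esub> defect_cocycle \<Gamma> A \<tau> \<rho> (a, b)"
    if abc: "a \<in> carrier \<Gamma>" "b \<in> carrier \<Gamma>" "c \<in> carrier \<Gamma>" for a b c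
  proof -
    have m: "Q_class x \<otimes>\<^bsub>Q_C\<^esub> Q_class y = Q_class (\<lambda>n. x n + y n)"
      if "x \<in> carrier null_seqs" "y \<in> carrier null_seqs" for x y
      using hom_mult[OF Q_class_hom that] by (simp add: c0_group_simps)
    show ?thesis
      using abc by (simp add: defect_cocycle_apply m c0 Q_class_eqI[OF defect_seq_cocycle[OF abc]])
  qed
  ultimately show ?thesis
    by (simp add: cocycles2_def)
qed

text \<open>The evaluation is lifted to the group of null sequences, where it can be read off
  termwise, and then mapped to the quotient.\<close>

lemma eval_defect_cocycle:
  assumes c: "c \<in> cycles2 \<Gamma>"
  defines "y \<equiv> \<lambda>n. \<Sum>(a, b)\<in>Poly_Mapping.keys c. of_int (Poly_Mapping.lookup c (a, b)) * defect_seq \<Gamma> A \<tau> \<rho> a b n"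
  shows "frag_eval Q_C (defect_cocycle \<Gamma> A \<tau> \<rho>) c = Q_class y" "y \<longlonglongrightarrow> 0"
proof -
  interpret Q: comm_group Q_C by (rule comm_group_Q_C)
  interpret C0: comm_group "null_seqs" by (rule comm_group_c0)
  have keys: "Poly_Mapping.keys c \<subseteq> carrier \<Gamma> \<times> carrier \<Gamma>"
    using c by (auto simp: cycles2_def bar2_def)
  define \<omega> where "\<omega> = (\<lambda>(a, b). defect_seq \<Gamma> A \<tau> \<rho> a b)"
  have \<omega>: "\<omega> \<in> carrier \<Gamma> \<times> carrier \<Gamma> \<rightarrow> carrier null_seqs"
    using defect_seq_tendsto by (auto simp: \<omega>_def c0_group_simps)
  define z where "z = frag_eval null_seqs \<omega> c"
  have z: "z \<in> carrier null_seqs"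
    unfolding z_def by (rule C0.frag_eval_closed[OF \<omega> keys])
  have "z n = y n" for n
  proof -
    have "(\<lambda>x. x n) \<in> hom null_seqs complex_add"
      by (rule homI) (simp_all add: c0_group_simps)
    from C0.frag_eval_hom[OF comm_group_complex_add this \<omega> keys] show ?thesis
      by (simp add: z_def y_def frag_eval_complex_add \<omega>_def case_prod_unfold)
  qed
  then have zy: "z = y" by auto
  with z show "y \<longlonglongrightarrow> 0" by (simp add: c0_group_simps)
  have "Q_class z = frag_eval Q_C (\<lambda>s. Q_class (\<omega> s)) c"
    unfolding z_def by (rule C0.frag_eval_hom[OF comm_group_Q_C Q_class_hom \<omega> keys])
  also have "\<dots> = frag_eval Q_C (defect_cocycle \<Gamma> A \<tau> \<rho>) c"
  proof (rule Q.frag_eval_cong[OF _ keys])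
    show "(\<lambda>s. Q_class (\<omega> s)) \<in> carrier \<Gamma> \<times> carrier \<Gamma> \<rightarrow> carrier Q_C"
      using hom_in_carrier[OF Q_class_hom] \<omega> by (auto simp: Pi_iff)
    show "Q_class (\<omega> s) = defect_cocycle \<Gamma> A \<tau> \<rho> s" if "s \<in> Poly_Mapping.keys c" for s
      using that keys defect_cocycle_apply by (auto simp: \<omega>_def)
  qed
  finally show "frag_eval Q_C (defect_cocycle \<Gamma> A \<tau> \<rho>) c = Q_class y"
    by (simp add: zy)
qed

theorem kronecker_rho_class:
  assumes c: "c \<in> cycles2 \<Gamma>"
  shows "kronecker Q_C (rho_class \<Gamma> A \<tau> \<rho>) (homology2_class \<Gamma> c) \<in> Q_sub (\<lambda>n. K0_trace (\<tau> n) ` carrier (K0 (A n)))"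
proof -
  interpret Q: comm_group Q_C by (rule comm_group_Q_C)
  define y where "y = (\<lambda>n. \<Sum>(a, b)\<in>Poly_Mapping.keys c. of_int (Poly_Mapping.lookup c (a, b)) * defect_seq \<Gamma> A \<tau> \<rho> a b n)"
  have keys: "Poly_Mapping.keys c \<subseteq> carrier \<Gamma> \<times> carrier \<Gamma>"
    using c by (auto simp: cycles2_def bar2_def)
  \<comment> \<open>A cycle involves finitely many pairs, so one bound on \<open>n\<close> brings
    all their defects within distance 1 of the unit.\<close>
  have "eventually (\<lambda>n. \<forall>(a, b)\<in>Poly_Mapping.keys c. cnorm (A n) (defect a b n \<ominus>\<^bsub>A n\<^esub> \<one>\<^bsub>A n\<^esub>) < 1) sequentially"
    using keys by (intro eventually_ball_finite) (auto intro!: defect_small)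
  then have "eventually (\<lambda>n. y n \<in> K0_trace (\<tau> n) ` carrier (K0 (A n))) sequentially"
  proof eventually_elim
    case (elim n)
    interpret tracial_cstar_algebra "A n" "\<tau> n" by (rule tracial)
    have "y n = (\<Sum>(a, b)\<in>Poly_Mapping.keys c. of_int (Poly_Mapping.lookup c (a, b)) *
        (1 / (2 * of_real pi * \<i>) * \<tau> n (cstar_log (A n) (defect a b n))))"
      unfolding y_def using elim by (intro sum.cong refl) (auto simp: defect_seq_eq)
    then show ?case
      using cycle_log_in_K0_trace[OF group c unitary] elim by (auto simp: defect_def)
  qed
  then obtain N where N: "\<And>n. n \<ge> N \<Longrightarrow> y n \<in> K0_trace (\<tau> n) ` carrier (K0 (A n))"
    unfolding eventually_sequentially by blast
  \<comment> \<open>\<open>y n\<close> is known to be a trace of a class in \<open>K0\<close> only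
    from \<open>N\<close> on. Replacing the earlier terms by 0, which is always such a trace, does
    not change the class.\<close>
  define x where "x n = (if n \<ge> N then y n else 0)" for n
  have xy: "eventually (\<lambda>n. x n = y n) sequentially"
    unfolding x_def by (rule eventually_sequentiallyI[of N]) simp
  have zero: "0 \<in> K0_trace (\<tau> n) ` carrier (K0 (A n))" for n
  proof -
    interpret tracial_cstar_algebra "A n" "\<tau> n" by (rule tracial)
    show ?thesis by (rule zero_in_K0_trace)
  qed
  have "y \<longlonglongrightarrow> 0"
    using eval_defect_cocycle(2)[OF c] by (simp add: y_def)
  then have "x \<longlonglongrightarrow> 0"
    using tendsto_cong[OF xy] by simp
  then have "Q_class x \<in> Q_sub (\<lambda>n. K0_trace (\<tau> n) ` carrier (K0 (A n)))"
    by (rule Q_class_in_Q_sub) (use N zero in \<open>auto simp: x_def\<close>)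
  moreover have "kronecker Q_C (rho_class \<Gamma> A \<tau> \<rho>) (homology2_class \<Gamma> c) = Q_class x"
    unfolding rho_class_def Q.kronecker_eq[OF group defect_cocycle_in c] eval_defect_cocycle(1)[OF c]
      Q_class_eqI[OF xy] y_def ..
  ultimately show ?thesis by simp
qed

end

theorem proposition4p2:
  fixes \<Gamma> :: "('g, 'm) monoid_scheme"
    and A :: "nat \<Rightarrow> ('a, 'b) cstar_struct_scheme"
    and \<tau> :: "nat \<Rightarrow> 'a \<Rightarrow> complex"
    and \<rho> :: "nat \<Rightarrow> 'g \<Rightarrow> 'a"
    and c :: "'g \<times> 'g \<Rightarrow>\<^sub>0 int"
  assumes "group \<Gamma>"
    and "\<And>n. unital_cstar_algebra (A n)"
    and "\<And>n. is_trace (A n) (\<tau> n)"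
    and "bdd_above (range (\<lambda>n. functional_norm (A n) (\<tau> n)))"
    and "\<And>n. \<rho> n \<in> carrier \<Gamma> \<rightarrow> unitary_group (A n)"
    and "\<And>n. \<rho> n \<one>\<^bsub>\<Gamma>\<^esub> = \<one>\<^bsub>A n\<^esub>"
    and "\<And>a b. a \<in> carrier \<Gamma> \<Longrightarrow> b \<in> carrier \<Gamma> \<Longrightarrow>
           (\<lambda>n. cnorm (A n) (\<rho> n a \<otimes>\<^bsub>A n\<^esub> \<rho> n b \<ominus>\<^bsub>A n\<^esub> \<rho> n (a \<otimes>\<^bsub>\<Gamma>\<^esub> b))) \<longlonglongrightarrow> 0"
    and "c \<in> cycles2 \<Gamma>"
  shows "kronecker Q_C (rho_class \<Gamma> A \<tau> \<rho>) (homology2_class \<Gamma> c)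
           \<in> Q_sub (\<lambda>n. K0_trace (\<tau> n) ` carrier (K0 (A n)))"
proof -
  interpret asymptotic_representation \<Gamma> A \<tau> \<rho>
    using assms
    by (intro asymptotic_representation.intro tracial_cstar_algebra.intro tracial_cstar_algebra_axioms.intro)
  show ?thesis
    by (rule kronecker_rho_class) fact
qed

end
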